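(* Suppose $R:[0,\infty)\to[0,\infty)$ is measurable, nondecreasing, strictly concave, $R(0)=0$, twice continuously differentiable on $(0,\infty)$, with derivative $R_c$ satisfying $\lim_{C\to0}R_c(C)=\infty$ and $\lim_{C\to\infty}R_c(C)=0$; and suppose $G(C)=G_0+\frac{c_-}{f_C}C$ for some $G_0\ge0$. Then the free boundaries $\hat y_+,\hat y_-$ of the game satisfy: (1) $t\mapsto\hat y_+(t)$ and $t\mapsto\hat y_-(t)$ are decreasing; (2) $\hat y_+$ is left-continuous and $\hat y_-$ is right-continuous; (3) $0<\hat y_+(t)<R_c^{-1}\big(\frac{\bar\mu c_+}{f_C}\big)$ for $t\in[0,T)$; (4) $\lim_{t\uparrow T}\hat y_+(t)=0$; (5) $0<R_c^{-1}\big(\frac{\bar\mu c_-}{f_C}\big)<\hat y_-(t)<+\infty$ for $t\in[0,T)$; (6) $\lim_{t\uparrow T}\hat y_-(t)=R_c^{-1}\big(\frac{\bar\mu c_-}{f_C}\big)$.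
   Context: Constants: $T>0$, $\mu_C,\sigma_C,f_C,\mu_F>0$, $c_+>c_->0$; $\bar\mu:=\mu_C+\mu_F$, $\hat\mu_C:=-\mu_C+\frac12\sigma_C^2$. $(\Omega,\mathcal F,\mathbb P)$ is a complete probability space with a Brownian motion $W$ and its augmented natural filtration $\mathbb F=\{\mathcal F_t\}$. The measure $\tilde{\mathbb P}$ (expectation $\tilde{\mathbb E}$) is defined by $d\tilde{\mathbb P}/d\mathbb P|_{\mathcal F_t}=\exp\{-\frac12\sigma_C^2t+\sigma_CW(t)\}$, so $\tilde W(t)=W(t)-\sigma_Ct$ is a $\tilde{\mathbb P}$-Brownian motion, and $C^0(t)=\exp\{\hat\mu_Ct+\sigma_C\tilde W(t)\}$. For $(t,y)\in[0,T]\times(0,\infty)$ and $\mathbb F$-stopping times $\sigma,\tau$ with values in $[0,T-t]$ set $$\Psi(t,y;\sigma,\tau)=\tilde{\mathbb E}\Big\{\tfrac{c_+}{f_C}e^{-\bar\mu\sigma}\mathbf 1_{\{\sigma\le\tau\}}\mathbf 1_{\{\sigma<T-t\}}+\tfrac{c_-}{f_C}e^{-\bar\mu\tau}\mathbf 1_{\{\tau<\sigma\}}+e^{-\bar\mu(T-t)}G_c(yC^0(T-t))\mathbf 1_{\{\tau=\sigma=T-t\}}+\int_0^{\tau\wedge\sigma}e^{-\bar\mu s}R_c(yC^0(s))ds\Big\},$$ where $G_c=G'$ (here $G_c\equiv c_-/f_C$). The value of the game is $$v(t,y)=\inf_{\sigma\in[0,T-t]}\sup_{\tau\in[0,T-t]}\Psi(t,y;\sigma,\tau)=\sup_{\tau\in[0,T-t]}\inf_{\sigma\in[0,T-t]}\Psi(t,y;\sigma,\tau)$$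 (the game has a value), and $c_-/f_C\le v\le c_+/f_C$. For $t\in[0,T)$, the free boundaries are the numbers $0\le\hat y_+(t)<\hat y_-(t)\le\infty$ such that $\{y>0:\frac{c_-}{f_C}<v(t,y)<\frac{c_+}{f_C}\}=(\hat y_+(t),\hat y_-(t))$, $\{y>0:v(t,y)=\frac{c_+}{f_C}\}=(0,\hat y_+(t)]$ and $\{y>0:v(t,y)=\frac{c_-}{f_C}\}=[\hat y_-(t),\infty)$. "Decreasing" is meant in the weak sense (nonincreasing). $R_c^{-1}:(0,\infty)\to(0,\infty)$ is the inverse of $R_c$. *)

theory Defs
  imports "HOL-Probability.Probability"
begin

definition strictly_concave_on :: "real set \<Rightarrow> (real \<Rightarrow> real) \<Rightarrow> bool" where
  "strictly_concave_on S f \<longleftrightarrow> convex S \<and>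
     (\<forall>x\<in>S. \<forall>y\<in>S. \<forall>u. x \<noteq> y \<longrightarrow> 0 < u \<longrightarrow> u < 1 \<longrightarrow>
        (1 - u) * f x + u * f y < f ((1 - u) * x + u * y))"

definition marginal_inverse :: "(real \<Rightarrow> real) \<Rightarrow> real \<Rightarrow> real" where
  "marginal_inverse R = the_inv_into {0<..} (deriv R)"

definition brownian_motion :: "'a measure \<Rightarrow> (real \<Rightarrow> 'a \<Rightarrow> real) \<Rightarrow> bool" where
  "brownian_motion M W \<longleftrightarrow>
     (\<forall>t\<ge>0. W t \<in> borel_measurable M) \<and>
     (AE \<omega> in M. W 0 \<omega> = 0) \<and>
     (AE \<omega> in M. continuous_on {0..} (\<lambda>t. W t \<omega>)) \<and>
     (\<forall>s t. 0 \<le> s \<longrightarrow> s < t \<longrightarrow>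
        distributed M lborel (\<lambda>\<omega>. W t \<omega> - W s \<omega>) (normal_density 0 (sqrt (t - s)))) \<and>
     (\<forall>(n::nat) t. 0 \<le> t 0 \<longrightarrow> (\<forall>i<n. t i < t (Suc i)) \<longrightarrow>
        prob_space.indep_vars M (\<lambda>_. borel) (\<lambda>i \<omega>. W (t (Suc i)) \<omega> - W (t i) \<omega>) {..<n})"

text \<open>
  The augmentation adds all null sets of \<open>M\<close>. For \<open>t < 0\<close> the definition yields the \<open>\<sigma>\<close>-algebra
  generated by the null sets, which imposes nothing on nonnegative stopping times.
\<close>

definition augmented_filtration :: "'a measure \<Rightarrow> (real \<Rightarrow> 'a \<Rightarrow> real) \<Rightarrow> real \<Rightarrow> 'a measure" where
  "augmented_filtration M W t =
     sigma (space M)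
       ({W s -` A \<inter> space M | s A. 0 \<le> s \<and> s \<le> t \<and> A \<in> sets borel} \<union> null_sets M)"

text \<open>
  \<open>P\<close> has density \<open>exp (- \<sigma>\<^sup>2 t / 2 + \<sigma> W t)\<close> relative to \<open>M\<close> on the \<open>\<sigma>\<close>-algebra at time \<open>t\<close>,
  for every \<open>t\<close> up to the horizon \<open>T\<close>. The horizon must be finite: the augmented \<open>\<sigma>\<close>-algebra at
  time 0 contains \<open>M\<close>-null tail events that would have full measure if the relation held for all
  \<open>t \<ge> 0\<close>, so no such \<open>P\<close> would exist. The game uses only times up to \<open>T\<close>.
\<close>

definition girsanov_measure ::
  "'a measure \<Rightarrow> (real \<Rightarrow> 'a \<Rightarrow> real) \<Rightarrow> real \<Rightarrow> real \<Rightarrow> 'a measure \<Rightarrow> bool" where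
  "girsanov_measure M W \<sigma> T P \<longleftrightarrow>
     sets P = sets M \<and>
     (\<forall>t\<in>{0..T}.
        restr_to_subalg P (augmented_filtration M W t) =
        density (restr_to_subalg M (augmented_filtration M W t))
          (\<lambda>\<omega>. ennreal (exp (- (1/2) * \<sigma>\<^sup>2 * t + \<sigma> * W t \<omega>))))"

definition W_tilde :: "real \<Rightarrow> (real \<Rightarrow> 'a \<Rightarrow> real) \<Rightarrow> real \<Rightarrow> 'a \<Rightarrow> real" where
  "W_tilde \<sigma> W t \<omega> = W t \<omega> - \<sigma> * t"

definition C0 :: "real \<Rightarrow> real \<Rightarrow> (real \<Rightarrow> 'a \<Rightarrow> real) \<Rightarrow> real \<Rightarrow> 'a \<Rightarrow> real" where
  "C0 \<mu> \<sigma> W t \<omega> = exp ((- \<mu> + 1/2 * \<sigma>\<^sup>2) * t + \<sigma> * W_tilde \<sigma> W t \<omega>)"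

definition stopping_times_upto ::
  "'a measure \<Rightarrow> (real \<Rightarrow> 'a measure) \<Rightarrow> real \<Rightarrow> ('a \<Rightarrow> real) set" where
  "stopping_times_upto M F h = {\<tau>. stopping_time F \<tau> \<and> (\<forall>\<omega>\<in>space M. 0 \<le> \<tau> \<omega> \<and> \<tau> \<omega> \<le> h)}"

text \<open>
  The minimizer chooses \<open>\<sigma>\<close>, the maximizer \<open>\<tau>\<close>; \<open>X\<close> is the state process started from 1, and
  \<open>r\<close> is the discount rate.
\<close>

definition game_payoff ::
  "'a measure \<Rightarrow> (real \<Rightarrow> 'a \<Rightarrow> real) \<Rightarrow> (real \<Rightarrow> real) \<Rightarrow> (real \<Rightarrow> real) \<Rightarrow>
   real \<Rightarrow> real \<Rightarrow> real \<Rightarrow> real \<Rightarrow> real \<Rightarrow>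
   real \<Rightarrow> real \<Rightarrow> ('a \<Rightarrow> real) \<Rightarrow> ('a \<Rightarrow> real) \<Rightarrow> real" where
  "game_payoff P X Rc Gc r cp cm fC T t y \<sigma> \<tau> =
     (\<integral>\<omega>. cp / fC * exp (- r * \<sigma> \<omega>) * of_bool (\<sigma> \<omega> \<le> \<tau> \<omega>) * of_bool (\<sigma> \<omega> < T - t)
         + cm / fC * exp (- r * \<tau> \<omega>) * of_bool (\<tau> \<omega> < \<sigma> \<omega>)
         + exp (- r * (T - t)) * Gc (y * X (T - t) \<omega>) * of_bool (\<tau> \<omega> = T - t \<and> \<sigma> \<omega> = T - t)
         + (LINT s:{0..min (\<tau> \<omega>) (\<sigma> \<omega>)}|lborel. exp (- r * s) * Rc (y * X s \<omega>))
       \<partial>P)"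

text \<open>
  \<open>S h\<close> is the set of strategies, for both players, when the remaining time is \<open>h\<close>. The
  infima and suprema are taken in the conditionally complete lattice of the reals. In the game
  considered here they are over nonempty bounded sets, because the payoff at a given \<open>(t, y)\<close>
  is nonnegative and bounded above uniformly in \<open>\<sigma>\<close> and \<open>\<tau>\<close>.
\<close>

definition is_game_value ::
  "(real \<Rightarrow> ('a \<Rightarrow> real) set) \<Rightarrow>
   (real \<Rightarrow> real \<Rightarrow> ('a \<Rightarrow> real) \<Rightarrow> ('a \<Rightarrow> real) \<Rightarrow> real) \<Rightarrow>
   real \<Rightarrow> (real \<Rightarrow> real \<Rightarrow> real) \<Rightarrow> bool" where
  "is_game_value S \<Psi> T v \<longleftrightarrow>
     (\<forall>t\<in>{0..T}. \<forall>y>0.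
        v t y = (INF \<sigma>\<in>S (T - t). SUP \<tau>\<in>S (T - t). \<Psi> t y \<sigma> \<tau>) \<and>
        v t y = (SUP \<tau>\<in>S (T - t). INF \<sigma>\<in>S (T - t). \<Psi> t y \<sigma> \<tau>))"

text \<open>
  \<open>lo\<close> and \<open>hi\<close> are the payments on exercise by the maximizer and by the minimizer. The upper
  boundary may be infinite; the lower one cannot, since it lies strictly below the upper one.
\<close>

definition free_boundaries ::
  "real \<Rightarrow> real \<Rightarrow> real \<Rightarrow> (real \<Rightarrow> real \<Rightarrow> real) \<Rightarrow> (real \<Rightarrow> real) \<Rightarrow> (real \<Rightarrow> ereal) \<Rightarrow> bool" where
  "free_boundaries T lo hi v yp ym \<longleftrightarrow>
     (\<forall>t\<in>{0..<T}.
        0 \<le> yp t \<and> ereal (yp t) < ym t \<and>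
        {y. 0 < y \<and> lo < v t y \<and> v t y < hi} = {y. yp t < y \<and> ereal y < ym t} \<and>
        {y. 0 < y \<and> v t y = hi} = {0<..yp t} \<and>
        {y. 0 < y \<and> v t y = lo} = {y. ym t \<le> ereal y})"

end

theory Submission
  imports Defs
begin

text \<open>
  Write \<open>a = c\<^sub>- / f\<^sub>C\<close>, \<open>b = c\<^sub>+ / f\<^sub>C\<close>, \<open>r = \<mu>\<^sub>C + \<mu>\<^sub>F\<close>, \<open>f = R'\<close> and \<open>h = T - t\<close>. Since \<open>G' = a\<close>, the payoff is
  \<open>a\<close> plus the accrued integral of \<open>exp (- r s) (f (y X\<^sub>s) - r a)\<close> plus the discounted premium \<open>b - a\<close> if the
  minimizer stops first and before \<open>h\<close>; symmetrically it can be written relative to \<open>b\<close>. Comparing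
  strategies for two horizons shows that the value increases in \<open>h\<close> and is Lipschitz in \<open>h\<close> for
  fixed \<open>y\<close>, which gives monotonicity and one-sided continuity of the boundaries.

  If \<open>y\<close> is small, never stopping secures \<open>b\<close> for the maximizer; if \<open>y\<close> is large, or \<open>h\<close> is small and
  \<open>f y < r a\<close>, never stopping secures \<open>a\<close> for the minimizer. In both cases the rate has the favourable
  sign except where \<open>X\<close> is far from 1, and this is controlled by bounding the expected integral of
  \<open>(X\<^sup>\<plusminus>\<^sup>1 - 1)\<^sup>2\<close> up to a stopping time \<open>\<sigma>\<close> by a multiple of \<open>h E \<sigma>\<close>.

  At the critical levels \<open>f y = r b\<close> and \<open>f y = r a\<close> the strict inequalities \<open>v < b\<close> and \<open>v > a\<close> come from
  a short asymmetric strategy: stop as soon as \<open>log X\<close> has moved by a tiny \<open>x\<close> in the unfavourable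
  direction. By a reflection argument the favourable excursions have probability of order \<open>x\<close>,
  whereas the loss is \<open>o(x)\<close>.
\<close>

section \<open>Gaussian measures\<close>

text \<open>Every bound on the value tests one explicit strategy against all replies: the inf-sup
  form serves upper bounds, the sup-inf form lower ones. The state enters only through
  \<open>Z\<close>, the logarithm of \<open>C0\<close>, whose increments under \<open>P\<close> are
  Gaussian and independent of the past. The obstacle is the critical level: there the net rate is
  zero at the start and its sign depends on the side to which the path moves, so a rule treating
  both sides alike settles nothing. The asymmetric rule cuts the bad side at depth \<open>x\<close>
  and leaves the good side free. For fixed \<open>x\<close> the passage time is taken on finite
  grids, so that both the stopping property and the reflection argument rest on the simple Markov
  property; the mesh then tends to 0. In the occupation bound, the squared deviation at a fixed time
  before \<sigma> is already of order \<open>E \<sigma>\<close>, and integration over time adds the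
  factor \<open>h\<close>. This is the form in which a gain linear in \<sigma> can absorb the rare
  excursions, whatever stopping time the opponent uses.\<close>

abbreviation gauss :: "real \<Rightarrow> real \<Rightarrow> real measure" where
  "gauss \<mu> \<sigma> \<equiv> density lborel (\<lambda>x. ennreal (normal_density \<mu> \<sigma> x))"

text \<open>Completing the square: an exponential weight shifts the mean by
  \<open>k * \<sigma>\<^sup>2\<close> and leaves the variance unchanged.\<close>

lemma normal_density_tilt:
  "\<sigma> > 0 \<Longrightarrow> normal_density \<mu> \<sigma> x * exp (k * x) =
    exp (k * \<mu> + k\<^sup>2 * \<sigma>\<^sup>2 / 2) * normal_density (\<mu> + k * \<sigma>\<^sup>2) \<sigma> x"
proof -
  assume s: "\<sigma> > 0"
  have "- (x - \<mu>)\<^sup>2 / (2 * \<sigma>\<^sup>2) + k * x =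
      (k * \<mu> + k\<^sup>2 * \<sigma>\<^sup>2 / 2) + - (x - (\<mu> + k * \<sigma>\<^sup>2))\<^sup>2 / (2 * \<sigma>\<^sup>2)"
    using s by (simp add: field_simps power2_eq_square)
  then show ?thesis
    by (simp add: normal_density_def exp_add[symmetric])
qed

lemma gauss_exp_moment:
  assumes "\<sigma> > 0"
  shows "has_bochner_integral (gauss \<mu> \<sigma>) (\<lambda>x. exp (k * x)) (exp (k * \<mu> + k\<^sup>2 * \<sigma>\<^sup>2 / 2))"
proof -
  have "has_bochner_integral lborel
      (\<lambda>x. exp (k * \<mu> + k\<^sup>2 * \<sigma>\<^sup>2 / 2) * normal_density (\<mu> + k * \<sigma>\<^sup>2) \<sigma> x)
      (exp (k * \<mu> + k\<^sup>2 * \<sigma>\<^sup>2 / 2) * 1)"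
    using assms by (intro has_bochner_integral_mult_right) (simp add: has_bochner_integral_iff)
  then show ?thesis
    by (subst has_bochner_integral_density) (simp_all add: normal_density_tilt[OF assms])
qed

lemma prob_space_gauss: "\<sigma> > 0 \<Longrightarrow> prob_space (gauss \<mu> \<sigma>)"
  by (rule prob_space_normal_density)

lemma gauss_neg:
  assumes "\<sigma> > 0" "B \<in> sets borel"
  shows "measure (gauss \<mu> \<sigma>) (uminus -` B) = measure (gauss (- \<mu>) \<sigma>) B"
proof -
  have m: "uminus -` B \<in> sets (borel::real measure)"
    using measurable_sets[of uminus borel borel B] assms by simp
  have "emeasure (gauss \<mu> \<sigma>) (uminus -` B) =
      (\<integral>\<^sup>+x. ennreal (normal_density \<mu> \<sigma> x) * indicator B (- x) \<partial>lborel)"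
    using m by (subst emeasure_density) (auto intro!: nn_integral_cong simp: indicator_def)
  also have "\<dots> = (\<integral>\<^sup>+x. ennreal (normal_density \<mu> \<sigma> (- x)) * indicator B x \<partial>lborel)"
    using assms by (subst nn_integral_real_affine[where c="-1" and t=0]) (auto simp: ac_simps)
  also have "\<dots> = emeasure (gauss (- \<mu>) \<sigma>) B"
    using assms by (subst emeasure_density)
      (auto intro!: nn_integral_cong simp: normal_density_def power2_eq_square algebra_simps)
  finally show ?thesis by (simp add: measure_def)
qed

lemma normal_density_le:
  assumes "\<sigma> > 0" shows "normal_density \<mu> \<sigma> x \<le> 1 / \<sigma>"
proof -
  have "sqrt (2 * pi * \<sigma>\<^sup>2) \<ge> sqrt (\<sigma>\<^sup>2)"
    using pi_gt3 by (intro real_sqrt_le_mono) (simp add: mult_le_cancel_right1)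
  then have "\<sigma> \<le> sqrt (2 * pi * \<sigma>\<^sup>2)" using assms by simp
  then have "1 / sqrt (2 * pi * \<sigma>\<^sup>2) \<le> 1 / \<sigma>" using assms by (simp add: frac_le)
  then have "1 / sqrt (2 * pi * \<sigma>\<^sup>2) * exp (-(x - \<mu>)\<^sup>2/ (2 * \<sigma>\<^sup>2)) \<le> 1 / \<sigma> * 1"
    using assms by (intro mult_mono) auto
  then show ?thesis by (simp add: normal_density_def)
qed

text \<open>Here \<open>u\<close> plays the current value \<open>exp (k * Z s)\<close>, so the
  integrand is the squared deviation of the exponential from 1 one increment later.\<close>

lemma gauss_square_moment:
  assumes "\<sigma> > 0"
  shows "(\<integral>\<^sup>+d. ennreal ((u * exp (k * d) - 1)\<^sup>2) \<partial>gauss \<mu> \<sigma>) =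
    ennreal (u\<^sup>2 * exp (2 * k * \<mu> + 2 * k\<^sup>2 * \<sigma>\<^sup>2) - 2 * u * exp (k * \<mu> + k\<^sup>2 * \<sigma>\<^sup>2 / 2) + 1)"
proof -
  interpret prob_space "gauss \<mu> \<sigma>" using assms by (rule prob_space_gauss)
  have one: "has_bochner_integral (gauss \<mu> \<sigma>) (\<lambda>d. 1) (1::real)"
    using prob_space by (simp add: has_bochner_integral_iff)
  have "has_bochner_integral (gauss \<mu> \<sigma>)
     (\<lambda>d. u\<^sup>2 * exp ((2 * k) * d) - 2 * u * exp (k * d) + 1)
     (u\<^sup>2 * exp ((2 * k) * \<mu> + (2 * k)\<^sup>2 * \<sigma>\<^sup>2 / 2) - 2 * u * exp (k * \<mu> + k\<^sup>2 * \<sigma>\<^sup>2 / 2) + 1)"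
    using assms one
    by (intro has_bochner_integral_add has_bochner_integral_diff has_bochner_integral_mult_right
        gauss_exp_moment) auto
  also have "(\<lambda>d. u\<^sup>2 * exp ((2 * k) * d) - 2 * u * exp (k * d) + 1) = (\<lambda>d. (u * exp (k * d) - 1)\<^sup>2)"
    by (auto simp: power2_eq_square algebra_simps mult_exp_exp)
  finally have "(\<integral>\<^sup>+d. ennreal ((u * exp (k * d) - 1)\<^sup>2) \<partial>gauss \<mu> \<sigma>) =
     ennreal (u\<^sup>2 * exp ((2 * k) * \<mu> + (2 * k)\<^sup>2 * \<sigma>\<^sup>2 / 2) - 2 * u * exp (k * \<mu> + k\<^sup>2 * \<sigma>\<^sup>2 / 2) + 1)"
    by (subst nn_integral_eq_integral) (auto simp: has_bochner_integral_iff)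
  then show ?thesis by (simp add: power2_eq_square field_simps)
qed

lemma exp_linear_bound:
  fixes c d T :: real
  assumes "0 \<le> d" "d \<le> T"
  shows "\<bar>exp (c * d) - 1\<bar> \<le> \<bar>c\<bar> * exp (\<bar>c\<bar> * T) * d"
proof -
  have "norm (exp (c * d) - exp 0) \<le> exp (\<bar>c\<bar> * T) * norm (c * d - 0)"
  proof (rule field_differentiable_bound[where S="{- \<bar>c\<bar> * T .. \<bar>c\<bar> * T}" and f'=exp])
    show "(exp has_field_derivative exp z) (at z within {- \<bar>c\<bar> * T..\<bar>c\<bar> * T})" for z :: real
      by (auto intro!: derivative_eq_intros)
    have "\<bar>c * d\<bar> \<le> \<bar>c\<bar> * T" using assms by (simp add: abs_mult mult_left_mono)
    then show "c * d \<in> {- \<bar>c\<bar> * T..\<bar>c\<bar> * T}" by (auto simp: abs_le_iff)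
  qed (use assms in auto)
  then show ?thesis using assms by (simp add: abs_mult ac_simps)
qed

text \<open>Both exponents in the second moment are linear in the time step \<open>d\<close>, so
  each exponential is \<open>1 + O(d)\<close> uniformly for \<open>d \<le> T\<close>. The result is
  one step of a discrete Gronwall argument, with \<open>c\<close> independent of \<open>d\<close>
  and \<open>u\<close>.\<close>

lemma gauss_square_growth:
  fixes m \<sigma> T k :: real
  assumes "\<sigma> > 0"
  shows "\<exists>c\<ge>0. \<forall>d u. 0 < d \<longrightarrow> d \<le> T \<longrightarrow> 0 \<le> u \<longrightarrow>
    (\<integral>\<^sup>+x. ennreal ((u * exp (k * x) - 1)\<^sup>2) \<partial>gauss (m * d) (\<sigma> * sqrt d)) \<le>
      ennreal ((1 + c * d) * (u - 1)\<^sup>2 + c * d)"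
proof -
  define c2 where "c2 = 2 * k * m + 2 * k\<^sup>2 * \<sigma>\<^sup>2"
  define c1 where "c1 = k * m + k\<^sup>2 * \<sigma>\<^sup>2 / 2"
  define K where "K = \<bar>c2\<bar> * exp (\<bar>c2\<bar> * T) + \<bar>c1\<bar> * exp (\<bar>c1\<bar> * T)"
  have K: "K \<ge> 0" by (simp add: K_def)
  have "(\<integral>\<^sup>+x. ennreal ((u * exp (k * x) - 1)\<^sup>2) \<partial>gauss (m * d) (\<sigma> * sqrt d)) \<le>
      ennreal ((1 + 5 * K * d) * (u - 1)\<^sup>2 + 5 * K * d)" if d: "0 < d" "d \<le> T" and u: "0 \<le> u" for d u
  proof -
    have b2: "exp (c2 * d) - 1 \<le> K * d"
    proof -
      have "exp (c2 * d) - 1 \<le> \<bar>c2\<bar> * exp (\<bar>c2\<bar> * T) * d"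
        using exp_linear_bound[of d T c2] d by linarith
      also have "\<dots> \<le> K * d" using d by (intro mult_right_mono) (auto simp: K_def)
      finally show ?thesis .
    qed
    have b1: "1 - exp (c1 * d) \<le> K * d"
    proof -
      have "1 - exp (c1 * d) \<le> \<bar>c1\<bar> * exp (\<bar>c1\<bar> * T) * d"
        using exp_linear_bound[of d T c1] d by linarith
      also have "\<dots> \<le> K * d" using d by (intro mult_right_mono) (auto simp: K_def)
      finally show ?thesis .
    qed
    have "u\<^sup>2 * exp (c2 * d) - 2 * u * exp (c1 * d) + 1
        = (u - 1)\<^sup>2 + u\<^sup>2 * (exp (c2 * d) - 1) + 2 * u * (1 - exp (c1 * d))"
      by (simp add: power2_eq_square algebra_simps)
    also have "\<dots> \<le> (u - 1)\<^sup>2 + u\<^sup>2 * (K * d) + 2 * u * (K * d)"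
      using b1 b2 u by (intro add_mono mult_left_mono) auto
    also have "\<dots> = (u - 1)\<^sup>2 + K * d * (u\<^sup>2 + 2 * u)" by (simp add: algebra_simps)
    also have "\<dots> \<le> (u - 1)\<^sup>2 + K * d * (5 * (u - 1)\<^sup>2 + 5)"
    proof -
      \<comment> \<open>This square is exactly
        \<open>5 * (u - 1)\<^sup>2 + 4 - (u\<^sup>2 + 2 * u)\<close>; it trades growth in
        \<open>u\<close> for growth in \<open>u - 1\<close>.\<close>
      have "0 \<le> (2 * u - 3) * (2 * u - 3)" by simp
      then have "u\<^sup>2 + 2 * u \<le> 5 * (u - 1)\<^sup>2 + 5"
        by (simp add: power2_eq_square algebra_simps)
      then show ?thesis using K d by (intro add_left_mono mult_left_mono) auto
    qed
    also have "\<dots> = (1 + 5 * K * d) * (u - 1)\<^sup>2 + 5 * K * d" by (simp add: algebra_simps)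
    finally have *: "u\<^sup>2 * exp (c2 * d) - 2 * u * exp (c1 * d) + 1 \<le> \<dots>" .
    have "(\<integral>\<^sup>+x. ennreal ((u * exp (k * x) - 1)\<^sup>2) \<partial>gauss (m * d) (\<sigma> * sqrt d)) =
        ennreal (u\<^sup>2 * exp (c2 * d) - 2 * u * exp (c1 * d) + 1)"
      using assms d by (subst gauss_square_moment)
        (auto simp: c1_def c2_def power_mult_distrib algebra_simps)
    then show ?thesis using * by (simp add: ennreal_leI)
  qed
  then show ?thesis using K by (intro exI[of _ "5 * K"]) auto
qed

section \<open>Brownian motion with drift\<close>

text \<open>\<open>Z_incr\<close> states at once that an increment is independent of
  \<open>F s\<close> and what its law is. Continuity and the start at 0 are required for every point
  of the space, so that pathwise arguments carry no exceptional set; \<open>girsanov_drifted\<close>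
  removes that set when the locale is instantiated.\<close>

locale drifted_brownian_motion =
  prob_space P + filtration "space P" F for P :: "'a measure" and F :: "real \<Rightarrow> 'a measure" +
  fixes Z :: "real \<Rightarrow> 'a \<Rightarrow> real" and m \<kappa> T :: real
  assumes T_pos: "0 < T" and vol_pos: "0 < \<kappa>"
    and sets_F_le: "sets (F t) \<subseteq> sets P"
    and Z_adapted: "0 \<le> s \<Longrightarrow> s \<le> T \<Longrightarrow> Z s \<in> borel_measurable (F s)"
    and Z_cont: "\<omega> \<in> space P \<Longrightarrow> continuous_on {0..T} (\<lambda>s. Z s \<omega>)"
    and Z_0: "\<omega> \<in> space P \<Longrightarrow> Z 0 \<omega> = 0"
    and Z_incr: "0 \<le> s \<Longrightarrow> s < u \<Longrightarrow> u \<le> T \<Longrightarrow> A \<in> sets (F s) \<Longrightarrow> B \<in> sets borel \<Longrightarrow>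
      prob (A \<inter> {\<omega>\<in>space P. Z u \<omega> - Z s \<omega> \<in> B}) =
      prob A * measure (gauss (m * (u - s)) (\<kappa> * sqrt (u - s))) B"
begin

abbreviation law :: "real \<Rightarrow> real measure" where
  "law s \<equiv> gauss (m * s) (\<kappa> * sqrt s)"

lemma measurable_F_imp: "f \<in> measurable (F s) N \<Longrightarrow> f \<in> measurable P N"
  using sets_F_le[of s] space_F[of s] by (auto simp: measurable_def)

lemma measurable_F_mono: "f \<in> measurable (F s) N \<Longrightarrow> s \<le> u \<Longrightarrow> f \<in> measurable (F u) N"
  using sets_F_mono[of s u] space_F[of s] space_F[of u] by (auto simp: measurable_def)

lemma Z_measurable: "0 \<le> s \<Longrightarrow> s \<le> T \<Longrightarrow> Z s \<in> borel_measurable P"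
  by (blast intro: measurable_F_imp Z_adapted)

text \<open>Lets one construction of a short stopping time serve both players, whose favourable
  directions are opposite.\<close>

lemma mirrored: "drifted_brownian_motion P F (\<lambda>s \<omega>. - Z s \<omega>) (- m) \<kappa> T"
proof unfold_locales
  show "0 < T" "0 < \<kappa>" "sets (F t) \<subseteq> events" for t
    using T_pos vol_pos sets_F_le by auto
  show "(\<lambda>\<omega>. - Z s \<omega>) \<in> borel_measurable (F s)" if "0 \<le> s" "s \<le> T" for s
    using Z_adapted[OF that] by measurable
  show "continuous_on {0..T} (\<lambda>s. - Z s \<omega>)" if "\<omega> \<in> space P" for \<omega>
    using Z_cont[OF that] by (intro continuous_intros)
  show "- Z 0 \<omega> = 0" if "\<omega> \<in> space P" for \<omega> using Z_0[OF that] by simp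
  show "prob (A \<inter> {\<omega> \<in> space P. - Z u \<omega> - - Z s \<omega> \<in> B}) =
       prob A * measure (gauss (- m * (u - s)) (\<kappa> * sqrt (u - s))) B"
    if *: "0 \<le> s" "s < u" "u \<le> T" "A \<in> sets (F s)" and B: "B \<in> sets borel" for s u A B
  proof -
    have B': "uminus -` B \<in> sets (borel::real measure)"
      using measurable_sets[of uminus borel borel B] B by simp
    have "{\<omega> \<in> space P. - Z u \<omega> - - Z s \<omega> \<in> B} = {\<omega> \<in> space P. Z u \<omega> - Z s \<omega> \<in> uminus -` B}"
      by auto
    then show ?thesis
      using Z_incr[OF * B'] gauss_neg[OF _ B, of "\<kappa> * sqrt (u - s)" "m * (u - s)"] * vol_pos by simp
  qed
qed

lemma distr_increment:
  assumes "0 \<le> s" "s < u" "u \<le> T"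
  shows "distr P borel (\<lambda>\<omega>. Z u \<omega> - Z s \<omega>) = law (u - s)"
proof (rule measure_eqI)
  have [measurable]: "Z u \<in> borel_measurable P" "Z s \<in> borel_measurable P"
    using assms by (auto intro: Z_measurable)
  interpret L: prob_space "law (u - s)" using assms vol_pos by (intro prob_space_gauss) simp
  fix B assume "B \<in> sets (distr P borel (\<lambda>\<omega>. Z u \<omega> - Z s \<omega>))"
  then have B: "B \<in> sets borel" by simp
  have sp: "space P \<in> sets (F s)" using space_F[of s] sets.top[of "F s"] by simp
  have "prob {\<omega> \<in> space P. Z u \<omega> - Z s \<omega> \<in> B} = measure (law (u - s)) B"
    using Z_incr[OF assms sp B] by (simp add: prob_space Int_absorb1 subset_eq)
  then have "prob ((\<lambda>\<omega>. Z u \<omega> - Z s \<omega>) -` B \<inter> space P) = measure (law (u - s)) B"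
    by (simp add: vimage_def Int_def conj_commute)
  then show "emeasure (distr P borel (\<lambda>\<omega>. Z u \<omega> - Z s \<omega>)) B = emeasure (law (u - s)) B"
    using B by (simp add: emeasure_distr emeasure_eq_measure L.emeasure_eq_measure)
qed simp

lemma distr_Z:
  assumes "0 < s" "s \<le> T"
  shows "distr P borel (Z s) = law s"
proof -
  have "distr P borel (Z s) = distr P borel (\<lambda>\<omega>. Z s \<omega> - Z 0 \<omega>)"
    by (rule distr_cong) (auto simp: Z_0)
  then show ?thesis using distr_increment[of 0 s] assms by simp
qed

lemma indep_increment:
  assumes "0 \<le> s" "s < u" "u \<le> T" and Y: "Y \<in> borel_measurable (F s)"
  shows "indep_var borel Y borel (\<lambda>\<omega>. Z u \<omega> - Z s \<omega>)"
proof -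
  have [measurable]: "Z u \<in> borel_measurable P" "Z s \<in> borel_measurable P"
    using assms by (auto intro: Z_measurable)
  have Y'[measurable]: "Y \<in> borel_measurable P" using Y by (rule measurable_F_imp)
  let ?D = "\<lambda>\<omega>. Z u \<omega> - Z s \<omega>"
  have sp: "space P \<in> sets (F s)" using space_F[of s] sets.top[of "F s"] by simp
  have D: "prob {\<omega> \<in> space P. ?D \<omega> \<in> B} = measure (law (u - s)) B" if "B \<in> sets borel" for B
    using Z_incr[OF assms(1-3) sp that] by (simp add: prob_space Int_absorb1 subset_eq)
  have st: "Int_stable {X -` A \<inter> space P |A. A \<in> sets borel}" for X :: "'a \<Rightarrow> real"
  proof (rule Int_stableI)
    fix a b assume "a \<in> {X -` A \<inter> space P |A. A \<in> sets borel}" "b \<in> {X -` A \<inter> space P |A. A \<in> sets borel}"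
    then obtain A B where "A \<in> sets borel" "B \<in> sets borel" "a = X -` A \<inter> space P" "b = X -` B \<inter> space P"
      by auto
    then show "a \<inter> b \<in> {X -` A \<inter> space P |A. A \<in> sets borel}"
      by (intro CollectI exI[of _ "A \<inter> B"]) auto
  qed
  show ?thesis
    unfolding indep_var_eq
  proof (intro conjI indep_set_sigma_sets st indep_setI)
    show "{Y -` A \<inter> space P |A. A \<in> sets borel} \<subseteq> events"
      "{?D -` A \<inter> space P |A. A \<in> sets borel} \<subseteq> events" by auto
    fix a b assume "a \<in> {Y -` A \<inter> space P |A. A \<in> sets borel}" "b \<in> {?D -` A \<inter> space P |A. A \<in> sets borel}"
    then obtain A B where AB: "A \<in> sets borel" "B \<in> sets borel"
      and a: "a = Y -` A \<inter> space P" and b: "b = ?D -` B \<inter> space P" by auto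
    have a': "a \<in> sets (F s)" using measurable_sets[OF Y AB(1)] space_F[of s] a by simp
    have b': "b = {\<omega> \<in> space P. ?D \<omega> \<in> B}" using b by auto
    show "prob (a \<inter> b) = prob a * prob b"
      using Z_incr[OF assms(1-3) a' AB(2)] D[OF AB(2)] b' by simp
  qed auto
qed

text \<open>The simple Markov property: the increment is integrated out while \<open>Y\<close> stays
  frozen. Since \<open>Y\<close> is any \<open>F s\<close>-measurable variable, it can also carry
  the information whether a stopping time has been reached.\<close>

lemma nn_integral_increment:
  fixes Y :: "'a \<Rightarrow> real"
  assumes "0 \<le> s" "s < u" "u \<le> T" and Y: "Y \<in> borel_measurable (F s)"
    and H[measurable]: "H \<in> borel_measurable (borel \<Otimes>\<^sub>M borel)"
  shows "(\<integral>\<^sup>+\<omega>. H (Y \<omega>, Z u \<omega> - Z s \<omega>) \<partial>P) = (\<integral>\<^sup>+\<omega>. (\<integral>\<^sup>+d. H (Y \<omega>, d) \<partial>law (u - s)) \<partial>P)"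
proof -
  have [measurable]: "Z u \<in> borel_measurable P" "Z s \<in> borel_measurable P"
    using assms by (auto intro: Z_measurable)
  have Y'[measurable]: "Y \<in> borel_measurable P" using Y by (rule measurable_F_imp)
  let ?D = "\<lambda>\<omega>. Z u \<omega> - Z s \<omega>"
  interpret L: prob_space "law (u - s)" using assms vol_pos by (intro prob_space_gauss) simp
  have "distr P borel Y \<Otimes>\<^sub>M law (u - s) = distr P (borel \<Otimes>\<^sub>M borel) (\<lambda>\<omega>. (Y \<omega>, ?D \<omega>))"
    using indep_increment[OF assms(1-4)] unfolding indep_var_distribution_eq
    by (simp add: distr_increment[OF assms(1-3)])
  then have "(\<integral>\<^sup>+\<omega>. H (Y \<omega>, ?D \<omega>) \<partial>P) = (\<integral>\<^sup>+p. H p \<partial>(distr P borel Y \<Otimes>\<^sub>M law (u - s)))"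
    by (simp add: nn_integral_distr)
  also have "\<dots> = (\<integral>\<^sup>+y. (\<integral>\<^sup>+d. H (y, d) \<partial>law (u - s)) \<partial>distr P borel Y)"
    by (subst L.nn_integral_fst[symmetric]) (auto cong: measurable_cong_sets)
  also have "\<dots> = (\<integral>\<^sup>+\<omega>. (\<integral>\<^sup>+d. H (Y \<omega>, d) \<partial>law (u - s)) \<partial>P)"
    by (subst nn_integral_distr) (auto cong: measurable_cong_sets)
  finally show ?thesis .
qed

end

section \<open>Occupation bounds for squared exponential deviations\<close>

lemma sum_grid_le:
  fixes d x :: real
  assumes "0 \<le> d" "0 \<le> x"
  shows "(\<Sum>i<n. d * indicator {..<x} (real i * d)) \<le> min (real n * d) (x + d)"
proof (induction n)
  case 0
  then show ?case using assms by simp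
next
  case (Suc n)
  \<comment> \<open>The bound \<open>real n * d\<close> carries the induction: a new point is
    counted only if \<open>real n * d < x\<close>, and then the sum is at most
    \<open>real n * d + d\<close>.\<close>
  then show ?case using assms by (auto simp: indicator_def algebra_simps min_def split: if_splits)
qed

context drifted_brownian_motion
begin

text \<open>
  Nothing is known about \<open>Z\<close> outside \<open>{0..T}\<close>; frozen there, it is continuous on the whole line
  and jointly measurable.
\<close>

definition Zc :: "real \<Rightarrow> 'a \<Rightarrow> real" where
  "Zc s = Z (min T (max 0 s))"

lemma Zc_eq: "0 \<le> s \<Longrightarrow> s \<le> T \<Longrightarrow> Zc s = Z s"
  by (simp add: Zc_def)

lemma Zc_cont: "\<omega> \<in> space P \<Longrightarrow> continuous_on UNIV (\<lambda>s. Zc s \<omega>)"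
  unfolding Zc_def using T_pos
  by (intro continuous_on_compose2[OF Z_cont, where f="\<lambda>s. min T (max 0 s)"] continuous_intros) auto

text \<open>Rounding the time down to a multiple of \<open>1 / Suc n\<close> leaves countably many
  times, for which joint measurability is clear; path continuity lets the rounded processes
  converge.\<close>

lemma Zc_joint_measurable [measurable]:
  "(\<lambda>p. Zc (fst p) (snd p)) \<in> borel_measurable (borel \<Otimes>\<^sub>M P)"
proof -
  define q where "q n s = \<lfloor>real (Suc n) * s\<rfloor>" for n :: nat and s :: real
  have m: "(\<lambda>p. Zc (real_of_int i / real (Suc n)) (snd p)) \<in> borel_measurable (borel \<Otimes>\<^sub>M P)" for i n
  proof -
    have "Zc (real_of_int i / real (Suc n)) \<in> borel_measurable P"
      unfolding Zc_def using T_pos by (intro Z_measurable) auto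
    then show ?thesis by measurable
  qed
  have [measurable]: "q n \<in> measurable borel (count_space UNIV)" for n
    unfolding q_def by measurable
  show ?thesis
  proof (rule borel_measurable_LIMSEQ_real)
    show "(\<lambda>p. Zc (real_of_int (q n (fst p)) / real (Suc n)) (snd p)) \<in> borel_measurable (borel \<Otimes>\<^sub>M P)"
      for n
      by (rule measurable_compose_countable[where f="\<lambda>i p. Zc (real_of_int i / real (Suc n)) (snd p)", OF m])
        measurable
    fix p :: "real \<times> 'a" assume "p \<in> space (borel \<Otimes>\<^sub>M P)"
    then have p: "snd p \<in> space P" by (auto simp: space_pair_measure)
    have "(\<lambda>n. real_of_int (q n (fst p)) / real (Suc n)) \<longlonglongrightarrow> fst p"
    proof (rule real_tendsto_sandwich)
      show "\<forall>\<^sub>F n in sequentially. fst p - 1 / real (Suc n) \<le> real_of_int (q n (fst p)) / real (Suc n)"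
      proof (intro always_eventually allI)
        fix n
        have "real (Suc n) * fst p - 1 \<le> real_of_int (q n (fst p))" unfolding q_def by linarith
        then have "(real (Suc n) * fst p - 1) / real (Suc n) \<le> real_of_int (q n (fst p)) / real (Suc n)"
          by (rule divide_right_mono) simp
        then show "fst p - 1 / real (Suc n) \<le> real_of_int (q n (fst p)) / real (Suc n)"
          by (simp add: diff_divide_distrib del: of_nat_Suc)
      qed
      show "\<forall>\<^sub>F n in sequentially. real_of_int (q n (fst p)) / real (Suc n) \<le> fst p"
      proof (intro always_eventually allI)
        fix n
        have "real_of_int (q n (fst p)) \<le> real (Suc n) * fst p" unfolding q_def by linarith
        then have "real_of_int (q n (fst p)) / real (Suc n) \<le> (real (Suc n) * fst p) / real (Suc n)"
          by (rule divide_right_mono) simp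
        then show "real_of_int (q n (fst p)) / real (Suc n) \<le> fst p"
          by (simp del: of_nat_Suc)
      qed
      have "(\<lambda>n. fst p - 1 / real (Suc n)) \<longlonglongrightarrow> fst p - 0"
        using LIMSEQ_Suc[OF lim_1_over_n] by (intro tendsto_intros) simp
      then show "(\<lambda>n. fst p - 1 / real (Suc n)) \<longlonglongrightarrow> fst p" by simp
    qed simp
    then show "(\<lambda>n. Zc (real_of_int (q n (fst p)) / real (Suc n)) (snd p)) \<longlonglongrightarrow> Zc (fst p) (snd p)"
      using Zc_cont[OF p] by (intro continuous_on_tendsto_compose[where f="\<lambda>s. Zc s (snd p)" and s=UNIV]) auto
  qed
qed

lemma stopping_time_measurable: "stopping_time F \<sigma> \<Longrightarrow> \<sigma> \<in> borel_measurable P" for \<sigma> :: "'a \<Rightarrow> real"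
  by (rule measurable_stopping_time[OF _ sets_F_le space_F])

text \<open>
  On a grid of mesh \<open>d\<close> the quantity \<open>E ((exp (k * Z) - 1)\<^sup>2; s < \<sigma>)\<close> grows in one step by a factor
  \<open>1 + c * d\<close> and by \<open>c * d\<close> times the probability that \<open>\<sigma>\<close> is not yet reached. These probabilities
  sum to about \<open>E \<sigma> / d\<close>, and no optional stopping theorem is needed.
\<close>

lemma stopped_square_exp_bound:
  "\<exists>C\<ge>0. \<forall>\<sigma> s. stopping_time F \<sigma> \<longrightarrow> (\<forall>\<omega>\<in>space P. 0 \<le> \<sigma> \<omega>) \<longrightarrow> 0 \<le> s \<longrightarrow> s \<le> T \<longrightarrow>
    (\<integral>\<^sup>+\<omega>. ennreal ((exp (k * Z s \<omega>) - 1)\<^sup>2) * indicator {..<\<sigma> \<omega>} s \<partial>P) \<le>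
      ennreal C * (\<integral>\<^sup>+\<omega>. ennreal (\<sigma> \<omega>) \<partial>P)"
proof -
  from gauss_square_growth[OF vol_pos, of T m k]
  obtain c where c: "c \<ge> 0" and growth: "\<And>d u. 0 < d \<Longrightarrow> d \<le> T \<Longrightarrow> 0 \<le> u \<Longrightarrow>
    (\<integral>\<^sup>+x. ennreal ((u * exp (k * x) - 1)\<^sup>2) \<partial>law d) \<le> ennreal ((1 + c * d) * (u - 1)\<^sup>2 + c * d)"
    by (elim exE conjE) (rule that, assumption, simp only:)
  define C where "C = exp (c * T) * c"
  have C: "C \<ge> 0" using c by (simp add: C_def)
  have "(\<integral>\<^sup>+\<omega>. ennreal ((exp (k * Z s \<omega>) - 1)\<^sup>2) * indicator {..<\<sigma> \<omega>} s \<partial>P) \<le>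
      ennreal C * (\<integral>\<^sup>+\<omega>. ennreal (\<sigma> \<omega>) \<partial>P)"
    if \<sigma>: "stopping_time F \<sigma>" "\<forall>\<omega>\<in>space P. 0 \<le> \<sigma> \<omega>" and s: "0 \<le> s" "s \<le> T" for \<sigma> :: "'a \<Rightarrow> real" and s
  proof (cases "s = 0")
    case True
    then have "(\<integral>\<^sup>+\<omega>. ennreal ((exp (k * Z s \<omega>) - 1)\<^sup>2) * indicator {..<\<sigma> \<omega>} s \<partial>P) = (\<integral>\<^sup>+\<omega>. 0 \<partial>P)"
      by (intro nn_integral_cong) (simp add: Z_0)
    then show ?thesis by simp
  next
    case False
    with s have s0: "0 < s" by simp
    have [measurable]: "\<sigma> \<in> borel_measurable P" using \<sigma>(1) by (rule stopping_time_measurable)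
    have [measurable]: "(\<lambda>\<omega>. indicator {..<\<sigma> \<omega>} c :: ennreal) \<in> borel_measurable P" for c
      unfolding indicator_def lessThan_iff by measurable
    define I where "I = (\<integral>\<^sup>+\<omega>. ennreal (\<sigma> \<omega>) \<partial>P)"
    have grid: "(\<integral>\<^sup>+\<omega>. ennreal ((exp (k * Z s \<omega>) - 1)\<^sup>2) * indicator {..<\<sigma> \<omega>} s \<partial>P)
        \<le> ennreal C * (I + ennreal (s / real (Suc n)))" for n
    proof -
      define d where "d = s / real (Suc n)"
      have d: "0 < d" "d \<le> T" and nd: "real (Suc n) * d = s"
      proof -
        have "s / real (Suc n) \<le> s / 1" using s by (intro divide_left_mono) auto
        then show "0 < d" "d \<le> T" "real (Suc n) * d = s" using s0 s by (auto simp: d_def)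
      qed
      define a where "a j = (\<integral>\<^sup>+\<omega>. ennreal ((exp (k * Z (real j * d) \<omega>) - 1)\<^sup>2)
        * indicator {..<\<sigma> \<omega>} (real j * d) \<partial>P)" for j
      define p where "p j = (\<integral>\<^sup>+\<omega>. indicator {..<\<sigma> \<omega>} (real j * d) \<partial>P)" for j
      have jd: "real j * d \<le> T" if "j \<le> Suc n" for j
      proof -
        have "real j * d \<le> real (Suc n) * d" using that d by (intro mult_right_mono) auto
        then show ?thesis using nd s by simp
      qed
      have step: "a (Suc j) \<le> ennreal (1 + c * d) * a j + ennreal (c * d) * p j" if "j \<le> n" for j
      proof -
        let ?s = "real j * d" and ?u = "real (Suc j) * d"
        have su: "0 \<le> ?s" "?s < ?u" "?u \<le> T" and us: "?u - ?s = d"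
          using d jd[of "Suc j"] that by (auto simp: algebra_simps)
        have [measurable]: "Z ?s \<in> borel_measurable P" "Z ?u \<in> borel_measurable P"
          using su by (auto intro!: Z_measurable)
        \<comment> \<open>The value 0 marks that \<sigma> has been reached. An exponential never
          takes it, so \<open>H\<close> can recognise the mark.\<close>
        define Y where "Y \<omega> = (if ?s < \<sigma> \<omega> then exp (k * Z ?s \<omega>) else 0)" for \<omega>
        have Y: "Y \<in> borel_measurable (F ?s)"
        proof -
          have [measurable]: "Z ?s \<in> borel_measurable (F ?s)" using su by (intro Z_adapted) auto
          have [measurable]: "Measurable.pred (F ?s) (\<lambda>\<omega>. ?s < \<sigma> \<omega>)"
            using \<sigma>(1) by (rule stopping_timeD2)
          show ?thesis unfolding Y_def by measurable
        qed
        define H :: "real \<times> real \<Rightarrow> ennreal"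
          where "H = (\<lambda>(y, x). if y = 0 then 0 else ennreal ((y * exp (k * x) - 1)\<^sup>2))"
        have [measurable]: "H \<in> borel_measurable (borel \<Otimes>\<^sub>M borel)" unfolding H_def by measurable
        \<comment> \<open>Surviving past \<open>?u\<close> implies surviving past \<open>?s\<close>,
          so the indicator is replaced by one that is known at time \<open>?s\<close>.\<close>
        have "a (Suc j) \<le> (\<integral>\<^sup>+\<omega>. H (Y \<omega>, Z ?u \<omega> - Z ?s \<omega>) \<partial>P)"
          unfolding a_def
        proof (intro nn_integral_mono)
          fix \<omega>
          have "exp (k * Z ?u \<omega>) = exp (k * Z ?s \<omega>) * exp (k * (Z ?u \<omega> - Z ?s \<omega>))"
            by (simp add: exp_add[symmetric] algebra_simps)
          then show "ennreal ((exp (k * Z ?u \<omega>) - 1)\<^sup>2) * indicator {..<\<sigma> \<omega>} ?u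
              \<le> H (Y \<omega>, Z ?u \<omega> - Z ?s \<omega>)"
            using su(2) by (auto simp: H_def Y_def indicator_def)
        qed
        also have "\<dots> = (\<integral>\<^sup>+\<omega>. (\<integral>\<^sup>+x. H (Y \<omega>, x) \<partial>law d) \<partial>P)"
          using nn_integral_increment[OF su Y, of H] us by simp
        also have "\<dots> \<le> (\<integral>\<^sup>+\<omega>. ennreal (1 + c * d) * (ennreal ((exp (k * Z ?s \<omega>) - 1)\<^sup>2) * indicator {..<\<sigma> \<omega>} ?s)
           + ennreal (c * d) * indicator {..<\<sigma> \<omega>} ?s \<partial>P)"
        proof (intro nn_integral_mono)
          fix \<omega>
          show "(\<integral>\<^sup>+x. H (Y \<omega>, x) \<partial>law d) \<le> ennreal (1 + c * d) *
             (ennreal ((exp (k * Z ?s \<omega>) - 1)\<^sup>2) * indicator {..<\<sigma> \<omega>} ?s) + ennreal (c * d) * indicator {..<\<sigma> \<omega>} ?s"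
          proof (cases "?s < \<sigma> \<omega>")
            case True
            then show ?thesis
              using growth[OF d, of "exp (k * Z ?s \<omega>)"] c d
              by (simp add: H_def Y_def ennreal_plus ennreal_mult)
          next
            case False
            then show ?thesis by (simp add: H_def Y_def)
          qed
        qed
        also have "\<dots> = ennreal (1 + c * d) * a j + ennreal (c * d) * p j"
          unfolding a_def p_def
          by (simp add: nn_integral_add nn_integral_cmult)
        finally show ?thesis .
      qed
      \<comment> \<open>Discrete Gronwall: \<open>step\<close> is iterated from
        \<open>a 0 = 0\<close>.\<close>
      have ind: "a j \<le> ennreal ((1 + c * d) ^ j) * (ennreal (c * d) * (\<Sum>i<j. p i))" if "j \<le> Suc n" for j
        using that
      proof (induction j)
        case 0
        have "a 0 = (\<integral>\<^sup>+\<omega>. 0 \<partial>P)" unfolding a_def by (intro nn_integral_cong) (simp add: Z_0)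
        then show ?case by simp
      next
        case (Suc j)
        let ?S = "ennreal (c * d) * (\<Sum>i<j. p i)"
        have "a (Suc j) \<le> ennreal (1 + c * d) * a j + ennreal (c * d) * p j"
          using Suc.prems by (intro step) simp
        also have "\<dots> \<le> ennreal (1 + c * d) * (ennreal ((1 + c * d) ^ j) * ?S) + ennreal ((1 + c * d) ^ Suc j) * (ennreal (c * d) * p j)"
        proof (intro add_mono mult_left_mono)
          show "a j \<le> ennreal ((1 + c * d) ^ j) * ?S" using Suc by simp
          have "1 \<le> (1 + c * d) ^ Suc j" using c d by (intro one_le_power) auto
          then have "1 \<le> ennreal ((1 + c * d) ^ Suc j)" using ennreal_leI by fastforce
          then have "1 * (ennreal (c * d) * p j) \<le> ennreal ((1 + c * d) ^ Suc j) * (ennreal (c * d) * p j)"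
            by (rule mult_right_mono) simp
          then show "ennreal (c * d) * p j \<le> ennreal ((1 + c * d) ^ Suc j) * (ennreal (c * d) * p j)" by simp
        qed auto
        also have "\<dots> = ennreal ((1 + c * d) ^ Suc j) * (ennreal (c * d) * (\<Sum>i<Suc j. p i))"
          using c d by (simp add: ennreal_mult distrib_left ac_simps)
        finally show ?case .
      qed
      have sums: "ennreal d * (\<Sum>i<Suc n. p i) \<le> I + ennreal d"
      proof -
        have "ennreal d * (\<Sum>i<Suc n. p i) = (\<integral>\<^sup>+\<omega>. ennreal d * (\<Sum>i<Suc n. indicator {..<\<sigma> \<omega>} (real i * d)) \<partial>P)"
          unfolding p_def by (subst nn_integral_cmult, measurable, subst nn_integral_sum) auto
        also have "\<dots> \<le> (\<integral>\<^sup>+\<omega>. ennreal (\<sigma> \<omega>) + ennreal d \<partial>P)"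
        proof (intro nn_integral_mono)
          fix \<omega> assume \<omega>: "\<omega> \<in> space P"
          have "ennreal d * (\<Sum>i<Suc n. indicator {..<\<sigma> \<omega>} (real i * d))
             = ennreal (\<Sum>i<Suc n. d * indicator {..<\<sigma> \<omega>} (real i * d))"
            using d by (simp add: sum_distrib_left ennreal_mult ennreal_indicator sum_ennreal[symmetric] ennreal_of_nat_eq_real_of_nat del: sum_ennreal sum.lessThan_Suc)
          also have "\<dots> \<le> ennreal (\<sigma> \<omega> + d)"
            using sum_grid_le[of d "\<sigma> \<omega>" "Suc n"] d \<sigma>(2) \<omega> by (intro ennreal_leI) auto
          finally show "ennreal d * (\<Sum>i<Suc n. indicator {..<\<sigma> \<omega>} (real i * d)) \<le> ennreal (\<sigma> \<omega>) + ennreal d"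
            using \<sigma>(2) \<omega> d by (simp add: ennreal_plus)
        qed
        also have "\<dots> = I + ennreal d"
          unfolding I_def by (subst nn_integral_add) (auto simp: emeasure_space_1)
        finally show ?thesis .
      qed
      \<comment> \<open>Keeps the accumulated growth factor bounded independently of the
        mesh.\<close>
      have pw: "(1 + c * d) ^ Suc n \<le> exp (c * T)"
      proof -
        have "(1 + c * d) ^ Suc n \<le> exp (c * d) ^ Suc n"
          using c d by (intro power_mono) (auto simp: add.commute exp_ge_add_one_self)
        also have "\<dots> = exp (c * (real (Suc n) * d))" by (simp only: exp_of_nat_mult[symmetric]) (simp add: ac_simps)
        also have "\<dots> \<le> exp (c * T)" using nd s c by (simp add: mult_left_mono)
        finally show ?thesis .
      qed
      have "a (Suc n) \<le> ennreal ((1 + c * d) ^ Suc n) * (ennreal (c * d) * (\<Sum>i<Suc n. p i))"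
        by (rule ind) simp
      also have "\<dots> = ennreal ((1 + c * d) ^ Suc n * c) * (ennreal d * (\<Sum>i<Suc n. p i))"
        using c d by (simp add: ennreal_mult ac_simps del: power_Suc)
      also have "\<dots> \<le> ennreal C * (I + ennreal d)"
        using sums pw c unfolding C_def by (intro mult_mono ennreal_leI mult_right_mono) auto
      finally show ?thesis unfolding a_def nd unfolding d_def .
    qed
    \<comment> \<open>A vanishing mesh removes the one extra grid cell counted in
      \<open>sums\<close>.\<close>
    have "(\<lambda>n. ennreal C * (I + ennreal (s / real (Suc n)))) \<longlonglongrightarrow> ennreal C * (I + ennreal 0)"
    proof (intro ennreal_tendsto_cmult tendsto_add tendsto_const tendsto_ennrealI)
      have "(\<lambda>n. s * (1 / real (Suc n))) \<longlonglongrightarrow> s * 0"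
        using LIMSEQ_Suc[OF lim_1_over_n] by (intro tendsto_intros) simp
      then show "(\<lambda>n. s / real (Suc n)) \<longlonglongrightarrow> 0" by simp
    qed simp
    then have "(\<integral>\<^sup>+\<omega>. ennreal ((exp (k * Z s \<omega>) - 1)\<^sup>2) * indicator {..<\<sigma> \<omega>} s \<partial>P) \<le> ennreal C * (I + ennreal 0)"
      by (rule tendsto_lowerbound) (use grid in \<open>auto simp del: of_nat_Suc\<close>)
    then show ?thesis by (simp add: I_def)
  qed
  then show ?thesis using C by (intro exI[of _ C] conjI allI impI)
qed

abbreviation LP :: "(real \<times> 'a) measure" where
  "LP \<equiv> lborel \<Otimes>\<^sub>M P"

lemma pair_sigma_finite: "pair_sigma_finite lborel P"
  by unfold_locales

text \<open>Tonelli reduces this to the bound at fixed times \<open>s \<le> h\<close>, and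
  integrating that over \<open>{0..h}\<close> produces the factor \<open>h\<close>. The closed and
  the half-open interval up to \<sigma> differ in a single point.\<close>

lemma occupation_square_exp_bound:
  "\<exists>C\<ge>0. \<forall>\<sigma> h. stopping_time F \<sigma> \<longrightarrow> (\<forall>\<omega>\<in>space P. 0 \<le> \<sigma> \<omega> \<and> \<sigma> \<omega> \<le> h) \<longrightarrow> h \<le> T \<longrightarrow>
    (\<integral>\<^sup>+\<omega>. (\<integral>\<^sup>+s. ennreal ((exp (k * Zc s \<omega>) - 1)\<^sup>2) * indicator {0..\<sigma> \<omega>} s \<partial>lborel) \<partial>P) \<le>
      ennreal (C * h) * (\<integral>\<^sup>+\<omega>. ennreal (\<sigma> \<omega>) \<partial>P)"
proof -
  interpret PS: pair_sigma_finite lborel P by (rule pair_sigma_finite)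
  from stopped_square_exp_bound[of k]
  obtain C where C: "C \<ge> 0" and bound: "\<And>\<sigma> s. stopping_time F \<sigma> \<Longrightarrow> (\<forall>\<omega>\<in>space P. 0 \<le> \<sigma> \<omega>) \<Longrightarrow> 0 \<le> s \<Longrightarrow> s \<le> T \<Longrightarrow>
    (\<integral>\<^sup>+\<omega>. ennreal ((exp (k * Z s \<omega>) - 1)\<^sup>2) * indicator {..<\<sigma> \<omega>} s \<partial>P) \<le>
      ennreal C * (\<integral>\<^sup>+\<omega>. ennreal (\<sigma> \<omega>) \<partial>P)"
    by (elim exE conjE) (rule that, assumption, simp only:)
  have "(\<integral>\<^sup>+\<omega>. (\<integral>\<^sup>+s. ennreal ((exp (k * Zc s \<omega>) - 1)\<^sup>2) * indicator {0..\<sigma> \<omega>} s \<partial>lborel) \<partial>P) \<le>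
      ennreal (C * h) * (\<integral>\<^sup>+\<omega>. ennreal (\<sigma> \<omega>) \<partial>P)"
    if \<sigma>: "stopping_time F \<sigma>" "\<forall>\<omega>\<in>space P. 0 \<le> \<sigma> \<omega> \<and> \<sigma> \<omega> \<le> h" and h: "h \<le> T" for \<sigma> :: "'a \<Rightarrow> real" and h
  proof -
    have [measurable]: "\<sigma> \<in> borel_measurable P" using \<sigma>(1) by (rule stopping_time_measurable)
    obtain \<omega>0 where "\<omega>0 \<in> space P" using not_empty by auto
    then have h0: "0 \<le> h" using \<sigma>(2) by force
    have [measurable]: "(\<lambda>p. indicator {..<\<sigma> (snd p)} (fst p) :: ennreal) \<in> borel_measurable (borel \<Otimes>\<^sub>M P)"
      unfolding indicator_def lessThan_iff by measurable
    let ?f = "\<lambda>s \<omega>. ennreal ((exp (k * Zc s \<omega>) - 1)\<^sup>2) * (indicator {..<\<sigma> \<omega>} s * indicator {0..h} s)"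
    have "(\<integral>\<^sup>+\<omega>. (\<integral>\<^sup>+s. ennreal ((exp (k * Zc s \<omega>) - 1)\<^sup>2) * indicator {0..\<sigma> \<omega>} s \<partial>lborel) \<partial>P)
       = (\<integral>\<^sup>+\<omega>. (\<integral>\<^sup>+s. ?f s \<omega> \<partial>lborel) \<partial>P)"
    proof (rule nn_integral_cong, rule nn_integral_cong_AE)
      fix \<omega> assume "\<omega> \<in> space P"
      then have le: "\<sigma> \<omega> \<le> h" using \<sigma>(2) by auto
      show "AE s in lborel. ennreal ((exp (k * Zc s \<omega>) - 1)\<^sup>2) * indicator {0..\<sigma> \<omega>} s = ?f s \<omega>"
        using AE_lborel_singleton[of "\<sigma> \<omega>"] by eventually_elim (use le in \<open>auto simp: indicator_def\<close>)
    qed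
    also have "\<dots> = (\<integral>\<^sup>+s. (\<integral>\<^sup>+\<omega>. ?f s \<omega> \<partial>P) \<partial>lborel)"
      by (rule PS.Fubini') measurable
    also have "\<dots> \<le> (\<integral>\<^sup>+s. (ennreal C * (\<integral>\<^sup>+\<omega>. ennreal (\<sigma> \<omega>) \<partial>P)) * indicator {0..h} s \<partial>lborel)"
    proof (intro nn_integral_mono)
      fix s
      show "(\<integral>\<^sup>+\<omega>. ?f s \<omega> \<partial>P) \<le> (ennreal C * (\<integral>\<^sup>+\<omega>. ennreal (\<sigma> \<omega>) \<partial>P)) * indicator {0..h} s"
        using bound[OF \<sigma>(1), of s] \<sigma>(2) h by (auto simp: indicator_def Zc_eq)
    qed
    also have "\<dots> = ennreal (C * h) * (\<integral>\<^sup>+\<omega>. ennreal (\<sigma> \<omega>) \<partial>P)"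
      using h0 C by (subst nn_integral_cmult_indicator) (auto simp: ennreal_mult ac_simps)
    finally show ?thesis .
  qed
  then show ?thesis using C by (intro exI[of _ C] conjI allI impI)
qed

end

section \<open>Reflection and avoidance of a lower level on a grid\<close>

lemma integral_nonpos:
  fixes f :: "'a \<Rightarrow> real"
  assumes "\<And>x. f x \<le> 0" shows "integral\<^sup>L M f \<le> 0"
  using integral_nonneg_AE[of "\<lambda>x. - f x" M] assms by simp

lemma pred_forall_less:
  fixes f :: "nat \<Rightarrow> 'a \<Rightarrow> real"
  assumes "\<And>k. k < N \<Longrightarrow> f k \<in> borel_measurable M"
  shows "Measurable.pred M (\<lambda>\<omega>. \<forall>k<N. c < f k \<omega>)"
  using assms
proof (induction N)
  case 0
  then show ?case by simp
next
  case (Suc N)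
  have [measurable]: "f N \<in> borel_measurable M" using Suc.prems by simp
  have "Measurable.pred M (\<lambda>\<omega>. \<forall>k<N. c < f k \<omega>)"
    using Suc.prems by (intro Suc.IH) simp
  moreover have "Measurable.pred M (\<lambda>\<omega>. c < f N \<omega>)" by measurable
  moreover have eq: "(\<forall>k<Suc N. c < f k \<omega>) \<longleftrightarrow> (\<forall>k<N. c < f k \<omega>) \<and> c < f N \<omega>" for \<omega>
    by (auto simp: less_Suc_eq)
  ultimately show ?case unfolding pred_def eq by (intro sets.sets_Collect_conj)
qed

context drifted_brownian_motion
begin

text \<open>The signed counterpart of \<open>nn_integral_increment\<close>, for
  \<open>mirror\<close>, which takes both signs.\<close>

lemma integral_increment:
  fixes Y :: "'a \<Rightarrow> real" and H :: "real \<times> real \<Rightarrow> real"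
  assumes "0 \<le> s" "s < u" "u \<le> T" and Y: "Y \<in> borel_measurable (F s)"
    and H[measurable]: "H \<in> borel_measurable (borel \<Otimes>\<^sub>M borel)" and bound: "\<And>p. \<bar>H p\<bar> \<le> B"
  shows "(\<integral>\<omega>. H (Y \<omega>, Z u \<omega> - Z s \<omega>) \<partial>P) = (\<integral>\<omega>. (\<integral>d. H (Y \<omega>, d) \<partial>law (u - s)) \<partial>P)"
proof -
  have [measurable]: "Z u \<in> borel_measurable P" "Z s \<in> borel_measurable P"
    using assms by (auto intro: Z_measurable)
  have Y'[measurable]: "Y \<in> borel_measurable P" using Y by (rule measurable_F_imp)
  let ?D = "\<lambda>\<omega>. Z u \<omega> - Z s \<omega>"
  interpret L: prob_space "law (u - s)" using assms vol_pos by (intro prob_space_gauss) simp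
  interpret DY: prob_space "distr P borel Y" by (rule prob_space_distr) measurable
  interpret DL: pair_prob_space "distr P borel Y" "law (u - s)" ..
  have eq: "distr P borel Y \<Otimes>\<^sub>M law (u - s) = distr P (borel \<Otimes>\<^sub>M borel) (\<lambda>\<omega>. (Y \<omega>, ?D \<omega>))"
    using indep_increment[OF assms(1-4)] unfolding indep_var_distribution_eq
    by (simp add: distr_increment[OF assms(1-3)])
  have int: "integrable (distr P borel Y \<Otimes>\<^sub>M law (u - s)) H"
    using bound by (intro DL.P.integrable_const_bound[where B=B]) (auto cong: measurable_cong_sets)
  have "(\<integral>\<omega>. H (Y \<omega>, ?D \<omega>) \<partial>P) = (\<integral>p. H p \<partial>(distr P borel Y \<Otimes>\<^sub>M law (u - s)))"
    unfolding eq by (subst integral_distr) auto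
  also have "\<dots> = (\<integral>y. (\<integral>d. H (y, d) \<partial>law (u - s)) \<partial>distr P borel Y)"
    using DL.integral_fst'[OF int] by simp
  also have "\<dots> = (\<integral>\<omega>. (\<integral>d. H (Y \<omega>, d) \<partial>law (u - s)) \<partial>P)"
    by (subst integral_distr) (auto intro!: L.borel_measurable_lebesgue_integral cong: measurable_cong_sets)
  finally show ?thesis .
qed

text \<open>
  The weight on the mirror image of \<open>{1..2}\<close> is the ratio of the drifted Gaussian density at
  mirror points, so that a path absorbed at \<open>-x\<close> contributes nothing to the expectation of
  \<open>mirror x (Z s)\<close>. For zero drift this is the reflection principle.
\<close>

definition mirror :: "real \<Rightarrow> real \<Rightarrow> real" where
  "mirror x z = indicator {1..2} (z + x) - exp (- 2 * (z + x) * m / \<kappa>\<^sup>2) * indicator {1..2} (- (z + x))"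

lemma mirror_measurable [measurable]: "mirror x \<in> borel_measurable borel"
  unfolding mirror_def[abs_def] by measurable

text \<open>The second indicator confines \<open>z + x\<close> to \<open>{-2..-1}\<close>, which
  bounds the exponent.\<close>

lemma mirror_bounded: "\<bar>mirror x z\<bar> \<le> 1 + exp (4 * \<bar>m\<bar> / \<kappa>\<^sup>2)"
proof -
  have "- 2 * (z + x) * m / \<kappa>\<^sup>2 \<le> 4 * \<bar>m\<bar> / \<kappa>\<^sup>2" if "- (z + x) \<in> {1..2}"
  proof (intro divide_right_mono)
    have "- (z + x) * m \<le> \<bar>- (z + x) * m\<bar>" by (rule abs_ge_self)
    also have "\<dots> = - (z + x) * \<bar>m\<bar>" using that by (simp add: abs_mult)
    also have "\<dots> \<le> 2 * \<bar>m\<bar>" using that by (intro mult_right_mono) auto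
    finally have "- (z + x) * m \<le> 2 * \<bar>m\<bar>" .
    then show "- 2 * (z + x) * m \<le> 4 * \<bar>m\<bar>" by (simp add: algebra_simps)
  qed simp
  then have "exp (- 2 * (z + x) * m / \<kappa>\<^sup>2) * indicator {1..2} (- (z + x)) \<le> exp (4 * \<bar>m\<bar> / \<kappa>\<^sup>2)"
    by (auto simp: indicator_def)
  moreover have "0 \<le> exp (- 2 * (z + x) * m / \<kappa>\<^sup>2) * (indicator {1..2} (- (z + x)) :: real)" by simp
  moreover have "0 \<le> (indicator {1..2} (z + x) :: real)" "(indicator {1..2} (z + x) :: real) \<le> 1"
    by (auto simp: indicator_def)
  ultimately show ?thesis
    unfolding mirror_def abs_le_iff by linarith
qed

text \<open>The path starts at depth \<open>d\<close> below \<open>-x\<close>. The substitutions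
  \<open>u = v - d\<close> and \<open>u = d - v\<close> fold both windows onto
  \<open>{1..2}\<close>; the weight in \<open>mirror\<close> cancels the drift, and what remains of
  the density ratio is \<open>exp (2 * u * d / (\<kappa>\<^sup>2 * S))\<close>. The sign of the
  integral is thus opposite to that of \<open>d\<close>.\<close>

lemma integral_mirror:
  assumes S: "0 < S"
  shows "(\<integral>v. mirror x (- x - d + v) \<partial>law S) =
    (\<integral>u. indicator {1..2} u * (normal_density (m * S) (\<kappa> * sqrt S) (u + d) * (1 - exp (2 * u * d / (\<kappa>\<^sup>2 * S)))) \<partial>lborel)"
proof -
  let ?p = "normal_density (m * S) (\<kappa> * sqrt S)"
  let ?e = "\<lambda>v. exp (2 * (d - v) * m / \<kappa>\<^sup>2) * indicator {1..2} (d - v)"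
  have pos: "0 < \<kappa> * sqrt S" using S vol_pos by simp
  have int1: "integrable lborel (\<lambda>v. ?p v * indicator {1..2} (v - d))"
    by (rule Bochner_Integration.integrable_bound[OF integrable_normal_density[OF pos]])
      (auto simp: indicator_def)
  have int2: "integrable lborel (\<lambda>v. ?p v * ?e v)"
  proof (rule Bochner_Integration.integrable_bound)
    show "integrable lborel (\<lambda>v. (1 + exp (4 * \<bar>m\<bar> / \<kappa>\<^sup>2) + 1) * ?p v)"
      using pos by (intro integrable_mult_right) auto
    have "?e v \<le> 1 + exp (4 * \<bar>m\<bar> / \<kappa>\<^sup>2) + 1" for v
      using mirror_bounded[of x "v - d - x"] unfolding mirror_def by (auto simp: indicator_def split: if_splits)
    then show "AE v in lborel. norm (?p v * ?e v) \<le> norm ((1 + exp (4 * \<bar>m\<bar> / \<kappa>\<^sup>2) + 1) * ?p v)"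
      by (intro AE_I2) (auto simp: abs_mult mult.commute intro!: mult_left_mono)
  qed measurable
  have "(\<integral>v. mirror x (- x - d + v) \<partial>law S) = (\<integral>v. ?p v * mirror x (- x - d + v) \<partial>lborel)"
    by (subst integral_density) auto
  also have "\<dots> = (\<integral>v. ?p v * indicator {1..2} (v - d) - ?p v * ?e v \<partial>lborel)"
    by (intro Bochner_Integration.integral_cong refl) (simp add: mirror_def algebra_simps)
  also have "\<dots> = (\<integral>v. ?p v * indicator {1..2} (v - d) \<partial>lborel) - (\<integral>v. ?p v * ?e v \<partial>lborel)"
    using int1 int2 by (rule Bochner_Integration.integral_diff)
  also have "(\<integral>v. ?p v * indicator {1..2} (v - d) \<partial>lborel) = (\<integral>u. ?p (d + u) * indicator {1..2} u \<partial>lborel)"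
    by (subst lborel_integral_real_affine[where c=1 and t=d]) auto
  also have "(\<integral>v. ?p v * ?e v \<partial>lborel) = (\<integral>u. ?p (d - u) * (exp (2 * u * m / \<kappa>\<^sup>2) * indicator {1..2} u) \<partial>lborel)"
    by (subst lborel_integral_real_affine[where c="-1" and t=d]) auto
  also have "(\<integral>u. ?p (d + u) * indicator {1..2} u \<partial>lborel) - \<dots> =
      (\<integral>u. ?p (d + u) * indicator {1..2} u - ?p (d - u) * (exp (2 * u * m / \<kappa>\<^sup>2) * indicator {1..2} u) \<partial>lborel)"
  proof (rule Bochner_Integration.integral_diff[symmetric])
    show "integrable lborel (\<lambda>u. ?p (d + u) * indicator {1..2} u)"
      using lborel_integrable_real_affine[OF int1, of 1 d] by simp
    show "integrable lborel (\<lambda>u. ?p (d - u) * (exp (2 * u * m / \<kappa>\<^sup>2) * indicator {1..2} u))"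
      using lborel_integrable_real_affine[OF int2, of "-1" d] by simp
  qed
  also have "\<dots> = (\<integral>u. indicator {1..2} u * (?p (u + d) * (1 - exp (2 * u * d / (\<kappa>\<^sup>2 * S)))) \<partial>lborel)"
  proof (intro Bochner_Integration.integral_cong refl)
    fix u
    have *: "- (d - u - m * S)\<^sup>2 / (2 * (\<kappa> * sqrt S)\<^sup>2) + 2 * u * m / \<kappa>\<^sup>2 =
        - (d + u - m * S)\<^sup>2 / (2 * (\<kappa> * sqrt S)\<^sup>2) + 2 * u * d / (\<kappa>\<^sup>2 * S)"
      using S vol_pos by (simp add: power_mult_distrib field_simps) (simp add: power2_eq_square algebra_simps)
    have "?p (d - u) * exp (2 * u * m / \<kappa>\<^sup>2) =
        1 / sqrt (2 * pi * (\<kappa> * sqrt S)\<^sup>2) * exp (- (d - u - m * S)\<^sup>2 / (2 * (\<kappa> * sqrt S)\<^sup>2) + 2 * u * m / \<kappa>\<^sup>2)"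
      by (simp only: normal_density_def exp_add mult.assoc)
    also have "\<dots> = ?p (d + u) * exp (2 * u * d / (\<kappa>\<^sup>2 * S))"
      unfolding * by (simp only: normal_density_def exp_add mult.assoc)
    finally have eq: "?p (d - u) * exp (2 * u * m / \<kappa>\<^sup>2) = ?p (d + u) * exp (2 * u * d / (\<kappa>\<^sup>2 * S))" .
    have "?p (d + u) * indicator {1..2} u - ?p (d - u) * (exp (2 * u * m / \<kappa>\<^sup>2) * indicator {1..2} u)
      = indicator {1..2} u * (?p (d + u) - ?p (d - u) * exp (2 * u * m / \<kappa>\<^sup>2))"
      by (simp add: algebra_simps)
    then show "?p (d + u) * indicator {1..2} u - ?p (d - u) * (exp (2 * u * m / \<kappa>\<^sup>2) * indicator {1..2} u)
      = indicator {1..2} u * (?p (u + d) * (1 - exp (2 * u * d / (\<kappa>\<^sup>2 * S))))"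
      unfolding eq by (simp add: algebra_simps)
  qed
  finally show ?thesis .
qed

text \<open>An inequality rather than the equality at \<open>z = - x\<close>, because a path
  observed on a grid has usually overshot the level when it is noticed.\<close>

lemma integral_mirror_absorbed:
  assumes "0 < S" "z \<le> - x"
  shows "(\<integral>v. mirror x (z + v) \<partial>law S) \<le> 0"
proof -
  define d where "d = - x - z"
  have z: "z = - x - d" and d: "0 \<le> d" using assms by (auto simp: d_def)
  have "(\<integral>u. indicator {1..2} u * (normal_density (m * S) (\<kappa> * sqrt S) (u + d) * (1 - exp (2 * u * d / (\<kappa>\<^sup>2 * S)))) \<partial>lborel) \<le> 0"
  proof (rule integral_nonpos)
    fix u :: real
    have "1 - exp (2 * u * d / (\<kappa>\<^sup>2 * S)) \<le> 0" if "u \<in> {1..2}"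
      using that d assms vol_pos by (auto intro!: divide_nonneg_nonneg)
    then show "indicator {1..2} u * (normal_density (m * S) (\<kappa> * sqrt S) (u + d) * (1 - exp (2 * u * d / (\<kappa>\<^sup>2 * S)))) \<le> 0"
      by (auto simp: indicator_def mult_le_0_iff)
  qed
  then show ?thesis unfolding z integral_mirror[OF assms(1)] .
qed

text \<open>Induction on the number of grid times: the paths discarded at the next time are below
  \<open>-x\<close> there, and by \<open>integral_mirror_absorbed\<close> their conditional
  expectation of \<open>mirror\<close> is nonpositive, so discarding them only increases the
  integral.\<close>

lemma reflection_principle:
  fixes q :: "nat \<Rightarrow> real"
  assumes s: "s \<le> T" and q: "\<And>k. k < N \<Longrightarrow> 0 \<le> q k \<and> q k < s" "\<And>i j. i \<le> j \<Longrightarrow> j < N \<Longrightarrow> q i \<le> q j"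
    and "0 \<le> s"
  shows "(\<integral>\<omega>. mirror x (Z s \<omega>) \<partial>P) \<le>
    (\<integral>\<omega>. mirror x (Z s \<omega>) * indicator {\<omega>. \<forall>k<N. - x < Z (q k) \<omega>} \<omega> \<partial>P)"
  using q
proof (induction N)
  case 0
  then show ?case by simp
next
  case (Suc N)
  define av where "av N \<omega> \<longleftrightarrow> (\<forall>k<N. - x < Z (q k) \<omega>)" for N \<omega>
  let ?A = "\<lambda>N. {\<omega>. av N \<omega>}"
  have qk: "0 \<le> q k" "q k < s" "q k \<le> T" if "k < Suc N" for k using Suc.prems(1)[OF that] s by auto
  have [measurable]: "Z s \<in> borel_measurable P" using assms by (intro Z_measurable)
  \<comment> \<open>The default \<open>- x + 1\<close> lies above the level, where \<open>H\<close>
    vanishes; it marks the paths that are not discarded at this time.\<close>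
  define Y where "Y \<omega> = (if av N \<omega> \<and> Z (q N) \<omega> \<le> - x then Z (q N) \<omega> else - x + 1)" for \<omega>
  have Y: "Y \<in> borel_measurable (F (q N))"
  proof -
    have ad: "Z (q k) \<in> borel_measurable (F (q N))" if "k < Suc N" for k
      using qk[OF that] Suc.prems(2)[of k N] that by (intro measurable_F_mono[OF Z_adapted]) auto
    have [measurable]: "Z (q N) \<in> borel_measurable (F (q N))" using ad by simp
    have [measurable]: "Measurable.pred (F (q N)) (av N)"
      using ad unfolding av_def[abs_def] by (intro pred_forall_less) auto
    show ?thesis unfolding Y_def mem_Collect_eq by measurable
  qed
  define H where "H = (\<lambda>(y, d). if y \<le> - x then mirror x (y + d) else 0)"
  have [measurable]: "H \<in> borel_measurable (borel \<Otimes>\<^sub>M borel)" unfolding H_def by measurable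
  have Hb: "\<bar>H p\<bar> \<le> 1 + exp (4 * \<bar>m\<bar> / \<kappa>\<^sup>2)" for p
    using mirror_bounded[of x] by (auto simp: H_def split: prod.split intro: add_nonneg_nonneg)
  have "(\<integral>\<omega>. H (Y \<omega>, Z s \<omega> - Z (q N) \<omega>) \<partial>P) = (\<integral>\<omega>. (\<integral>d. H (Y \<omega>, d) \<partial>law (s - q N)) \<partial>P)"
    using qk[of N] s Y Hb by (intro integral_increment) auto
  also have "\<dots> \<le> 0"
  proof (rule integral_nonpos)
    fix \<omega>
    show "(\<integral>d. H (Y \<omega>, d) \<partial>law (s - q N)) \<le> 0"
      using integral_mirror_absorbed[of "s - q N" "Y \<omega>" x] qk[of N] by (cases "Y \<omega> \<le> - x") (simp_all add: H_def)
  qed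
  finally have neg: "(\<integral>\<omega>. H (Y \<omega>, Z s \<omega> - Z (q N) \<omega>) \<partial>P) \<le> 0" .
  have int: "integrable P (\<lambda>\<omega>. mirror x (Z s \<omega>) * indicator (?A M) \<omega>)" if "M \<le> Suc N" for M
  proof (rule integrable_const_bound[where B="1 + exp (4 * \<bar>m\<bar> / \<kappa>\<^sup>2)"])
    show "AE \<omega> in P. norm (mirror x (Z s \<omega>) * indicator (?A M) \<omega>) \<le> 1 + exp (4 * \<bar>m\<bar> / \<kappa>\<^sup>2)"
      using mirror_bounded by (intro AE_I2) (auto simp: indicator_def intro: add_nonneg_nonneg)
    have [measurable]: "Measurable.pred P (av M)"
      using qk that unfolding av_def[abs_def] by (intro pred_forall_less Z_measurable) auto
    show "(\<lambda>\<omega>. mirror x (Z s \<omega>) * indicator (?A M) \<omega>) \<in> borel_measurable P"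
      unfolding indicator_def mem_Collect_eq by measurable
  qed
  have "(\<integral>\<omega>. mirror x (Z s \<omega>) * indicator (?A N) \<omega> \<partial>P) - (\<integral>\<omega>. mirror x (Z s \<omega>) * indicator (?A (Suc N)) \<omega> \<partial>P)
     = (\<integral>\<omega>. mirror x (Z s \<omega>) * indicator (?A N) \<omega> - mirror x (Z s \<omega>) * indicator (?A (Suc N)) \<omega> \<partial>P)"
    by (rule Bochner_Integration.integral_diff[symmetric]) (intro int; simp)+
  also have "\<dots> = (\<integral>\<omega>. H (Y \<omega>, Z s \<omega> - Z (q N) \<omega>) \<partial>P)"
    by (intro Bochner_Integration.integral_cong refl)
      (auto simp: indicator_def H_def Y_def av_def less_Suc_eq not_le split: if_splits)
  finally show ?case using Suc neg by (simp add: av_def)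
qed

text \<open>Since \<open>mirror\<close> is at most the indicator of the upper window, the
  probability dominates the restricted integral of \<open>mirror\<close>, hence by reflection the
  unrestricted one. The latter is \<open>integral_mirror\<close> at \<open>d = - x\<close>, whose
  factor \<open>1 - exp (- 2 * u * x / (\<kappa>\<^sup>2 * s))\<close> is of order \<open>x\<close>.
  The constant is the same for all grids, which permits refining them.\<close>

lemma avoidance_lower_bound:
  assumes \<epsilon>: "0 < \<epsilon>" "\<epsilon> \<le> T"
  shows "\<exists>c>0. \<forall>x s (N::nat) q. 0 < x \<longrightarrow> x \<le> 1 \<longrightarrow> \<epsilon> / 2 \<le> s \<longrightarrow> s \<le> \<epsilon> \<longrightarrow>
    (\<forall>k<N. 0 \<le> q k \<and> q k < s) \<longrightarrow> (\<forall>i j. i \<le> j \<longrightarrow> j < N \<longrightarrow> q i \<le> q j) \<longrightarrow>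
    c * x \<le> prob {\<omega>\<in>space P. (\<forall>k<N. - x < Z (q k) \<omega>) \<and> Z s \<omega> + x \<in> {1..2}}"
proof -
  \<comment> \<open>\<open>c0\<close> bounds the density at \<open>u - x\<close> from below for
    \<open>u\<close> in \<open>{1..2}\<close>, \<open>0 < x \<le> 1\<close> and \<open>s\<close>
    between \<open>\<epsilon> / 2\<close> and \<epsilon>; \<open>t * x\<close> bounds the exponent
    \<open>2 * u * x / (\<kappa>\<^sup>2 * s)\<close> from below.\<close>
  define c0 where "c0 = 1 / sqrt (2 * pi * (\<kappa>\<^sup>2 * \<epsilon>)) * exp (- (2 + \<bar>m\<bar> * \<epsilon>)\<^sup>2 / (\<kappa>\<^sup>2 * \<epsilon>))"
  define t where "t = 2 / (\<kappa>\<^sup>2 * \<epsilon>)"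
  have c0: "0 < c0" and t: "0 < t" using \<epsilon> vol_pos by (auto simp: c0_def t_def)
  have "c0 * (t / (1 + t)) * x \<le> prob {\<omega>\<in>space P. (\<forall>k<N. - x < Z (q k) \<omega>) \<and> Z s \<omega> + x \<in> {1..2}}"
    if x: "0 < x" "x \<le> 1" and s: "\<epsilon> / 2 \<le> s" "s \<le> \<epsilon>"
      and q: "\<forall>k<N. 0 \<le> q k \<and> q k < s" "\<forall>i j. i \<le> j \<longrightarrow> j < N \<longrightarrow> q i \<le> q j"
    for x s q and N :: nat
  proof -
    have s0: "0 < s" "s \<le> T" using s \<epsilon> by auto
    let ?p = "normal_density (m * s) (\<kappa> * sqrt s)"
    define av where "av \<omega> \<longleftrightarrow> (\<forall>k<N. - x < Z (q k) \<omega>)" for \<omega>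
    let ?A = "{\<omega>. av \<omega>}"
    let ?f = "\<lambda>u. ?p (u + (- x)) * (1 - exp (2 * u * (- x) / (\<kappa>\<^sup>2 * s)))"
    have [measurable]: "Z s \<in> borel_measurable P" using s0 by (intro Z_measurable) auto
    have [measurable]: "Measurable.pred P av"
      unfolding av_def[abs_def] using q(1) s0 by (intro pred_forall_less Z_measurable) auto
    have pos: "0 < \<kappa> * sqrt s" using s0 vol_pos by simp
    have lower: "c0 * (t / (1 + t)) * x \<le> ?f u" if u: "u \<in> {1..2}" for u
    proof -
      have "c0 \<le> ?p (u + (- x))"
        unfolding c0_def normal_density_def
      proof (intro mult_mono)
        have "sqrt (2 * pi * (\<kappa> * sqrt s)\<^sup>2) \<le> sqrt (2 * pi * (\<kappa>\<^sup>2 * \<epsilon>))"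
          using s s0 \<epsilon> by (simp add: power_mult_distrib mult_left_mono)
        then show "1 / sqrt (2 * pi * (\<kappa>\<^sup>2 * \<epsilon>)) \<le> 1 / sqrt (2 * pi * (\<kappa> * sqrt s)\<^sup>2)"
          using pos s0 vol_pos by (intro frac_le) (auto simp: zero_less_mult_iff)
        have "\<bar>u + - x - m * s\<bar> \<le> \<bar>u + - x\<bar> + \<bar>m * s\<bar>" by (rule abs_triangle_ineq4)
        also have "\<dots> \<le> 2 + \<bar>m\<bar> * \<epsilon>"
          using u x s s0 by (intro add_mono) (auto simp: abs_mult mult_left_mono)
        finally have sq: "(u + - x - m * s)\<^sup>2 \<le> (2 + \<bar>m\<bar> * \<epsilon>)\<^sup>2"
          using \<epsilon> by (intro abs_le_square_iff[THEN iffD1]) auto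
        have "(u + - x - m * s)\<^sup>2 / (2 * (\<kappa> * sqrt s)\<^sup>2) \<le> (2 + \<bar>m\<bar> * \<epsilon>)\<^sup>2 / (\<kappa>\<^sup>2 * \<epsilon>)"
        proof (rule frac_le)
          have "\<kappa>\<^sup>2 * \<epsilon> \<le> \<kappa>\<^sup>2 * (2 * s)" using s by (intro mult_left_mono) auto
          then show "\<kappa>\<^sup>2 * \<epsilon> \<le> 2 * (\<kappa> * sqrt s)\<^sup>2" using s0 by (simp add: power_mult_distrib)
        qed (use sq \<epsilon> vol_pos in auto)
        then show "exp (- (2 + \<bar>m\<bar> * \<epsilon>)\<^sup>2 / (\<kappa>\<^sup>2 * \<epsilon>)) \<le> exp (- (u + - x - m * s)\<^sup>2 / (2 * (\<kappa> * sqrt s)\<^sup>2))"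
          by simp
      qed auto
      \<comment> \<open>From \<open>1 - exp (- t * x) \<ge> t * x / (1 + t * x)\<close> and
        \<open>x \<le> 1\<close>.\<close>
      moreover have "t / (1 + t) * x \<le> 1 - exp (2 * u * (- x) / (\<kappa>\<^sup>2 * s))"
      proof -
        have "t * x \<le> 2 * u * x / (\<kappa>\<^sup>2 * s)"
        proof -
          have "2 * x / (\<kappa>\<^sup>2 * \<epsilon>) \<le> 2 * u * x / (\<kappa>\<^sup>2 * s)"
            using u x s s0 vol_pos by (intro frac_le mult_mono) auto
          then show ?thesis by (simp add: t_def)
        qed
        moreover have "2 * u * (- x) / (\<kappa>\<^sup>2 * s) = - (2 * u * x / (\<kappa>\<^sup>2 * s))" by simp
        ultimately have "exp (2 * u * (- x) / (\<kappa>\<^sup>2 * s)) \<le> exp (- (t * x))" by simp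
        also have "\<dots> \<le> 1 / (1 + t * x)"
        proof -
          have "1 + t * x \<le> exp (t * x)" by (simp add: exp_ge_add_one_self)
          then show ?thesis using t x by (simp add: exp_minus inverse_eq_divide frac_le add_pos_pos)
        qed
        finally have "1 - 1 / (1 + t * x) \<le> 1 - exp (2 * u * (- x) / (\<kappa>\<^sup>2 * s))" by simp
        moreover have "t / (1 + t) * x \<le> 1 - 1 / (1 + t * x)"
        proof -
          have "0 < 1 + t * x" using t x by (simp add: add_pos_pos)
          then have "1 - 1 / (1 + t * x) = t * x / (1 + t * x)" by (simp add: field_simps)
          moreover have "t * x / (1 + t) \<le> t * x / (1 + t * x)"
            using t x by (intro frac_le) (auto simp: add_pos_pos mult_le_cancel_left1)
          ultimately show ?thesis by simp
        qed
        ultimately show ?thesis by linarith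
      qed
      ultimately have "c0 * (t / (1 + t) * x) \<le> ?f u"
        using c0 t x by (intro mult_mono) auto
      then show ?thesis by (simp add: mult.assoc)
    qed
    have "c0 * (t / (1 + t)) * x = (\<integral>u. indicator {1..2::real} u * (c0 * (t / (1 + t)) * x) \<partial>lborel)"
      by simp
    also have "\<dots> \<le> (\<integral>u. indicator {1..2} u * ?f u \<partial>lborel)"
    proof (rule integral_mono)
      show "integrable lborel (\<lambda>u. indicator {1..2::real} u * (c0 * (t / (1 + t)) * x))"
        by (intro integrable_mult_left) simp
      show "integrable lborel (\<lambda>u. indicator {1..2} u * ?f u)"
      proof (rule Bochner_Integration.integrable_bound)
        show "integrable lborel (\<lambda>u. indicator {1..2::real} u * (1 / (\<kappa> * sqrt s)))"
          by (intro integrable_mult_left) simp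
        have "\<bar>?f u\<bar> \<le> 1 / (\<kappa> * sqrt s)" if "u \<in> {1..2}" for u
        proof -
          have "exp (2 * u * (- x) / (\<kappa>\<^sup>2 * s)) \<le> 1"
            using that x s0 vol_pos by (auto intro!: divide_nonpos_nonneg)
          then have f: "0 \<le> 1 - exp (2 * u * (- x) / (\<kappa>\<^sup>2 * s))" by simp
          have "?f u \<le> 1 / (\<kappa> * sqrt s) * 1"
            using f pos by (intro mult_mono normal_density_le) auto
          moreover have "0 \<le> ?f u" using f by (intro mult_nonneg_nonneg) auto
          ultimately show ?thesis by simp
        qed
        then show "AE u in lborel. norm (indicator {1..2} u * ?f u) \<le> norm (indicator {1..2} u * (1 / (\<kappa> * sqrt s)))"
          using pos by (intro AE_I2) (auto simp: indicator_def)
      qed measurable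
      show "indicator {1..2} u * (c0 * (t / (1 + t)) * x) \<le> indicator {1..2} u * ?f u" for u
        using lower[of u] by (auto simp: indicator_def)
    qed
    \<comment> \<open>The choice \<open>d = - x\<close> places the starting point at 0.\<close>
    also have "\<dots> = (\<integral>v. mirror x (- x - (- x) + v) \<partial>law s)"
      by (rule integral_mirror[OF s0(1), symmetric])
    also have "\<dots> = (\<integral>\<omega>. mirror x (Z s \<omega>) \<partial>P)"
      unfolding distr_Z[OF s0, symmetric] by (subst integral_distr) auto
    also have "\<dots> \<le> (\<integral>\<omega>. mirror x (Z s \<omega>) * indicator ?A \<omega> \<partial>P)"
      unfolding av_def using q s0 by (intro reflection_principle) auto
    also have "\<dots> \<le> (\<integral>\<omega>. indicator {\<omega>\<in>space P. av \<omega> \<and> Z s \<omega> + x \<in> {1..2}} \<omega> \<partial>P)"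
    proof (rule integral_mono)
      show "integrable P (\<lambda>\<omega>. mirror x (Z s \<omega>) * indicator ?A \<omega>)"
      proof (rule integrable_const_bound[where B="1 + exp (4 * \<bar>m\<bar> / \<kappa>\<^sup>2)"])
        show "AE \<omega> in P. norm (mirror x (Z s \<omega>) * indicator ?A \<omega>) \<le> 1 + exp (4 * \<bar>m\<bar> / \<kappa>\<^sup>2)"
          using mirror_bounded by (intro AE_I2) (auto simp: indicator_def intro: add_nonneg_nonneg)
        show "(\<lambda>\<omega>. mirror x (Z s \<omega>) * indicator ?A \<omega>) \<in> borel_measurable P"
          unfolding indicator_def mem_Collect_eq by measurable
      qed
      show "integrable P (indicat_real {\<omega>\<in>space P. av \<omega> \<and> Z s \<omega> + x \<in> {1..2}})"
        by (intro integrable_real_indicator) (auto simp: emeasure_eq_measure)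
      fix \<omega> assume "\<omega> \<in> space P"
      then show "mirror x (Z s \<omega>) * indicator ?A \<omega> \<le>
          indicator {\<omega>\<in>space P. av \<omega> \<and> Z s \<omega> + x \<in> {1..2}} \<omega>"
        by (auto simp: indicator_def mirror_def)
    qed
    also have "\<dots> = prob {\<omega>\<in>space P. av \<omega> \<and> Z s \<omega> + x \<in> {1..2}}"
      by simp
    finally show ?thesis unfolding av_def .
  qed
  moreover have "0 < c0 * (t / (1 + t))" using c0 t by simp
  ultimately show ?thesis by (intro exI[of _ "c0 * (t / (1 + t))"] conjI allI impI)
qed

section \<open>Integrals up to a random time and occupation near 0\<close>

lemma stopped_integral:
  fixes \<phi> :: "real \<Rightarrow> 'a \<Rightarrow> real"
  assumes [measurable]: "(\<lambda>p. \<phi> (fst p) (snd p)) \<in> borel_measurable (borel \<Otimes>\<^sub>M P)"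
    and int: "integrable LP (\<lambda>p. indicator {0..h} (fst p) * \<phi> (fst p) (snd p))"
    and [measurable]: "\<rho> \<in> borel_measurable P" and \<rho>: "\<And>\<omega>. \<omega> \<in> space P \<Longrightarrow> \<rho> \<omega> \<le> h"
  shows "integrable LP (\<lambda>p. indicator {0..\<rho> (snd p)} (fst p) * \<phi> (fst p) (snd p))"
    and "integrable P (\<lambda>\<omega>. LINT s:{0..\<rho> \<omega>}|lborel. \<phi> s \<omega>)"
    and "(\<integral>\<omega>. (LINT s:{0..\<rho> \<omega>}|lborel. \<phi> s \<omega>) \<partial>P) =
      (\<integral>p. indicator {0..\<rho> (snd p)} (fst p) * \<phi> (fst p) (snd p) \<partial>LP)"
proof -
  interpret PS: pair_sigma_finite lborel P by (rule pair_sigma_finite)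
  have [measurable]: "(\<lambda>p. indicator {0..\<rho> (snd p)} (fst p) :: real) \<in> borel_measurable (borel \<Otimes>\<^sub>M P)"
    unfolding indicator_def atLeastAtMost_iff by measurable
  have [measurable]: "(\<lambda>p. \<phi> (fst p) (snd p)) \<in> borel_measurable LP"
    "(\<lambda>p. indicator {0..\<rho> (snd p)} (fst p) :: real) \<in> borel_measurable LP"
    by (simp_all cong: measurable_cong_sets)
  \<comment> \<open>The strip up to \<open>h\<close> dominates every random upper limit below
    \<open>h\<close>. Fubini then turns pathwise integrals into integrals over \<open>LP\<close>,
    where integrands can be compared pointwise.\<close>
  show *: "integrable LP (\<lambda>p. indicator {0..\<rho> (snd p)} (fst p) * \<phi> (fst p) (snd p))"
  proof (rule Bochner_Integration.integrable_bound[OF int])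
    show "AE p in LP. norm (indicator {0..\<rho> (snd p)} (fst p) * \<phi> (fst p) (snd p)) \<le>
        norm (indicator {0..h} (fst p) * \<phi> (fst p) (snd p))"
    proof (rule AE_I2)
      fix p :: "real \<times> 'a" assume "p \<in> space LP"
      then have "\<rho> (snd p) \<le> h" by (intro \<rho>) (auto simp: space_pair_measure)
      then show "norm (indicator {0..\<rho> (snd p)} (fst p) * \<phi> (fst p) (snd p)) \<le>
        norm (indicator {0..h} (fst p) * \<phi> (fst p) (snd p))"
        by (auto simp: indicator_def)
    qed
  qed measurable
  show "integrable P (\<lambda>\<omega>. LINT s:{0..\<rho> \<omega>}|lborel. \<phi> s \<omega>)"
    using PS.integrable_snd[of "\<lambda>s \<omega>. indicator {0..\<rho> \<omega>} s * \<phi> s \<omega>"] *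
    by (simp add: set_lebesgue_integral_def split_beta')
  show "(\<integral>\<omega>. (LINT s:{0..\<rho> \<omega>}|lborel. \<phi> s \<omega>) \<partial>P) =
      (\<integral>p. indicator {0..\<rho> (snd p)} (fst p) * \<phi> (fst p) (snd p) \<partial>LP)"
    using PS.integral_snd[of "\<lambda>s \<omega>. indicator {0..\<rho> \<omega>} s * \<phi> s \<omega>"] *
    by (simp add: set_lebesgue_integral_def split_beta')
qed

text \<open>The density is at most \<open>1 / (\<kappa> * sqrt s)\<close>. This singularity at 0 is
  integrable in time, which makes the expected time spent in \<open>{-x..0}\<close> of order
  \<open>x\<close>.\<close>

lemma prob_Z_interval:
  assumes "0 < s" "s \<le> T" "0 < x"
  shows "prob {\<omega>\<in>space P. Z s \<omega> \<in> {-x..0}} \<le> x / \<kappa> * s powr (-1/2)"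
proof -
  have [measurable]: "Z s \<in> borel_measurable P" using assms by (intro Z_measurable) auto
  have pos: "0 < \<kappa> * sqrt s" using assms vol_pos by simp
  have "ennreal (prob {\<omega>\<in>space P. Z s \<omega> \<in> {-x..0}}) = emeasure (distr P borel (Z s)) {-x..0}"
    by (subst emeasure_distr) (auto simp: emeasure_eq_measure intro!: arg_cong[where f=prob])
  also have "\<dots> = emeasure (law s) {-x..0}" using assms by (simp add: distr_Z)
  also have "\<dots> \<le> (\<integral>\<^sup>+v. ennreal (1 / (\<kappa> * sqrt s)) * indicator {-x..0} v \<partial>lborel)"
    using normal_density_le[OF pos] by (subst emeasure_density)
      (auto intro!: nn_integral_mono mult_right_mono ennreal_leI)
  also have "\<dots> = ennreal (1 / (\<kappa> * sqrt s) * x)"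
    using assms vol_pos ennreal_mult[of "1 / (\<kappa> * sqrt s)" x]
    by (subst nn_integral_cmult_indicator) auto
  also have "1 / (\<kappa> * sqrt s) * x = x / \<kappa> * s powr (-1/2)"
    using assms by (simp add: powr_minus powr_half_sqrt field_simps)
  finally show ?thesis using assms vol_pos by (subst (asm) ennreal_le_iff) auto
qed

lemma emeasure_strip: "emeasure LP ({a..b::real} \<times> space P) < \<infinity>"
  by (subst emeasure_pair_measure_Times) (auto simp: emeasure_space_1 emeasure_lborel_Icc_eq)

lemma integrable_strip:
  fixes f :: "real \<times> 'a \<Rightarrow> real"
  assumes "f \<in> borel_measurable LP"
    and "\<And>s \<omega>. \<omega> \<in> space P \<Longrightarrow> \<bar>f (s, \<omega>)\<bar> \<le> B * indicator {a..b} s"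
  shows "integrable LP f"
proof (rule Bochner_Integration.integrable_bound[OF _ assms(1)])
  show "integrable LP (\<lambda>p. B * indicator ({a..b} \<times> space P) p)"
    using emeasure_strip by (intro integrable_mult_right integrable_real_indicator) auto
  show "AE p in LP. norm (f p) \<le> norm (B * indicator ({a..b} \<times> space P) p)"
  proof (rule AE_I2)
    fix p :: "real \<times> 'a" assume "p \<in> space LP"
    then show "norm (f p) \<le> norm (B * indicator ({a..b} \<times> space P) p)"
      using assms(2)[of "snd p" "fst p"]
      by (cases "a \<le> fst p \<and> fst p \<le> b") (auto simp: space_pair_measure indicator_def)
  qed
qed

lemma inv_sqrt_integral:
  assumes "0 \<le> \<epsilon>"
  shows "integrable lborel (\<lambda>s. indicator {0..\<epsilon>} s * s powr (-1/2))"
    and "(\<integral>s. indicator {0..\<epsilon>} s * s powr (-1/2) \<partial>lborel) = 2 * sqrt \<epsilon>"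
proof -
  have "((\<lambda>s::real. s powr (-1/2)) has_integral (\<epsilon> powr (-1/2 + 1) / (-1/2 + 1))) {0..\<epsilon>}"
    using assms by (intro has_integral_powr_from_0) auto
  then have hi: "((\<lambda>s::real. s powr (-1/2)) has_integral (2 * sqrt \<epsilon>)) {0..\<epsilon>}"
    using assms by (simp add: powr_half_sqrt mult.commute)
  then have "((\<lambda>s::real. if s \<in> {0..\<epsilon>} then s powr (-1/2) else 0) has_integral (2 * sqrt \<epsilon>)) UNIV"
    by (simp only: has_integral_restrict_UNIV)
  also have "(\<lambda>s::real. if s \<in> {0..\<epsilon>} then s powr (-1/2) else 0) = (\<lambda>s. indicator {0..\<epsilon>} s * s powr (-1/2))"
    by (simp add: indicator_def fun_eq_iff)
  finally have "((\<lambda>s::real. indicator {0..\<epsilon>} s * s powr (-1/2)) has_integral (2 * sqrt \<epsilon>)) UNIV" .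
  then have "has_bochner_integral lborel (\<lambda>s. indicator {0..\<epsilon>} s * s powr (-1/2)) (2 * sqrt \<epsilon>)"
    by (intro has_bochner_integral_nn_integral nn_integral_has_integral_lborel) (auto simp: assms)
  then show "integrable lborel (\<lambda>s. indicator {0..\<epsilon>} s * s powr (-1/2))"
    "(\<integral>s. indicator {0..\<epsilon>} s * s powr (-1/2) \<partial>lborel) = 2 * sqrt \<epsilon>"
    by (auto simp: has_bochner_integral_iff)
qed

lemma occupation_near_zero:
  assumes \<epsilon>: "0 < \<epsilon>" "\<epsilon> \<le> T" and x: "0 < x"
  shows "(\<integral>p. indicator {0..\<epsilon>} (fst p) * indicator {-x..0} (Zc (fst p) (snd p)) \<partial>LP)
    \<le> x / \<kappa> * (2 * sqrt \<epsilon>)"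
proof -
  interpret PS: pair_sigma_finite lborel P by (rule pair_sigma_finite)
  let ?f = "\<lambda>p. indicator {0..\<epsilon>} (fst p) * indicator {-x..0} (Zc (fst p) (snd p)) :: real"
  have Zm[measurable]: "(\<lambda>p. Zc (fst p) (snd p)) \<in> borel_measurable LP"
    using Zc_joint_measurable by (simp cong: measurable_cong_sets)
  have int: "integrable LP ?f"
    by (rule integrable_strip[of _ 1 0 \<epsilon>]) (measurable, auto simp: indicator_def)
  have "(\<integral>p. ?f p \<partial>LP) = (\<integral>s. (\<integral>\<omega>. ?f (s, \<omega>) \<partial>P) \<partial>lborel)"
    using PS.integral_fst'[OF int] by simp
  also have "\<dots> \<le> (\<integral>s. x / \<kappa> * (indicator {0..\<epsilon>} s * s powr (-1/2)) \<partial>lborel)"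
  proof (rule integral_mono_AE)
    show "integrable lborel (\<lambda>s. (\<integral>\<omega>. ?f (s, \<omega>) \<partial>P))"
      using PS.integrable_fst'[OF int] by simp
    show "integrable lborel (\<lambda>s. x / \<kappa> * (indicator {0..\<epsilon>} s * s powr (-1/2)))"
      using inv_sqrt_integral[of \<epsilon>] \<epsilon> by (intro integrable_mult_right) auto
    show "AE s in lborel. (\<integral>\<omega>. ?f (s, \<omega>) \<partial>P) \<le> x / \<kappa> * (indicator {0..\<epsilon>} s * s powr (-1/2))"
      using AE_lborel_singleton[of 0]
    proof eventually_elim
      fix s :: real assume s: "s \<noteq> 0"
      show "(\<integral>\<omega>. ?f (s, \<omega>) \<partial>P) \<le> x / \<kappa> * (indicator {0..\<epsilon>} s * s powr (-1/2))"
      proof (cases "s \<in> {0..\<epsilon>}")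
        case True
        have "(\<integral>\<omega>. ?f (s, \<omega>) \<partial>P) = (\<integral>\<omega>. indicator {\<omega>\<in>space P. Z s \<omega> \<in> {-x..0}} \<omega> \<partial>P)"
          using True \<epsilon> by (intro Bochner_Integration.integral_cong) (auto simp: indicator_def Zc_eq)
        also have "\<dots> = prob {\<omega>\<in>space P. Z s \<omega> \<in> {-x..0}}"
          by (simp add: Int_absorb2 subset_eq del: atLeastAtMost_iff)
        finally show ?thesis using True s \<epsilon> prob_Z_interval[of s x] x by simp
      qed simp
    qed
  qed
  also have "\<dots> = x / \<kappa> * (2 * sqrt \<epsilon>)" using inv_sqrt_integral[of \<epsilon>] \<epsilon> by simp
  finally show ?thesis .
qed

text \<open>A minimum over finitely many grid times, so the stopping property is a finite union of
  events. The equivalence for \<open>s \<le> \<sigma> \<omega>\<close> has a strict inequality in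
  time: survival up to \<open>s\<close> depends only on earlier grid points, which is the event of
  \<open>avoidance_lower_bound\<close>.\<close>

lemma grid_hitting_time:
  assumes \<epsilon>: "0 < \<epsilon>" "\<epsilon> \<le> T"
  obtains \<sigma> where "stopping_time F \<sigma>" "\<And>\<omega>. 0 \<le> \<sigma> \<omega> \<and> \<sigma> \<omega> \<le> \<epsilon>"
    "\<And>s \<omega>. s \<le> \<sigma> \<omega> \<longleftrightarrow> s \<le> \<epsilon> \<and> (\<forall>k\<le>Suc n. real k * \<epsilon> / real (Suc n) < s \<longrightarrow> - x < Z (real k * \<epsilon> / real (Suc n)) \<omega>)"
proof
  define q where "q k = real k * \<epsilon> / real (Suc n)" for k
  \<comment> \<open>Inserting \<epsilon> keeps the set nonempty and caps the minimum.\<close>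
  define B where "B \<omega> = insert \<epsilon> (q ` {k. k \<le> Suc n \<and> Z (q k) \<omega> \<le> - x})" for \<omega>
  have q: "0 \<le> q k" for k using \<epsilon> by (simp add: q_def)
  have qle: "q k \<le> \<epsilon>" if "k \<le> Suc n" for k
  proof -
    have "real k * \<epsilon> \<le> real (Suc n) * \<epsilon>" using that \<epsilon> by (intro mult_right_mono) auto
    then show ?thesis by (simp add: q_def divide_le_eq mult.commute del: of_nat_Suc)
  qed
  have fin: "finite (B \<omega>)" "B \<omega> \<noteq> {}" for \<omega> by (auto simp: B_def)
  have le: "Min (B \<omega>) \<le> t \<longleftrightarrow> \<epsilon> \<le> t \<or> (\<exists>k\<in>{..Suc n}. q k \<le> t \<and> Z (q k) \<omega> \<le> - x)" for t \<omega>
    using fin by (auto simp: Min_le_iff B_def)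
  show "stopping_time F (\<lambda>\<omega>. Min (B \<omega>))"
  proof
    fix t
    have *: "{\<omega> \<in> space (F t). q k \<le> t \<and> Z (q k) \<omega> \<le> - x} \<in> sets (F t)" if "k \<le> Suc n" for k
    proof (cases "q k \<le> t")
      case True
      then have [measurable]: "Z (q k) \<in> borel_measurable (F t)"
        using q qle[OF that] \<epsilon> by (intro measurable_F_mono[OF Z_adapted]) auto
      show ?thesis by measurable
    qed simp
    have **: "{\<omega> \<in> space (F t). \<exists>k\<in>{..Suc n}. q k \<le> t \<and> Z (q k) \<omega> \<le> - x} \<in> sets (F t)"
      by (rule sets.sets_Collect_finite_Ex[OF *]) simp_all
    show "Measurable.pred (F t) (\<lambda>\<omega>. Min (B \<omega>) \<le> t)"
    proof (cases "\<epsilon> \<le> t")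
      case True
      then have "(\<lambda>\<omega>. Min (B \<omega>) \<le> t) = (\<lambda>\<omega>. True)" unfolding le by simp
      then show ?thesis by simp
    next
      case False
      then have eq: "(\<lambda>\<omega>. Min (B \<omega>) \<le> t) = (\<lambda>\<omega>. \<exists>k\<in>{..Suc n}. q k \<le> t \<and> Z (q k) \<omega> \<le> - x)"
        unfolding le by simp
      show ?thesis unfolding eq pred_def by (rule **)
    qed
  qed
  show "0 \<le> Min (B \<omega>) \<and> Min (B \<omega>) \<le> \<epsilon>" for \<omega>
    using fin[of \<omega>] q \<epsilon> by (auto simp: B_def)
  show "s \<le> Min (B \<omega>) \<longleftrightarrow> s \<le> \<epsilon> \<and> (\<forall>k\<le>Suc n. real k * \<epsilon> / real (Suc n) < s \<longrightarrow> - x < Z (real k * \<epsilon> / real (Suc n)) \<omega>)"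
    for s \<omega>
    using fin[of \<omega>] unfolding q_def[symmetric] by (auto simp: B_def not_le[symmetric])
qed

text \<open>Rewrites the grid times before \<open>s\<close> as an index range \<open>k < N\<close>,
  the form in which the avoidance bound takes them.\<close>

lemma initial_segment_of_grid:
  fixes s \<epsilon> :: real
  assumes "0 < \<epsilon>" "s \<le> \<epsilon>"
  obtains N where "\<And>k. k < N \<longleftrightarrow> k \<le> Suc n \<and> real k * \<epsilon> / real (Suc n) < s"
proof -
  let ?q = "\<lambda>k. real k * \<epsilon> / real (Suc n)"
  define N where "N = (LEAST k. s \<le> ?q k)"
  have top: "s \<le> ?q (Suc n)" using assms by (simp del: of_nat_Suc)
  then have N: "s \<le> ?q N" "N \<le> Suc n" unfolding N_def by (rule LeastI, rule Least_le)
  have "k < N \<longleftrightarrow> k \<le> Suc n \<and> ?q k < s" for k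
  proof
    assume "k < N"
    then show "k \<le> Suc n \<and> ?q k < s" using not_less_Least[of k "\<lambda>k. s \<le> ?q k"] N by (auto simp: N_def not_le)
  next
    assume k: "k \<le> Suc n \<and> ?q k < s"
    show "k < N"
    proof (rule ccontr)
      assume "\<not> k < N"
      then have "?q N \<le> ?q k" using assms by (intro divide_right_mono mult_right_mono) auto
      then show False using k N by simp
    qed
  qed
  then show ?thesis by (rule that)
qed

text \<open>
  Run until \<open>Z\<close> falls below \<open>-x\<close>. Up to the discretization error \<open>U2\<close>, the positive values of \<open>g\<close>
  contribute at most a multiple of \<open>x * g (-x)\<close>, because \<open>Z\<close> lies in \<open>{-x..0}\<close> with probability
  of order \<open>x\<close>, while the excursions that survive to the levels where \<open>g\<close> is negative contribute
  at least a fixed multiple of \<open>x\<close>. Since \<open>g (-x)\<close> tends to 0, no assumption on the slope of \<open>g\<close>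
  at 0 is needed.
\<close>

lemma exists_short_stopping_time:
  fixes g :: "real \<Rightarrow> real"
  assumes \<epsilon>: "0 < \<epsilon>" "\<epsilon> \<le> T" and r: "0 \<le> r"
    and g: "antimono g" "g 0 = 0" "\<And>z. 0 < z \<Longrightarrow> g z < 0" "(g \<longlongrightarrow> 0) (at_left 0)"
    and int: "integrable LP (\<lambda>p. indicator {0..\<epsilon>} (fst p) * g (Zc (fst p) (snd p)))"
  obtains \<sigma> where "stopping_time F \<sigma>" "\<And>\<omega>. 0 \<le> \<sigma> \<omega> \<and> \<sigma> \<omega> \<le> \<epsilon>"
    "(\<integral>\<omega>. (LINT s:{0..\<sigma> \<omega>}|lborel. exp (- r * s) * g (Zc s \<omega>)) \<partial>P) < 0"
proof -
  interpret PS: pair_sigma_finite lborel P by (rule pair_sigma_finite)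
  have [measurable]: "g \<in> borel_measurable borel"
  proof -
    have "mono (\<lambda>z. - g z)" using g(1) by (auto simp: mono_def antimono_def)
    then have "(\<lambda>z. - (- g z)) \<in> borel_measurable borel"
      by (intro borel_measurable_uminus borel_measurable_mono)
    then show ?thesis by simp
  qed
  have Zm[measurable]: "(\<lambda>p. Zc (fst p) (snd p)) \<in> borel_measurable LP"
    using Zc_joint_measurable by (simp cong: measurable_cong_sets)
  define \<phi> where "\<phi> s \<omega> = exp (- r * s) * g (Zc s \<omega>)" for s \<omega>
  have \<phi>m: "(\<lambda>p. \<phi> (fst p) (snd p)) \<in> borel_measurable (borel \<Otimes>\<^sub>M P)" unfolding \<phi>_def by measurable
  have \<phi>m'[measurable]: "(\<lambda>p. \<phi> (fst p) (snd p)) \<in> borel_measurable LP"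
    unfolding \<phi>_def by measurable
  have \<phi>_int: "integrable LP (\<lambda>p. indicator {0..\<epsilon>} (fst p) * \<phi> (fst p) (snd p))"
    using r by (intro Bochner_Integration.integrable_bound[OF int])
      (auto simp: \<phi>_def indicator_def abs_mult intro!: AE_I2 mult_left_le_one_le)
  obtain c where c: "0 < c" and avoid: "\<And>x s N q. 0 < x \<Longrightarrow> x \<le> 1 \<Longrightarrow> \<epsilon> / 2 \<le> s \<Longrightarrow> s \<le> \<epsilon> \<Longrightarrow>
    (\<forall>k<(N::nat). 0 \<le> q k \<and> q k < s) \<Longrightarrow> (\<forall>i j. i \<le> j \<longrightarrow> j < N \<longrightarrow> q i \<le> q j) \<Longrightarrow>
    c * x \<le> prob {\<omega>\<in>space P. (\<forall>k<N. - x < Z (q k) \<omega>) \<and> Z s \<omega> + x \<in> {1..2}}"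
    using avoidance_lower_bound[OF \<epsilon>] by (elim exE conjE) (rule that, assumption, simp only:)
  \<comment> \<open>A lower bound for the discounted loss rate wherever \<open>Z \<ge> 1/2\<close>,
    which holds in the window \<open>Z + x \<ge> 1\<close> once \<open>x \<le> 1/2\<close>.\<close>
  define \<gamma> where "\<gamma> = - g (1/2) * exp (- r * \<epsilon>)"
  have \<gamma>: "0 < \<gamma>" using g(3)[of "1/2"] by (simp add: \<gamma>_def mult_neg_pos)
  \<comment> \<open>\<open>x * K\<close> bounds the expected time in \<open>{-x..0}\<close>, by
    \<open>occupation_near_zero\<close>.\<close>
  define K where "K = 2 * sqrt \<epsilon> / \<kappa>"
  have K: "0 < K" using \<epsilon> vol_pos by (simp add: K_def)
  \<comment> \<open>\<open>x * D\<close> bounds the contribution of surviving paths: probability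
    \<open>c * x\<close> and loss rate \<gamma>, during a time of length
    \<open>\<epsilon> / 2\<close>.\<close>
  define D where "D = \<gamma> * (c * (\<epsilon> / 2))"
  have D: "0 < D" using \<gamma> c \<epsilon> by (simp add: D_def)
  obtain x where x: "0 < x" "x \<le> 1/2" "g (- x) * K < D"
  proof -
    have "\<forall>\<^sub>F z in at_left 0. g z < D / K" using g(4) D K by (intro order_tendstoD) auto
    then obtain b where b: "b < 0" "\<And>z. b < z \<Longrightarrow> z < 0 \<Longrightarrow> g z < D / K"
      unfolding eventually_at_left_field by auto
    let ?x = "min (1/2) (- b / 2)"
    have "g (- ?x) < D / K" using b(1) by (intro b(2)) auto
    then show ?thesis using b(1) K by (intro that[of ?x]) (auto simp: pos_less_divide_eq)
  qed
  have gx: "0 \<le> g (- x)" using g(1,2) x antimonoD[OF g(1), of "- x" 0] by simp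
  define Q where "Q n \<sigma> \<longleftrightarrow> stopping_time F \<sigma> \<and> (\<forall>\<omega>. 0 \<le> \<sigma> \<omega> \<and> \<sigma> \<omega> \<le> \<epsilon>) \<and>
    (\<forall>s \<omega>. s \<le> \<sigma> \<omega> \<longleftrightarrow> s \<le> \<epsilon> \<and> (\<forall>k\<le>Suc n. real k * \<epsilon> / real (Suc n) < s \<longrightarrow> - x < Z (real k * \<epsilon> / real (Suc n)) \<omega>))"
    for n \<sigma>
  have "\<exists>\<sigma>. Q n \<sigma>" for n
  proof (rule grid_hitting_time[OF \<epsilon>, of n x])
    fix \<sigma> :: "'a \<Rightarrow> real" assume *: "stopping_time F \<sigma>" "\<And>\<omega>. 0 \<le> \<sigma> \<omega> \<and> \<sigma> \<omega> \<le> \<epsilon>"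
      "\<And>s \<omega>. s \<le> \<sigma> \<omega> \<longleftrightarrow> s \<le> \<epsilon> \<and> (\<forall>k\<le>Suc n. real k * \<epsilon> / real (Suc n) < s \<longrightarrow> - x < Z (real k * \<epsilon> / real (Suc n)) \<omega>)"
    have "Q n \<sigma>" unfolding Q_def
      by (intro conjI allI, rule *(1), rule *(2)[THEN conjunct1], rule *(2)[THEN conjunct2], rule *(3))
    then show "\<exists>\<sigma>. Q n \<sigma>" by blast
  qed
  then have "\<exists>\<sigma>. \<forall>n. Q n (\<sigma> n)" by (intro choice allI)
  then obtain \<sigma> where Q: "\<And>n. Q n (\<sigma> n)" by blast
  note Q' = Q[unfolded Q_def]
  have st: "stopping_time F (\<sigma> n)" for n using Q'[of n] by (rule conjunct1)
  have range: "0 \<le> \<sigma> n \<omega>" "\<sigma> n \<omega> \<le> \<epsilon>" for n \<omega>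
    using conjunct1[OF conjunct2[OF Q'[of n]]] by simp_all
  have before: "s \<le> \<sigma> n \<omega> \<longleftrightarrow> s \<le> \<epsilon> \<and> (\<forall>k\<le>Suc n. real k * \<epsilon> / real (Suc n) < s \<longrightarrow> - x < Z (real k * \<epsilon> / real (Suc n)) \<omega>)"
    for n \<omega> s
    by (rule spec[OF spec[OF conjunct2[OF conjunct2[OF Q'[of n]]]]])
  have \<sigma>m[measurable]: "\<sigma> n \<in> borel_measurable P" for n using st by (rule stopping_time_measurable)
  let ?J = "\<lambda>n p. indicator {0..\<sigma> n (snd p)} (fst p) * \<phi> (fst p) (snd p)"
  let ?U1 = "\<lambda>p. indicator {0..\<epsilon>} (fst p) * indicator {-x..0} (Zc (fst p) (snd p)) :: real"
  \<comment> \<open>\<open>U2\<close> is the cost of time spent below \<open>-x\<close> before the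
    grid notices it; \<open>U3\<close> indicates the survivors in the upper window during the second
    half of the time.\<close>
  define U2 where "U2 n p = of_bool (0 \<le> fst p \<and> fst p \<le> \<sigma> n (snd p)) * of_bool (Zc (fst p) (snd p) < - x) * \<bar>g (Zc (fst p) (snd p))\<bar>"
    for n p
  define U3 where "U3 n p = indicator {\<epsilon>/2..\<epsilon>} (fst p) * of_bool (fst p \<le> \<sigma> n (snd p)) * (indicator {1..2} (Zc (fst p) (snd p) + x) :: real)"
    for n p
  note J = stopped_integral[OF \<phi>m \<phi>_int \<sigma>m range(2)]
  have U2m[measurable]: "U2 n \<in> borel_measurable LP" for n unfolding U2_def[abs_def] by measurable
  have U3m[measurable]: "U3 n \<in> borel_measurable LP" for n unfolding U3_def[abs_def] by measurable
  have intU1: "integrable LP ?U1"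
    by (rule integrable_strip[of _ 1 0 \<epsilon>]) (measurable, auto simp: indicator_def)
  have intU3: "integrable LP (U3 n)" for n
    by (rule integrable_strip[of _ 1 "\<epsilon>/2" \<epsilon>]) (measurable, auto simp: U3_def indicator_def)
  have U2_bound: "norm (U2 n p) \<le> \<bar>indicator {0..\<epsilon>} (fst p) * g (Zc (fst p) (snd p))\<bar>" for n p
    using range[of n "snd p"] by (auto simp: U2_def indicator_def)
  have int': "integrable LP (\<lambda>p. \<bar>indicator {0..\<epsilon>} (fst p) * g (Zc (fst p) (snd p))\<bar>)"
    using int by (rule integrable_abs)
  have intU2: "integrable LP (U2 n)" for n
    using U2_bound by (intro Bochner_Integration.integrable_bound[OF int']) auto
  \<comment> \<open>Pointwise comparison in three zones: below \<open>-x\<close> by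
    \<open>U2\<close>, in \<open>{-x..0}\<close> by \<open>g (-x)\<close> on \<open>?U1\<close>, and
    above 0 by the loss on \<open>U3\<close>.\<close>
  have upper: "(\<integral>p. ?J n p \<partial>LP) \<le>
      g (- x) * (x / \<kappa> * (2 * sqrt \<epsilon>)) + (\<integral>p. U2 n p \<partial>LP) - \<gamma> * (c * x * (\<epsilon> / 2))" for n
  proof -
    have "(\<integral>p. ?J n p \<partial>LP) \<le> (\<integral>p. g (- x) * ?U1 p + U2 n p - \<gamma> * U3 n p \<partial>LP)"
    proof (rule integral_mono)
      show "integrable LP (?J n)" by (rule J(1))
      show "integrable LP (\<lambda>p. g (- x) * ?U1 p + U2 n p - \<gamma> * U3 n p)"
        using intU1 intU2 intU3 by (intro Bochner_Integration.integrable_diff Bochner_Integration.integrable_add integrable_mult_right)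
      fix p :: "real \<times> 'a"
      let ?s = "fst p" and ?z = "Zc (fst p) (snd p)"
      show "?J n p \<le> g (- x) * ?U1 p + U2 n p - \<gamma> * U3 n p"
      proof (cases "0 \<le> ?s \<and> ?s \<le> \<sigma> n (snd p)")
        case False
        then have "U3 n p = 0" "U2 n p = 0" and J0: "?J n p = 0" using \<epsilon> by (auto simp: U3_def U2_def indicator_def)
        then show ?thesis unfolding J0 using gx by simp
      next
        case True
        then have s: "0 \<le> ?s" "?s \<le> \<epsilon>" using range[of n "snd p"] by auto
        have J_eq: "?J n p = exp (- r * ?s) * g ?z" using True by (simp add: \<phi>_def)
        have e1: "exp (- r * ?s) \<le> 1" using r s by simp
        have e2: "exp (- r * \<epsilon>) \<le> exp (- r * ?s)" using r s by (simp add: mult_left_mono)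
        consider "?z < - x" | "- x \<le> ?z" "?z \<le> 0" | "0 < ?z" by linarith
        then show ?thesis
        proof cases
          case 1
          have "U3 n p = 0" using 1 by (simp add: U3_def)
          moreover have "U2 n p = \<bar>g ?z\<bar>" using 1 True by (simp add: U2_def)
          moreover have "exp (- r * ?s) * g ?z \<le> 1 * \<bar>g ?z\<bar>"
            using e1 1 x antimonoD[OF g(1), of ?z 0] g(2) by (intro mult_mono) auto
          ultimately show ?thesis using J_eq 1 by simp
        next
          case 2
          have "U3 n p = 0" using 2 x by (simp add: U3_def)
          moreover have "?U1 p = 1" using 2 s by simp
          moreover have "0 \<le> U2 n p" by (simp add: U2_def)
          moreover have "exp (- r * ?s) * g ?z \<le> 1 * g (- x)"
            using e1 2 antimonoD[OF g(1), of "- x" ?z] antimonoD[OF g(1), of ?z 0] g(2) by (intro mult_mono) auto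
          ultimately show ?thesis using J_eq by simp
        next
          case 3
          have z: "?U1 p = 0" "U2 n p = 0" using 3 x by (auto simp: U2_def)
          have neg: "g ?z < 0" using 3 by (rule g(3))
          show ?thesis
          proof (cases "U3 n p = 0")
            case True
            have "exp (- r * ?s) * g ?z \<le> 0" using neg by (simp add: mult_le_0_iff)
            then show ?thesis unfolding J_eq z True by simp
          next
            case False
            then have U3: "U3 n p = 1" and "1 \<le> ?z + x" by (auto simp: U3_def indicator_def split: if_splits)
            then have "- g ?z \<ge> - g (1/2)" using antimonoD[OF g(1), of "1/2" ?z] x by simp
            then have "\<gamma> \<le> - g ?z * exp (- r * ?s)"
              unfolding \<gamma>_def using e2 neg by (intro mult_mono) auto
            then show ?thesis unfolding J_eq z U3 by (simp add: mult.commute)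
          qed
        qed
      qed
    qed
    also have "\<dots> = g (- x) * (\<integral>p. ?U1 p \<partial>LP) + (\<integral>p. U2 n p \<partial>LP)
        - \<gamma> * (\<integral>p. U3 n p \<partial>LP)"
    proof -
      have i1: "integrable LP (\<lambda>p. g (- x) * ?U1 p)" using intU1 by (rule integrable_mult_right)
      have i3: "integrable LP (\<lambda>p. \<gamma> * U3 n p)" using intU3 by (rule integrable_mult_right)
      show ?thesis
        unfolding Bochner_Integration.integral_diff[OF Bochner_Integration.integrable_add[OF i1 intU2] i3]
          Bochner_Integration.integral_add[OF i1 intU2] by simp
    qed
    also have "\<dots> \<le> g (- x) * (x / \<kappa> * (2 * sqrt \<epsilon>)) + (\<integral>p. U2 n p \<partial>LP) - \<gamma> * (c * x * (\<epsilon> / 2))"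
    proof (intro diff_mono add_mono mult_left_mono order_refl gx)
      show "(\<integral>p. ?U1 p \<partial>LP) \<le> x / \<kappa> * (2 * sqrt \<epsilon>)"
        using occupation_near_zero[OF \<epsilon> x(1)] .
      have "c * x * (\<epsilon> / 2) = (\<integral>s. (c * x) * indicator {\<epsilon>/2..\<epsilon>} s \<partial>lborel)"
        using \<epsilon> by (simp add: field_simps)
      also have "\<dots> \<le> (\<integral>s. (\<integral>\<omega>. U3 n (s, \<omega>) \<partial>P) \<partial>lborel)"
      proof (rule integral_mono)
        show "integrable lborel (\<lambda>s. (c * x) * indicator {\<epsilon>/2..\<epsilon>} s)"
          by (intro integrable_mult_right integrable_real_indicator) (auto simp: emeasure_lborel_Icc_eq)
        show "integrable lborel (\<lambda>s. \<integral>\<omega>. U3 n (s, \<omega>) \<partial>P)" using PS.integrable_fst'[OF intU3] by simp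
        fix s
        show "(c * x) * indicator {\<epsilon>/2..\<epsilon>} s \<le> (\<integral>\<omega>. U3 n (s, \<omega>) \<partial>P)"
        proof (cases "s \<in> {\<epsilon>/2..\<epsilon>}")
          case False
          then show ?thesis by (simp add: U3_def)
        next
          case True
          then have s: "0 \<le> s" "s \<le> T" "s \<le> \<epsilon>" "\<epsilon> / 2 \<le> s" using \<epsilon> by auto
          let ?q = "\<lambda>k. real k * \<epsilon> / real (Suc n)"
          obtain N where N: "\<And>k. k < N \<longleftrightarrow> k \<le> Suc n \<and> ?q k < s"
            using initial_segment_of_grid[OF \<epsilon>(1) s(3), of n] by metis
          define av where "av \<omega> \<longleftrightarrow> (\<forall>k<N. - x < Z (?q k) \<omega>)" for \<omega>
          have av: "s \<le> \<sigma> n \<omega> \<longleftrightarrow> av \<omega>" for \<omega>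
            unfolding before av_def using N s by auto
          have "c * x \<le> prob {\<omega>\<in>space P. av \<omega> \<and> Z s \<omega> + x \<in> {1..2}}"
            unfolding av_def
          proof (rule avoid)
            show "\<forall>k<N. 0 \<le> ?q k \<and> ?q k < s" using N \<epsilon> by auto
            show "\<forall>i j. i \<le> j \<longrightarrow> j < N \<longrightarrow> ?q i \<le> ?q j"
              using \<epsilon> by (auto intro!: divide_right_mono mult_right_mono)
          qed (use x s in auto)
          also have "\<dots> = (\<integral>\<omega>. indicator {\<omega>\<in>space P. av \<omega> \<and> Z s \<omega> + x \<in> {1..2}} \<omega> \<partial>P)"
            by (simp add: Int_absorb2 subset_eq del: atLeastAtMost_iff)
          also have "\<dots> = (\<integral>\<omega>. U3 n (s, \<omega>) \<partial>P)"
            using True s by (intro Bochner_Integration.integral_cong refl) (simp add: U3_def av indicator_def Zc_eq)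
          finally show ?thesis using True by simp
        qed
      qed
      also have "\<dots> = (\<integral>p. U3 n p \<partial>LP)" by (rule PS.integral_fst'[OF intU3])
      finally show "c * x * (\<epsilon> / 2) \<le> (\<integral>p. U3 n p \<partial>LP)" .
    qed (use \<gamma> in auto)
    finally show ?thesis .
  qed
  \<comment> \<open>By continuity a path below \<open>-x\<close> at time \<open>s\<close> is already
    there shortly before, so a fine grid has stopped it by then and \<open>U2\<close> vanishes;
    dominated convergence finishes.\<close>
  have "(\<lambda>n. \<integral>p. U2 n p \<partial>LP) \<longlonglongrightarrow> (\<integral>(p::real \<times> 'a). 0 \<partial>LP)"
  proof (rule integral_dominated_convergence[where w="\<lambda>p. \<bar>indicator {0..\<epsilon>} (fst p) * g (Zc (fst p) (snd p))\<bar>"])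
    show "AE p in LP. (\<lambda>n. U2 n p) \<longlonglongrightarrow> 0"
    proof (rule AE_I2)
      fix p :: "real \<times> 'a" assume "p \<in> space LP"
      then have \<omega>: "snd p \<in> space P" by (auto simp: space_pair_measure)
      let ?s = "fst p" and ?\<omega> = "snd p"
      have "\<forall>\<^sub>F n in sequentially. U2 n p = 0"
      proof (cases "0 < ?s \<and> ?s \<le> \<epsilon> \<and> Zc ?s ?\<omega> < - x")
        case False
        have "\<not> (0 \<le> ?s \<and> ?s \<le> \<sigma> n ?\<omega> \<and> Zc ?s ?\<omega> < - x)" for n
          using False range(2)[of n ?\<omega>] x Z_0[OF \<omega>] T_pos by (cases "?s = 0") (auto simp: Zc_eq)
        then show ?thesis by (intro always_eventually allI) (auto simp: U2_def)
      next
        case True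
        have "isCont (\<lambda>s. Zc s ?\<omega>) ?s"
          using Zc_cont[OF \<omega>] by (simp add: continuous_on_eq_continuous_at)
        then have "\<forall>\<^sub>F s in at ?s. Zc s ?\<omega> < - x"
          using True unfolding isCont_def by (intro order_tendstoD(2)) auto
        then obtain \<delta> where \<delta>: "0 < \<delta>" "\<And>s. s \<noteq> ?s \<Longrightarrow> \<bar>s - ?s\<bar> < \<delta> \<Longrightarrow> Zc s ?\<omega> < - x"
          unfolding eventually_at by (auto simp: dist_real_def)
        have "(\<lambda>n. \<epsilon> * (1 / real (Suc n))) \<longlonglongrightarrow> \<epsilon> * 0"
          using LIMSEQ_Suc[OF lim_1_over_n] by (intro tendsto_intros) simp
        then have "\<forall>\<^sub>F n in sequentially. \<epsilon> * (1 / real (Suc n)) < \<delta>"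
          using \<delta>(1) by (intro order_tendstoD(2)) auto
        then show ?thesis
        proof eventually_elim
          fix n assume n: "\<epsilon> * (1 / real (Suc n)) < \<delta>"
          \<comment> \<open>The last grid index whose time is strictly before \<open>?s\<close>,
            hence the ceiling minus 1.\<close>
          define k where "k = nat (\<lceil>?s * real (Suc n) / \<epsilon>\<rceil> - 1)"
          have pos: "0 < ?s * real (Suc n) / \<epsilon>" using True \<epsilon> by simp
          then have k: "real k = real_of_int \<lceil>?s * real (Suc n) / \<epsilon>\<rceil> - 1" by (simp add: k_def)
          have k1: "real k < ?s * real (Suc n) / \<epsilon>" and k2: "?s * real (Suc n) / \<epsilon> \<le> real k + 1"
            unfolding k by linarith+
          let ?q = "real k * \<epsilon> / real (Suc n)"
          have q1: "?q < ?s" using k1 \<epsilon> by (simp add: field_simps)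
          have "?s \<le> (real k + 1) * \<epsilon> / real (Suc n)" using k2 \<epsilon> by (simp add: field_simps)
          also have "\<dots> = ?q + \<epsilon> * (1 / real (Suc n))" by (simp add: add_divide_distrib distrib_right)
          finally have "\<bar>?q - ?s\<bar> < \<delta>" using q1 n by simp
          then have "Zc ?q ?\<omega> < - x" using q1 by (intro \<delta>(2)) auto
          moreover have "0 \<le> ?q" "?q \<le> T" using q1 True \<epsilon> by auto
          ultimately have "Z ?q ?\<omega> < - x" by (simp add: Zc_eq)
          moreover have "k \<le> Suc n"
          proof -
            have "?s * real (Suc n) / \<epsilon> \<le> real (Suc n)"
              using True \<epsilon> by (simp add: divide_le_eq mult.commute mult_left_mono del: of_nat_Suc)
            then have "real k < real (Suc n)" using k1 by linarith
            then show ?thesis by simp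
          qed
          ultimately have "\<not> ?s \<le> \<sigma> n ?\<omega>" unfolding before using q1 by (auto simp del: of_nat_Suc)
          then show "U2 n p = 0" by (simp add: U2_def)
        qed
      qed
      then show "(\<lambda>n. U2 n p) \<longlonglongrightarrow> 0" by (rule tendsto_eventually)
    qed
    show "AE p in LP. norm (U2 n p) \<le> \<bar>indicator {0..\<epsilon>} (fst p) * g (Zc (fst p) (snd p))\<bar>" for n
      using U2_bound by (intro AE_I2)
  qed (use int' in auto)
  moreover have "0 < x * (D - g (- x) * K)" using x by simp
  ultimately have "\<forall>\<^sub>F n in sequentially. (\<integral>p. U2 n p \<partial>LP) < x * (D - g (- x) * K)"
    by (intro order_tendstoD(2)) auto
  then obtain n where n: "(\<integral>p. U2 n p \<partial>LP) < x * (D - g (- x) * K)"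
    by (auto simp: eventually_sequentially)
  have "g (- x) * (x / \<kappa> * (2 * sqrt \<epsilon>)) - \<gamma> * (c * x * (\<epsilon> / 2)) = - (x * (D - g (- x) * K))"
    by (simp add: D_def K_def algebra_simps)
  then have "(\<integral>p. ?J n p \<partial>LP) < 0" using upper[of n] n by linarith
  then have "(\<integral>\<omega>. (LINT s:{0..\<sigma> n \<omega>}|lborel. exp (- r * s) * g (Zc s \<omega>)) \<partial>P) < 0"
    using J(3)[of n] by (simp add: \<phi>_def)
  then show ?thesis using st[of n] range[of n] by (intro that[of "\<sigma> n"]) auto
qed

end

section \<open>Integrals along a single path\<close>

lemma set_integrable_path:
  fixes w :: "real \<Rightarrow> real"
  assumes "continuous_on UNIV w"
  shows "set_integrable lborel {a..b} w"
  using assms by (intro borel_integrable_atLeastAtMost' continuous_on_subset[OF assms]) auto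

lemma path_integral_split:
  fixes w :: "real \<Rightarrow> real"
  assumes w: "continuous_on UNIV w" and c: "0 \<le> c" "c \<le> d"
  shows "(LINT s:{0..d}|lborel. w s) = (LINT s:{0..c}|lborel. w s) + (LINT s:{c..d}|lborel. w s)"
  using Henstock_Kurzweil_Integration.integral_combine[OF c, of w]
    set_borel_integral_eq_integral[OF set_integrable_path[OF w]] by simp

lemma path_integral_mono:
  fixes w w' :: "real \<Rightarrow> real"
  assumes "continuous_on UNIV w" "continuous_on UNIV w'" "\<And>s. c \<le> s \<Longrightarrow> s \<le> d \<Longrightarrow> w s \<le> w' s"
  shows "(LINT s:{c..d}|lborel. w s) \<le> (LINT s:{c..d}|lborel. w' s)"
  using assms by (intro set_integral_mono set_integrable_path) auto

lemma path_integral_const: "c \<le> d \<Longrightarrow> (LINT s:{c..d}|lborel. (k::real)) = k * (d - c)"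
  by (simp add: set_lebesgue_integral_def)

lemma discount_integral:
  fixes r c :: real
  assumes "0 < r" "0 \<le> c"
  shows "(LINT s:{0..c}|lborel. r * exp (- r * s)) = 1 - exp (- r * c)"
proof -
  have cont: "continuous_on UNIV (\<lambda>s. r * exp (- r * s))" by (intro continuous_intros)
  have "((\<lambda>s. r * exp (- r * s)) has_integral (- exp (- r * c) - - exp (- r * 0))) {0..c}"
    using assms by (intro fundamental_theorem_of_calculus)
      (auto intro!: derivative_eq_intros simp flip: has_real_derivative_iff_has_vector_derivative)
  then have "((\<lambda>s. r * exp (- r * s)) has_integral (1 - exp (- r * c))) {0..c}" by simp
  then show ?thesis
    unfolding set_borel_integral_eq_integral(2)[OF set_integrable_path[OF cont], of 0 c]
    by (rule integral_unique)
qed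

context drifted_brownian_motion
begin

text \<open>The Bochner form of \<open>occupation_square_exp_bound\<close>. The constant time
  \<open>T\<close> gives integrability on the whole strip, and every smaller stopping time inherits
  it.\<close>

lemma occupation_square_exp:
  "\<exists>C\<ge>0. \<forall>\<sigma> h. stopping_time F \<sigma> \<longrightarrow> (\<forall>\<omega>\<in>space P. 0 \<le> \<sigma> \<omega> \<and> \<sigma> \<omega> \<le> h) \<longrightarrow> h \<le> T \<longrightarrow>
    integrable P (\<lambda>\<omega>. LINT s:{0..\<sigma> \<omega>}|lborel. (exp (k * Zc s \<omega>) - 1)\<^sup>2) \<and>
    (\<integral>\<omega>. (LINT s:{0..\<sigma> \<omega>}|lborel. (exp (k * Zc s \<omega>) - 1)\<^sup>2) \<partial>P) \<le> C * h * (\<integral>\<omega>. \<sigma> \<omega> \<partial>P)"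
proof -
  interpret PS: pair_sigma_finite lborel P by (rule pair_sigma_finite)
  obtain C where C: "C \<ge> 0" and bound: "\<And>\<sigma> h. stopping_time F \<sigma> \<Longrightarrow> (\<forall>\<omega>\<in>space P. 0 \<le> \<sigma> \<omega> \<and> \<sigma> \<omega> \<le> h) \<Longrightarrow> h \<le> T \<Longrightarrow>
    (\<integral>\<^sup>+\<omega>. (\<integral>\<^sup>+s. ennreal ((exp (k * Zc s \<omega>) - 1)\<^sup>2) * indicator {0..\<sigma> \<omega>} s \<partial>lborel) \<partial>P) \<le>
      ennreal (C * h) * (\<integral>\<^sup>+\<omega>. ennreal (\<sigma> \<omega>) \<partial>P)"
    using occupation_square_exp_bound[of k] by (elim exE conjE) (rule that, assumption, simp only:)
  let ?\<phi> = "\<lambda>s \<omega>. (exp (k * Zc s \<omega>) - 1)\<^sup>2"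
  have m[measurable]: "(\<lambda>p. ?\<phi> (fst p) (snd p)) \<in> borel_measurable (borel \<Otimes>\<^sub>M P)" by measurable
  have Zm[measurable]: "(\<lambda>p. Zc (fst p) (snd p)) \<in> borel_measurable LP"
    using Zc_joint_measurable by (simp cong: measurable_cong_sets)
  have nn: "(\<integral>\<^sup>+p. ennreal (indicator {0..\<sigma> (snd p)} (fst p) * ?\<phi> (fst p) (snd p)) \<partial>LP) \<le>
      ennreal (C * h * (\<integral>\<omega>. \<sigma> \<omega> \<partial>P))"
    if \<sigma>: "stopping_time F \<sigma>" "\<forall>\<omega>\<in>space P. 0 \<le> \<sigma> \<omega> \<and> \<sigma> \<omega> \<le> h" and h: "h \<le> T" for \<sigma> :: "'a \<Rightarrow> real" and h
  proof -
    have [measurable]: "\<sigma> \<in> borel_measurable P" using \<sigma>(1) by (rule stopping_time_measurable)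
    have [measurable]: "(\<lambda>p. indicator {0..\<sigma> (snd p)} (fst p) :: real) \<in> borel_measurable LP"
      unfolding indicator_def atLeastAtMost_iff by measurable
    obtain \<omega>0 where "\<omega>0 \<in> space P" using not_empty by auto
    then have h0: "0 \<le> h" using \<sigma>(2) by force
    have "(\<integral>\<^sup>+p. ennreal (indicator {0..\<sigma> (snd p)} (fst p) * ?\<phi> (fst p) (snd p)) \<partial>LP) =
        (\<integral>\<^sup>+\<omega>. (\<integral>\<^sup>+s. ennreal (?\<phi> s \<omega>) * indicator {0..\<sigma> \<omega>} s \<partial>lborel) \<partial>P)"
      by (subst PS.nn_integral_snd[symmetric])
        (auto intro!: nn_integral_cong simp: ennreal_mult' ennreal_indicator mult.commute indicator_def)
    also have "\<dots> \<le> ennreal (C * h) * (\<integral>\<^sup>+\<omega>. ennreal (\<sigma> \<omega>) \<partial>P)" using \<sigma> h by (rule bound)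
    also have "(\<integral>\<^sup>+\<omega>. ennreal (\<sigma> \<omega>) \<partial>P) = ennreal (\<integral>\<omega>. \<sigma> \<omega> \<partial>P)"
      using \<sigma>(2) by (intro nn_integral_eq_integral integrable_const_bound[where B=h]) auto
    finally show ?thesis using C h0 \<sigma>(2) by (simp add: ennreal_mult integral_nonneg_AE)
  qed
  have "integrable LP (\<lambda>p. indicator {0..T} (fst p) * ?\<phi> (fst p) (snd p))"
  proof (rule integrableI_bounded)
    have "(\<integral>\<^sup>+p. ennreal (norm (indicator {0..T} (fst p) * ?\<phi> (fst p) (snd p))) \<partial>LP) \<le>
       ennreal (C * T * (\<integral>\<omega>. T \<partial>P))"
      using nn[of "\<lambda>_. T" T] T_pos by (simp add: stopping_time_const abs_mult)
    then show "(\<integral>\<^sup>+p. ennreal (norm (indicator {0..T} (fst p) * ?\<phi> (fst p) (snd p))) \<partial>LP) < \<infinity>"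
      by (rule order_le_less_trans) simp
  qed measurable
  note SI = stopped_integral[where \<phi>="?\<phi>", OF m this stopping_time_measurable]
  have "integrable P (\<lambda>\<omega>. LINT s:{0..\<sigma> \<omega>}|lborel. ?\<phi> s \<omega>) \<and>
    (\<integral>\<omega>. (LINT s:{0..\<sigma> \<omega>}|lborel. ?\<phi> s \<omega>) \<partial>P) \<le> C * h * (\<integral>\<omega>. \<sigma> \<omega> \<partial>P)"
    if \<sigma>: "stopping_time F \<sigma>" "\<forall>\<omega>\<in>space P. 0 \<le> \<sigma> \<omega> \<and> \<sigma> \<omega> \<le> h" and h: "h \<le> T" for \<sigma> :: "'a \<Rightarrow> real" and h
  proof
    have le: "\<sigma> \<omega> \<le> T" if "\<omega> \<in> space P" for \<omega> using \<sigma>(2) h that by force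
    show "integrable P (\<lambda>\<omega>. LINT s:{0..\<sigma> \<omega>}|lborel. ?\<phi> s \<omega>)" by (rule SI(2)[OF \<sigma>(1) le])
    obtain \<omega>0 where "\<omega>0 \<in> space P" using not_empty by auto
    then have h0: "0 \<le> h" using \<sigma>(2) by force
    have "ennreal (\<integral>p. indicator {0..\<sigma> (snd p)} (fst p) * ?\<phi> (fst p) (snd p) \<partial>LP) \<le>
      ennreal (C * h * (\<integral>\<omega>. \<sigma> \<omega> \<partial>P))"
      using nn[OF \<sigma> h] nn_integral_eq_integral[OF SI(1)[OF \<sigma>(1) le]] by simp
    then have "(\<integral>p. indicator {0..\<sigma> (snd p)} (fst p) * ?\<phi> (fst p) (snd p) \<partial>LP) \<le> C * h * (\<integral>\<omega>. \<sigma> \<omega> \<partial>P)"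
      using C h0 \<sigma>(2) by (subst (asm) ennreal_le_iff) (auto intro!: mult_nonneg_nonneg integral_nonneg_AE)
    then show "(\<integral>\<omega>. (LINT s:{0..\<sigma> \<omega>}|lborel. ?\<phi> s \<omega>) \<partial>P) \<le> C * h * (\<integral>\<omega>. \<sigma> \<omega> \<partial>P)"
      by (rule ord_eq_le_trans[OF SI(3)[OF \<sigma>(1) le], rotated]) assumption
  qed
  then show ?thesis using C by (intro exI[of _ C] conjI allI impI) blast+
qed

end

section \<open>The stopping game\<close>

text \<open>\<open>f\<close> is the marginal revenue at state \<open>y * exp Z\<close>. The bound
  \<open>K * (1 + 1 / x)\<close> controls \<open>f\<close> near 0 by a negative exponential of
  \<open>Z\<close>, which has finite moments.\<close>

locale stopping_game_setup = drifted_brownian_motion P F Z m \<kappa> T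
  for P :: "'a measure" and F Z m \<kappa> T +
  fixes f :: "real \<Rightarrow> real" and r a b K :: real
  assumes r_pos: "0 < r" and a_pos: "0 < a" and a_less_b: "a < b" and K_nonneg: "0 \<le> K"
    and f_anti: "\<And>x y. 0 < x \<Longrightarrow> x < y \<Longrightarrow> f y < f x"
    and f_pos: "\<And>x. 0 < x \<Longrightarrow> 0 < f x"
    and f_cont: "continuous_on {0<..} f"
    and f_le: "\<And>x. 0 < x \<Longrightarrow> f x \<le> K * (1 + 1 / x)"
    and f_at_top: "(f \<longlongrightarrow> 0) at_top"
    and f_at_0: "filterlim f at_top (at_right 0)"
begin

definition ST :: "real \<Rightarrow> ('a \<Rightarrow> real) set" where
  "ST h = {\<tau>. stopping_time F \<tau> \<and> (\<forall>\<omega>\<in>space P. 0 \<le> \<tau> \<omega> \<and> \<tau> \<omega> \<le> h)}"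

definition rate :: "real \<Rightarrow> real \<Rightarrow> 'a \<Rightarrow> real" where
  "rate y s \<omega> = exp (- r * s) * f (y * exp (Zc s \<omega>))"

text \<open>Condenses the three stopping terms of \<open>game_payoff\<close>: if the minimizer does
  not stop first before \<open>h\<close>, either \<tau> comes first or both equal \<open>h\<close>.
  In the latter case the terminal payment, \<open>G'\<close> being the constant \<open>a\<close>, is
  again \<open>a * exp (- r * \<tau> \<omega>)\<close>.\<close>

definition pay :: "real \<Rightarrow> real \<Rightarrow> ('a \<Rightarrow> real) \<Rightarrow> ('a \<Rightarrow> real) \<Rightarrow> 'a \<Rightarrow> real" where
  "pay h y \<sigma> \<tau> \<omega> =
    (if \<sigma> \<omega> \<le> \<tau> \<omega> \<and> \<sigma> \<omega> < h then b * exp (- r * \<sigma> \<omega>) else a * exp (- r * \<tau> \<omega>)) +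
    (LINT s:{0..min (\<tau> \<omega>) (\<sigma> \<omega>)}|lborel. rate y s \<omega>)"

definition \<Psi> :: "real \<Rightarrow> real \<Rightarrow> ('a \<Rightarrow> real) \<Rightarrow> ('a \<Rightarrow> real) \<Rightarrow> real" where
  "\<Psi> h y \<sigma> \<tau> = (\<integral>\<omega>. pay h y \<sigma> \<tau> \<omega> \<partial>P)"

lemma ST_D: "\<sigma> \<in> ST h \<Longrightarrow> stopping_time F \<sigma>" "\<sigma> \<in> ST h \<Longrightarrow> \<omega> \<in> space P \<Longrightarrow> 0 \<le> \<sigma> \<omega>"
  "\<sigma> \<in> ST h \<Longrightarrow> \<omega> \<in> space P \<Longrightarrow> \<sigma> \<omega> \<le> h"
  by (auto simp: ST_def)

lemma ST_measurable: "\<sigma> \<in> ST h \<Longrightarrow> \<sigma> \<in> borel_measurable P"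
  by (auto dest: ST_D stopping_time_measurable)

lemma ST_const: "0 \<le> c \<Longrightarrow> c \<le> h \<Longrightarrow> (\<lambda>_. c) \<in> ST h"
  by (auto simp: ST_def stopping_time_const)

lemma f_mono: "0 < x \<Longrightarrow> x \<le> y \<Longrightarrow> f y \<le> f x"
  using f_anti[of x y] by (cases "x = y") auto

lemma f_exp_cont: "0 < y \<Longrightarrow> continuous_on UNIV (\<lambda>z. f (y * exp z))"
  by (intro continuous_on_compose2[OF f_cont] continuous_intros) auto

lemma f_exp_measurable [measurable]: "0 < y \<Longrightarrow> (\<lambda>z. f (y * exp z)) \<in> borel_measurable borel"
  by (intro borel_measurable_continuous_onI f_exp_cont)

lemma rate_measurable [measurable]:
  "0 < y \<Longrightarrow> (\<lambda>p. rate y (fst p) (snd p)) \<in> borel_measurable (borel \<Otimes>\<^sub>M P)"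
  unfolding rate_def
  using measurable_compose[OF Zc_joint_measurable f_exp_measurable, of y] by measurable

lemma rate_nonneg: "0 < y \<Longrightarrow> 0 \<le> rate y s \<omega>"
  using f_pos[of "y * exp (Zc s \<omega>)"] by (simp add: rate_def)

lemma path_cont: "0 < y \<Longrightarrow> \<omega> \<in> space P \<Longrightarrow> continuous_on UNIV (\<lambda>s. f (y * exp (Zc s \<omega>)))"
  using continuous_on_compose2[OF f_exp_cont Zc_cont] by auto

lemma rate_cont: "0 < y \<Longrightarrow> \<omega> \<in> space P \<Longrightarrow> continuous_on UNIV (\<lambda>s. rate y s \<omega>)"
  unfolding rate_def by (intro continuous_intros path_cont)

text \<open>The growth bound on \<open>f\<close> leaves the moment of \<open>exp (- Z s)\<close>,
  which is bounded over \<open>s \<le> T\<close>.\<close>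

lemma expected_rate:
  assumes y: "0 < y"
  obtains C where "0 \<le> C" "\<And>s. 0 \<le> s \<Longrightarrow> s \<le> T \<Longrightarrow> (\<integral>\<^sup>+\<omega>. ennreal (rate y s \<omega>) \<partial>P) \<le> ennreal C"
proof
  let ?C = "K * (1 + exp (\<bar>- m + \<kappa>\<^sup>2 / 2\<bar> * T) / y)"
  show C: "0 \<le> ?C" using K_nonneg y by (intro mult_nonneg_nonneg) (auto intro: add_nonneg_nonneg)
  fix s assume s: "0 \<le> s" "s \<le> T"
  have Zs[measurable]: "Z s \<in> borel_measurable P" using s by (intro Z_measurable)
  have moment: "(\<integral>\<^sup>+\<omega>. ennreal (exp (- Z s \<omega>)) \<partial>P) \<le> ennreal (exp (\<bar>- m + \<kappa>\<^sup>2 / 2\<bar> * T))"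
  proof (cases "s = 0")
    case True
    then have "(\<integral>\<^sup>+\<omega>. ennreal (exp (- Z s \<omega>)) \<partial>P) = (\<integral>\<^sup>+\<omega>. 1 \<partial>P)"
      by (intro nn_integral_cong) (simp add: Z_0)
    also have "\<dots> \<le> ennreal (exp (\<bar>- m + \<kappa>\<^sup>2 / 2\<bar> * T))"
      using T_pos by (simp add: emeasure_space_1)
    finally show ?thesis .
  next
    case False
    then have s0: "0 < s" using s by simp
    have pos: "0 < \<kappa> * sqrt s" using s0 vol_pos by simp
    have "(\<integral>\<^sup>+\<omega>. ennreal (exp (- Z s \<omega>)) \<partial>P) = (\<integral>\<^sup>+z. ennreal (exp (- 1 * z)) \<partial>distr P borel (Z s))"
      by (subst nn_integral_distr) auto
    also have "\<dots> = (\<integral>\<^sup>+z. ennreal (exp (- 1 * z)) \<partial>law s)" using s0 s by (simp add: distr_Z)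
    also have "\<dots> = ennreal (exp (- 1 * (m * s) + (- 1)\<^sup>2 * (\<kappa> * sqrt s)\<^sup>2 / 2))"
      using gauss_exp_moment[OF pos, of "m * s" "- 1"] by (subst nn_integral_eq_integral) (auto simp: has_bochner_integral_iff)
    also have "- 1 * (m * s) + (- 1)\<^sup>2 * (\<kappa> * sqrt s)\<^sup>2 / 2 = (- m + \<kappa>\<^sup>2 / 2) * s"
      using s by (simp add: power_mult_distrib algebra_simps)
    also have "ennreal (exp ((- m + \<kappa>\<^sup>2 / 2) * s)) \<le> ennreal (exp (\<bar>- m + \<kappa>\<^sup>2 / 2\<bar> * T))"
    proof (intro ennreal_leI, unfold exp_le_cancel_iff)
      show "(- m + \<kappa>\<^sup>2 / 2) * s \<le> \<bar>- m + \<kappa>\<^sup>2 / 2\<bar> * T" using s by (intro mult_mono) auto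
    qed
    finally show ?thesis .
  qed
  have "(\<integral>\<^sup>+\<omega>. ennreal (rate y s \<omega>) \<partial>P) \<le> (\<integral>\<^sup>+\<omega>. ennreal K + ennreal (K / y) * ennreal (exp (- Z s \<omega>)) \<partial>P)"
  proof (intro nn_integral_mono)
    fix \<omega>
    have "rate y s \<omega> \<le> 1 * (K * (1 + 1 / (y * exp (Z s \<omega>))))"
      unfolding rate_def using s y r_pos f_pos[of "y * exp (Zc s \<omega>)"] f_le[of "y * exp (Zc s \<omega>)"]
      by (intro mult_mono) (auto simp: Zc_eq)
    also have "\<dots> = K + K / y * exp (- Z s \<omega>)" using y by (simp add: field_simps exp_minus)
    finally have "ennreal (rate y s \<omega>) \<le> ennreal (K + K / y * exp (- Z s \<omega>))" by (rule ennreal_leI)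
    then show "ennreal (rate y s \<omega>) \<le> ennreal K + ennreal (K / y) * ennreal (exp (- Z s \<omega>))"
      using K_nonneg y by (simp add: ennreal_plus[symmetric] ennreal_mult[symmetric] del: ennreal_plus)
  qed
  also have "\<dots> = ennreal K + ennreal (K / y) * (\<integral>\<^sup>+\<omega>. ennreal (exp (- Z s \<omega>)) \<partial>P)"
    by (subst nn_integral_add) (auto simp: nn_integral_cmult emeasure_space_1)
  also have "\<dots> \<le> ennreal K + ennreal (K / y) * ennreal (exp (\<bar>- m + \<kappa>\<^sup>2 / 2\<bar> * T))"
    by (intro add_left_mono mult_left_mono moment) simp
  also have "\<dots> = ennreal ?C"
    using K_nonneg y by (simp add: ennreal_plus[symmetric] ennreal_mult[symmetric] distrib_left del: ennreal_plus)
  finally show "(\<integral>\<^sup>+\<omega>. ennreal (rate y s \<omega>) \<partial>P) \<le> ennreal ?C" .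
qed

lemma rate_integrable:
  assumes y: "0 < y"
  shows "integrable LP (\<lambda>p. indicator {0..T} (fst p) * rate y (fst p) (snd p))"
proof (rule integrableI_bounded)
  have rm[measurable]: "(\<lambda>p. rate y (fst p) (snd p)) \<in> borel_measurable LP"
    using rate_measurable[OF y] by (simp cong: measurable_cong_sets)
  show "(\<lambda>p. indicator {0..T} (fst p) * rate y (fst p) (snd p)) \<in> borel_measurable LP" by measurable
  obtain C where C: "0 \<le> C" "\<And>s. 0 \<le> s \<Longrightarrow> s \<le> T \<Longrightarrow> (\<integral>\<^sup>+\<omega>. ennreal (rate y s \<omega>) \<partial>P) \<le> ennreal C"
    using expected_rate[OF y] by blast
  have "(\<integral>\<^sup>+p. ennreal (norm (indicator {0..T} (fst p) * rate y (fst p) (snd p))) \<partial>LP) =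
     (\<integral>\<^sup>+s. (\<integral>\<^sup>+\<omega>. ennreal (norm (indicator {0..T} s * rate y s \<omega>)) \<partial>P) \<partial>lborel)"
    by (subst nn_integral_fst[symmetric]) auto
  also have "\<dots> \<le> (\<integral>\<^sup>+s. ennreal C * indicator {0..T} s \<partial>lborel)"
    using C(2) rate_nonneg[OF y] by (intro nn_integral_mono) (auto simp: indicator_def)
  also have "\<dots> < \<infinity>" using T_pos by (subst nn_integral_cmult_indicator) (auto simp: ennreal_mult_less_top)
  finally show "(\<integral>\<^sup>+p. ennreal (norm (indicator {0..T} (fst p) * rate y (fst p) (snd p))) \<partial>LP) < \<infinity>" .
qed

lemma expected_rate_interval:
  assumes y: "0 < y"
  obtains C where "0 < C" "\<And>h1 h2. 0 \<le> h1 \<Longrightarrow> h1 \<le> h2 \<Longrightarrow> h2 \<le> T \<Longrightarrow>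
    (\<integral>\<omega>. (LINT s:{0..h2}|lborel. rate y s \<omega>) \<partial>P) \<le> (\<integral>\<omega>. (LINT s:{0..h1}|lborel. rate y s \<omega>) \<partial>P) + C * (h2 - h1)"
proof -
  interpret PS: pair_sigma_finite lborel P by (rule pair_sigma_finite)
  obtain C where C: "0 \<le> C" "\<And>s. 0 \<le> s \<Longrightarrow> s \<le> T \<Longrightarrow> (\<integral>\<^sup>+\<omega>. ennreal (rate y s \<omega>) \<partial>P) \<le> ennreal C"
    using expected_rate[OF y] by blast
  have Cs: "(\<integral>\<omega>. rate y s \<omega> \<partial>P) \<le> C" if s: "0 \<le> s" "s \<le> T" for s
  proof -
    have "ennreal (\<integral>\<omega>. rate y s \<omega> \<partial>P) \<le> (\<integral>\<^sup>+\<omega>. ennreal (rate y s \<omega>) \<partial>P)"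
    proof (cases "integrable P (rate y s)")
      case True
      then show ?thesis using rate_nonneg[OF y] by (simp add: nn_integral_eq_integral)
    next
      case False
      then show ?thesis by (simp add: not_integrable_integral_eq)
    qed
    also have "\<dots> \<le> ennreal C" using C(2) s by simp
    finally show ?thesis using C(1) by (simp add: ennreal_le_iff)
  qed
  \<comment> \<open>Passing to \<open>C + 1\<close> makes the constant positive, because later it
    serves as a divisor.\<close>
  have "(\<integral>\<omega>. (LINT s:{0..h2}|lborel. rate y s \<omega>) \<partial>P) \<le> (\<integral>\<omega>. (LINT s:{0..h1}|lborel. rate y s \<omega>) \<partial>P) + (C + 1) * (h2 - h1)"
    if h: "0 \<le> h1" "h1 \<le> h2" "h2 \<le> T" for h1 h2
  proof -
    note SI = stopped_integral[OF rate_measurable[OF y] rate_integrable[OF y], of "\<lambda>_. _", simplified]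
    let ?R = "\<lambda>h p. indicator {0..h} (fst p) * rate y (fst p) (snd p)"
    have i: "integrable LP (?R h1)" "integrable LP (?R h2)" using h by (auto intro!: SI(1))
    have "(\<integral>p. ?R h2 p \<partial>LP) - (\<integral>p. ?R h1 p \<partial>LP) = (\<integral>p. ?R h2 p - ?R h1 p \<partial>LP)"
      using i by (intro Bochner_Integration.integral_diff[symmetric])
    also have "\<dots> = (\<integral>s. (\<integral>\<omega>. ?R h2 (s, \<omega>) - ?R h1 (s, \<omega>) \<partial>P) \<partial>lborel)"
      using PS.integral_fst'[OF Bochner_Integration.integrable_diff[OF i(2,1)]] by simp
    also have "\<dots> \<le> (\<integral>s. C * indicator {h1..h2} s \<partial>lborel)"
    proof (rule integral_mono)
      show "integrable lborel (\<lambda>s. \<integral>\<omega>. ?R h2 (s, \<omega>) - ?R h1 (s, \<omega>) \<partial>P)"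
        using PS.integrable_fst'[OF Bochner_Integration.integrable_diff[OF i(2,1)]] by simp
      show "integrable lborel (\<lambda>s. C * indicator {h1..h2} s)"
        by (intro integrable_mult_right integrable_real_indicator) (auto simp: emeasure_lborel_Icc_eq)
      fix s
      have "s \<in> {h1..h2} \<or> s < 0 \<or> (0 \<le> s \<and> s < h1) \<or> h2 < s" by auto
      then show "(\<integral>\<omega>. ?R h2 (s, \<omega>) - ?R h1 (s, \<omega>) \<partial>P) \<le> C * indicator {h1..h2} s"
        using h C(1) Cs[of s] by (cases "s = h1") auto
    qed
    also have "\<dots> = C * (h2 - h1)" using h by simp
    also have "\<dots> \<le> (C + 1) * (h2 - h1)" using h by (intro mult_right_mono) auto
    finally show ?thesis using SI(3)[of h1] SI(3)[of h2] h by simp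
  qed
  then show ?thesis using C(1) by (intro that[of "C + 1"]) auto
qed

end

section \<open>Payoffs relative to a constant level\<close>

lemma path_integral_singleton: "(LINT s:{c}|lborel. (w s :: real)) = 0"
  using AE_lborel_singleton[of c] unfolding set_lebesgue_integral_def
  by (intro integral_eq_zero_AE) (auto elim!: eventually_mono)

context stopping_game_setup
begin

definition gain :: "real \<Rightarrow> real \<Rightarrow> real \<Rightarrow> 'a \<Rightarrow> real" where
  "gain \<beta> y c \<omega> = (LINT s:{0..c}|lborel. exp (- r * s) * (f (y * exp (Zc s \<omega>)) - r * \<beta>))"

lemma gain_cont: "0 < y \<Longrightarrow> \<omega> \<in> space P \<Longrightarrow>
    continuous_on UNIV (\<lambda>s. exp (- r * s) * (f (y * exp (Zc s \<omega>)) - r * \<beta>))"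
  by (intro continuous_intros path_cont)

lemma gain_split:
  assumes "0 < y" "\<omega> \<in> space P" "0 \<le> c" "c \<le> d"
  shows "gain \<beta> y d \<omega> = gain \<beta> y c \<omega> + (LINT s:{c..d}|lborel. exp (- r * s) * (f (y * exp (Zc s \<omega>)) - r * \<beta>))"
  unfolding gain_def by (rule path_integral_split[OF gain_cont[OF assms(1,2)] assms(3,4)])

text \<open>An income stream \<open>r * \<beta>\<close> up to time \<open>c\<close> is worth
  \<open>\<beta> * (1 - exp (- r * c))\<close>. Together with a discounted payment \<beta> at
  \<open>c\<close> it amounts to the constant \<beta>, so only the \<open>gain\<close> still depends
  on the stopping time.\<close>

lemma accrued_eq_gain:
  assumes "0 < y" "\<omega> \<in> space P" "0 \<le> c"
  shows "(LINT s:{0..c}|lborel. rate y s \<omega>) = gain \<beta> y c \<omega> + \<beta> * (1 - exp (- r * c))"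
proof -
  have cont: "continuous_on UNIV (\<lambda>s. r * exp (- r * s))" by (intro continuous_intros)
  have "(LINT s:{0..c}|lborel. rate y s \<omega>) =
      (LINT s:{0..c}|lborel. exp (- r * s) * (f (y * exp (Zc s \<omega>)) - r * \<beta>) + \<beta> * (r * exp (- r * s)))"
    by (intro set_lebesgue_integral_cong) (auto simp: rate_def algebra_simps)
  also have "\<dots> = gain \<beta> y c \<omega> + (LINT s:{0..c}|lborel. \<beta> * (r * exp (- r * s)))"
    unfolding gain_def
    by (intro set_integral_add set_integrable_mult_right set_integrable_path gain_cont assms cont)
  also have "(LINT s:{0..c}|lborel. \<beta> * (r * exp (- r * s))) = \<beta> * (1 - exp (- r * c))"
    unfolding discount_integral[OF r_pos assms(3), symmetric] by (rule set_integral_mult_right)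
  finally show ?thesis .
qed

lemma pay_lower_form:
  assumes "0 < y" "\<sigma> \<in> ST h" "\<tau> \<in> ST h" "\<omega> \<in> space P"
  shows "pay h y \<sigma> \<tau> \<omega> = a + gain a y (min (\<tau> \<omega>) (\<sigma> \<omega>)) \<omega> +
    (if \<sigma> \<omega> \<le> \<tau> \<omega> \<and> \<sigma> \<omega> < h then (b - a) * exp (- r * \<sigma> \<omega>) else 0)"
proof -
  have st: "0 \<le> \<sigma> \<omega>" "\<sigma> \<omega> \<le> h" "0 \<le> \<tau> \<omega>" "\<tau> \<omega> \<le> h" using assms ST_D by auto
  \<comment> \<open>This covers the tie at maturity, where both times equal \<open>h\<close> and the
    minimizer owes nothing extra.\<close>
  have "\<tau> \<omega> \<le> \<sigma> \<omega>" if "\<not> (\<sigma> \<omega> \<le> \<tau> \<omega> \<and> \<sigma> \<omega> < h)" using that st by auto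
  then show ?thesis
    using accrued_eq_gain[OF assms(1,4), of "min (\<tau> \<omega>) (\<sigma> \<omega>)" a] st
    by (auto simp: pay_def min_def algebra_simps)
qed

lemma pay_upper_form:
  assumes "0 < y" "\<sigma> \<in> ST h" "\<tau> \<in> ST h" "\<omega> \<in> space P"
  shows "pay h y \<sigma> \<tau> \<omega> = b + gain b y (min (\<tau> \<omega>) (\<sigma> \<omega>)) \<omega> -
    (if \<sigma> \<omega> \<le> \<tau> \<omega> \<and> \<sigma> \<omega> < h then 0 else (b - a) * exp (- r * \<tau> \<omega>))"
proof -
  have st: "0 \<le> \<sigma> \<omega>" "\<sigma> \<omega> \<le> h" "0 \<le> \<tau> \<omega>" "\<tau> \<omega> \<le> h" using assms ST_D by auto
  have "\<tau> \<omega> \<le> \<sigma> \<omega>" if "\<not> (\<sigma> \<omega> \<le> \<tau> \<omega> \<and> \<sigma> \<omega> < h)" using that st by auto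
  then show ?thesis
    using accrued_eq_gain[OF assms(1,4), of "min (\<tau> \<omega>) (\<sigma> \<omega>)" b] st
    by (auto simp: pay_def min_def algebra_simps)
qed

lemma ST_min: "\<sigma> \<in> ST h \<Longrightarrow> \<tau> \<in> ST k \<Longrightarrow> (\<lambda>\<omega>. min (\<sigma> \<omega>) (\<tau> \<omega>)) \<in> ST (min h k)"
  by (auto simp: ST_def stopping_time_min min_le_iff_disj)

lemma ST_mono: "\<sigma> \<in> ST h \<Longrightarrow> h \<le> k \<Longrightarrow> \<sigma> \<in> ST k"
  by (force simp: ST_def)

lemma accrued_integrable:
  assumes "0 < y" "\<sigma> \<in> ST h" "h \<le> T"
  shows "integrable P (\<lambda>\<omega>. LINT s:{0..\<sigma> \<omega>}|lborel. rate y s \<omega>)"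
  using ST_D(3)[OF assms(2)] assms(3)
  by (intro stopped_integral(2)[OF rate_measurable[OF assms(1)] rate_integrable[OF assms(1)] ST_measurable[OF assms(2)]])
    force

lemma gain_integrable:
  assumes "0 < y" "\<sigma> \<in> ST h" "h \<le> T"
  shows "integrable P (\<lambda>\<omega>. gain \<beta> y (\<sigma> \<omega>) \<omega>)"
proof -
  have [measurable]: "\<sigma> \<in> borel_measurable P" using assms by (intro ST_measurable)
  have "integrable P (\<lambda>\<omega>. exp (- r * \<sigma> \<omega>))"
    using r_pos ST_D(2)[OF assms(2)] by (intro integrable_const_bound[where B=1]) auto
  then have "integrable P (\<lambda>\<omega>. (LINT s:{0..\<sigma> \<omega>}|lborel. rate y s \<omega>) - \<beta> * (1 - exp (- r * \<sigma> \<omega>)))"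
    using accrued_integrable[OF assms] by simp
  then show ?thesis
    using accrued_eq_gain[OF assms(1) _ ST_D(2)[OF assms(2)], where \<beta>=\<beta>]
    by (subst Bochner_Integration.integrable_cong[OF refl]) auto
qed

lemma accrued_mono:
  assumes "0 < y" "\<omega> \<in> space P" "0 \<le> c" "c \<le> d"
  shows "(LINT s:{0..c}|lborel. rate y s \<omega>) \<le> (LINT s:{0..d}|lborel. rate y s \<omega>)"
proof -
  have "0 \<le> (LINT s:{c..d}|lborel. rate y s \<omega>)"
    using rate_nonneg[OF assms(1)] by (simp add: set_lebesgue_integral_def integral_nonneg_AE)
  then show ?thesis using path_integral_split[OF rate_cont[OF assms(1,2)] assms(3,4)] by simp
qed

lemma accrued_nonneg: "0 < y \<Longrightarrow> 0 \<le> (LINT s:{c..d}|lborel. rate y s \<omega>)"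
  using rate_nonneg by (simp add: set_lebesgue_integral_def integral_nonneg_AE)

lemma pay_integrable:
  assumes "0 < y" "\<sigma> \<in> ST h" "\<tau> \<in> ST h" "h \<le> T"
  shows "integrable P (pay h y \<sigma> \<tau>)"
proof -
  have [measurable]: "\<sigma> \<in> borel_measurable P" "\<tau> \<in> borel_measurable P" using assms by (auto intro: ST_measurable)
  have "(\<lambda>\<omega>. min (\<tau> \<omega>) (\<sigma> \<omega>)) \<in> ST h" using ST_min[OF assms(3,2)] by simp
  then have i: "integrable P (\<lambda>\<omega>. LINT s:{0..min (\<tau> \<omega>) (\<sigma> \<omega>)}|lborel. rate y s \<omega>)"
    using assms by (intro accrued_integrable)
  have le: "x * exp (- r * c) \<le> b" if "0 \<le> c" "x \<le> b" "0 \<le> x" for x c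
    using mult_mono[of x b "exp (- r * c)" 1] that r_pos a_pos a_less_b by simp
  have "integrable P (\<lambda>\<omega>. if \<sigma> \<omega> \<le> \<tau> \<omega> \<and> \<sigma> \<omega> < h then b * exp (- r * \<sigma> \<omega>) else a * exp (- r * \<tau> \<omega>))"
  proof (rule integrable_const_bound[where B=b])
    show "AE \<omega> in P. norm (if \<sigma> \<omega> \<le> \<tau> \<omega> \<and> \<sigma> \<omega> < h then b * exp (- r * \<sigma> \<omega>) else a * exp (- r * \<tau> \<omega>)) \<le> b"
      using le[of _ b] le[of _ a] ST_D(2)[OF assms(2)] ST_D(2)[OF assms(3)] a_pos a_less_b
      by (intro AE_I2) (auto simp: abs_mult)
  qed measurable
  then show ?thesis unfolding pay_def[abs_def] using i by (rule Bochner_Integration.integrable_add)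
qed

lemma payoff_nonneg:
  assumes "0 < y" "\<sigma> \<in> ST h" "\<tau> \<in> ST h"
  shows "0 \<le> \<Psi> h y \<sigma> \<tau>"
  unfolding \<Psi>_def pay_def using accrued_nonneg[OF assms(1)] a_pos a_less_b
  by (intro integral_nonneg_AE AE_I2) (auto intro!: add_nonneg_nonneg)

text \<open>Real-valued suprema behave as intended only on bounded sets; this bound and
  \<open>payoff_nonneg\<close> justify their use in the value.\<close>

lemma payoff_bounded:
  assumes "0 < y" "h \<le> T"
  shows "\<exists>B. \<forall>\<sigma>\<in>ST h. \<forall>\<tau>\<in>ST h. \<Psi> h y \<sigma> \<tau> \<le> B"
proof (intro exI ballI)
  fix \<sigma> \<tau> assume s: "\<sigma> \<in> ST h" and t: "\<tau> \<in> ST h"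
  have "\<Psi> h y \<sigma> \<tau> \<le> (\<integral>\<omega>. b + (LINT s:{0..T}|lborel. rate y s \<omega>) \<partial>P)"
    unfolding \<Psi>_def
  proof (rule integral_mono)
    show "integrable P (pay h y \<sigma> \<tau>)" using assms s t by (intro pay_integrable)
    show "integrable P (\<lambda>\<omega>. b + (LINT s:{0..T}|lborel. rate y s \<omega>))"
      using accrued_integrable[OF assms(1) ST_const[of T T]] T_pos by simp
    fix \<omega> assume \<omega>: "\<omega> \<in> space P"
    have b: "0 \<le> \<sigma> \<omega>" "\<sigma> \<omega> \<le> h" "0 \<le> \<tau> \<omega>" using ST_D s t \<omega> by auto
    have "b * exp (- r * \<sigma> \<omega>) \<le> b * 1"
      by (rule mult_mono) (use b r_pos a_pos a_less_b in auto)
    moreover have "a * exp (- r * \<tau> \<omega>) \<le> b * 1"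
      by (rule mult_mono) (use b r_pos a_pos a_less_b in auto)
    moreover have "(LINT s:{0..min (\<tau> \<omega>) (\<sigma> \<omega>)}|lborel. rate y s \<omega>) \<le> (LINT s:{0..T}|lborel. rate y s \<omega>)"
      using b assms by (intro accrued_mono \<omega>) auto
    ultimately show "pay h y \<sigma> \<tau> \<omega> \<le> b + (LINT s:{0..T}|lborel. rate y s \<omega>)"
      by (auto simp: pay_def)
  qed
  then show "\<Psi> h y \<sigma> \<tau> \<le> (\<integral>\<omega>. b + (LINT s:{0..T}|lborel. rate y s \<omega>) \<partial>P)" .
qed

end

section \<open>Bounds on the value by comparison of strategies\<close>

locale stopping_game = stopping_game_setup P F Z m \<kappa> T f r a b K
  for P :: "'a measure" and F Z m \<kappa> T f r a b K +
  fixes v :: "real \<Rightarrow> real \<Rightarrow> real"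
  assumes game_value: "\<And>h y. 0 \<le> h \<Longrightarrow> h \<le> T \<Longrightarrow> 0 < y \<Longrightarrow>
      v h y = (INF \<sigma>\<in>ST h. SUP \<tau>\<in>ST h. \<Psi> h y \<sigma> \<tau>) \<and>
      v h y = (SUP \<tau>\<in>ST h. INF \<sigma>\<in>ST h. \<Psi> h y \<sigma> \<tau>)"
begin

lemmas value_inf_sup = game_value[THEN conjunct1] and value_sup_inf = game_value[THEN conjunct2]

context
  fixes h y :: real assumes h: "0 \<le> h" "h \<le> T" and y: "0 < y"
begin

lemma ST_nonempty: "ST h \<noteq> {}"
  using ST_const[of 0 h] h by auto

lemma payoff_bdd_above: "\<sigma> \<in> ST h \<Longrightarrow> bdd_above ((\<lambda>\<tau>. \<Psi> h y \<sigma> \<tau>) ` ST h)"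
  using payoff_bounded[OF y h(2)] by (force simp: bdd_above_def)

lemma payoff_bdd_below: "\<tau> \<in> ST h \<Longrightarrow> bdd_below ((\<lambda>\<sigma>. \<Psi> h y \<sigma> \<tau>) ` ST h)"
  using payoff_nonneg[OF y] by (intro bdd_belowI[of _ 0]) auto

text \<open>By the inf-sup form, one minimizing strategy that holds every reply below
  \<open>c\<close> suffices; \<open>value_ge\<close> is the dual statement and uses the sup-inf
  form.\<close>

lemma value_le:
  assumes "\<sigma> \<in> ST h" "\<And>\<tau>. \<tau> \<in> ST h \<Longrightarrow> \<Psi> h y \<sigma> \<tau> \<le> c"
  shows "v h y \<le> c"
proof -
  have "bdd_below ((\<lambda>\<sigma>. SUP \<tau>\<in>ST h. \<Psi> h y \<sigma> \<tau>) ` ST h)"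
  proof (intro bdd_belowI[of _ 0], safe)
    fix \<sigma> assume s: "\<sigma> \<in> ST h"
    obtain \<tau> where t: "\<tau> \<in> ST h" using ST_nonempty by blast
    show "0 \<le> (SUP \<tau>\<in>ST h. \<Psi> h y \<sigma> \<tau>)"
      using payoff_nonneg[OF y s t] cSUP_upper[OF t payoff_bdd_above[OF s]] by simp
  qed
  then have "v h y \<le> (SUP \<tau>\<in>ST h. \<Psi> h y \<sigma> \<tau>)"
    unfolding value_inf_sup[OF h y] by (rule cINF_lower[OF _ assms(1)])
  also have "\<dots> \<le> c" using assms ST_nonempty by (intro cSUP_least)
  finally show ?thesis .
qed

lemma value_ge:
  assumes "\<tau> \<in> ST h" "\<And>\<sigma>. \<sigma> \<in> ST h \<Longrightarrow> c \<le> \<Psi> h y \<sigma> \<tau>"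
  shows "c \<le> v h y"
proof -
  obtain B where B: "\<forall>\<sigma>\<in>ST h. \<forall>\<tau>\<in>ST h. \<Psi> h y \<sigma> \<tau> \<le> B" using payoff_bounded[OF y h(2)] by blast
  have "bdd_above ((\<lambda>\<tau>. INF \<sigma>\<in>ST h. \<Psi> h y \<sigma> \<tau>) ` ST h)"
  proof (intro bdd_aboveI[of _ B], safe)
    fix \<tau> assume t: "\<tau> \<in> ST h"
    obtain \<sigma> where s: "\<sigma> \<in> ST h" using ST_nonempty by blast
    have "(INF \<sigma>\<in>ST h. \<Psi> h y \<sigma> \<tau>) \<le> \<Psi> h y \<sigma> \<tau>" by (rule cINF_lower[OF payoff_bdd_below[OF t] s])
    then show "(INF \<sigma>\<in>ST h. \<Psi> h y \<sigma> \<tau>) \<le> B" using B s t by force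
  qed
  then have "(INF \<sigma>\<in>ST h. \<Psi> h y \<sigma> \<tau>) \<le> v h y"
    unfolding value_sup_inf[OF h y] by (rule cSUP_upper[OF assms(1)])
  moreover have "c \<le> (INF \<sigma>\<in>ST h. \<Psi> h y \<sigma> \<tau>)" using assms ST_nonempty by (intro cINF_greatest)
  ultimately show ?thesis by simp
qed

end

text \<open>Transfer between horizons: the minimizer translates a strategy for \<open>h\<close> to
  one for \<open>h'\<close>, and each reply in the game for \<open>h'\<close> is translated back.
  The loss of the round trip is \<open>e\<close>.\<close>

lemma value_le_shift:
  assumes h: "0 \<le> h" "h \<le> T" "0 \<le> h'" "h' \<le> T" and y: "0 < y"
    and *: "\<And>\<sigma>. \<sigma> \<in> ST h \<Longrightarrow> \<exists>\<sigma>'\<in>ST h'. \<forall>\<tau>'\<in>ST h'. \<exists>\<tau>\<in>ST h. \<Psi> h' y \<sigma>' \<tau>' \<le> \<Psi> h y \<sigma> \<tau> + e"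
  shows "v h' y \<le> v h y + e"
proof -
  have "v h' y - e \<le> (INF \<sigma>\<in>ST h. SUP \<tau>\<in>ST h. \<Psi> h y \<sigma> \<tau>)"
  proof (rule cINF_greatest)
    show "ST h \<noteq> {}" using h y by (intro ST_nonempty)
    fix \<sigma> assume s: "\<sigma> \<in> ST h"
    obtain \<sigma>' where s': "\<sigma>' \<in> ST h'" and **: "\<And>\<tau>'. \<tau>' \<in> ST h' \<Longrightarrow> \<exists>\<tau>\<in>ST h. \<Psi> h' y \<sigma>' \<tau>' \<le> \<Psi> h y \<sigma> \<tau> + e"
      using *[OF s] by blast
    have "v h' y \<le> (SUP \<tau>\<in>ST h. \<Psi> h y \<sigma> \<tau>) + e"
    proof (rule value_le[OF h(3,4) y s'])
      fix \<tau>' assume "\<tau>' \<in> ST h'"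
      then obtain \<tau> where t: "\<tau> \<in> ST h" "\<Psi> h' y \<sigma>' \<tau>' \<le> \<Psi> h y \<sigma> \<tau> + e" using ** by blast
      then show "\<Psi> h' y \<sigma>' \<tau>' \<le> (SUP \<tau>\<in>ST h. \<Psi> h y \<sigma> \<tau>) + e"
        using cSUP_upper[OF t(1) payoff_bdd_above[OF h(1,2) y s]] by simp
    qed
    then show "v h' y - e \<le> (SUP \<tau>\<in>ST h. \<Psi> h y \<sigma> \<tau>)" by simp
  qed
  then show ?thesis unfolding value_inf_sup[OF h(1,2) y, symmetric] by simp
qed

lemma value_ge_shift:
  assumes h: "0 \<le> h" "h \<le> T" "0 \<le> h'" "h' \<le> T" and y: "0 < y"
    and *: "\<And>\<tau>. \<tau> \<in> ST h \<Longrightarrow> \<exists>\<tau>'\<in>ST h'. \<forall>\<sigma>'\<in>ST h'. \<exists>\<sigma>\<in>ST h. \<Psi> h y \<sigma> \<tau> \<le> \<Psi> h' y \<sigma>' \<tau>'"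
  shows "v h y \<le> v h' y"
proof -
  have "(SUP \<tau>\<in>ST h. INF \<sigma>\<in>ST h. \<Psi> h y \<sigma> \<tau>) \<le> v h' y"
  proof (rule cSUP_least)
    show "ST h \<noteq> {}" using h y by (intro ST_nonempty)
    fix \<tau> assume t: "\<tau> \<in> ST h"
    obtain \<tau>' where t': "\<tau>' \<in> ST h'" and **: "\<And>\<sigma>'. \<sigma>' \<in> ST h' \<Longrightarrow> \<exists>\<sigma>\<in>ST h. \<Psi> h y \<sigma> \<tau> \<le> \<Psi> h' y \<sigma>' \<tau>'"
      using *[OF t] by blast
    show "(INF \<sigma>\<in>ST h. \<Psi> h y \<sigma> \<tau>) \<le> v h' y"
    proof (rule value_ge[OF h(3,4) y t'])
      fix \<sigma>' assume "\<sigma>' \<in> ST h'"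
      then obtain \<sigma> where s: "\<sigma> \<in> ST h" "\<Psi> h y \<sigma> \<tau> \<le> \<Psi> h' y \<sigma>' \<tau>'" using ** by blast
      then show "(INF \<sigma>\<in>ST h. \<Psi> h y \<sigma> \<tau>) \<le> \<Psi> h' y \<sigma>' \<tau>'"
        using cINF_lower[OF payoff_bdd_below[OF h(1,2) y t] s(1)] by simp
    qed
  qed
  then show ?thesis unfolding value_sup_inf[OF h(1,2) y, symmetric] .
qed

text \<open>The minimizer stops at once. This costs exactly \<open>b\<close> because
  \<open>0 < h\<close>: at horizon 0 the minimizer's payment is excluded.\<close>

lemma value_le_upper:
  assumes "0 < h" "h \<le> T" "0 < y"
  shows "v h y \<le> b"
proof (rule value_le[OF _ assms(2,3)])
  show "(\<lambda>_. 0) \<in> ST h" using assms by (intro ST_const) auto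
  fix \<tau> assume t: "\<tau> \<in> ST h"
  have "\<Psi> h y (\<lambda>_. 0) \<tau> = (\<integral>\<omega>. b \<partial>P)"
    unfolding \<Psi>_def pay_def using ST_D(2)[OF t] assms
    by (intro Bochner_Integration.integral_cong refl) (simp add: min_absorb2 path_integral_singleton)
  then show "\<Psi> h y (\<lambda>_. 0) \<tau> \<le> b" by (simp add: prob_space)
qed (use assms in simp)

lemma value_ge_lower:
  assumes "0 < h" "h \<le> T" "0 < y"
  shows "a \<le> v h y"
proof (rule value_ge[OF _ assms(2,3)])
  show "(\<lambda>_. 0) \<in> ST h" using assms by (intro ST_const) auto
  fix \<sigma> assume s: "\<sigma> \<in> ST h"
  have "(\<integral>\<omega>. a \<partial>P) \<le> \<Psi> h y \<sigma> (\<lambda>_. 0)"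
    unfolding \<Psi>_def
  proof (rule integral_mono)
    show "integrable P (pay h y \<sigma> (\<lambda>_. 0))" using s assms by (intro pay_integrable ST_const) auto
    fix \<omega> assume \<omega>: "\<omega> \<in> space P"
    show "a \<le> pay h y \<sigma> (\<lambda>_. 0) \<omega>"
      unfolding pay_def using ST_D(2)[OF s \<omega>] a_less_b
      by (auto simp: min_absorb1 path_integral_singleton)
  qed simp
  then show "a \<le> \<Psi> h y \<sigma> (\<lambda>_. 0)" by (simp add: prob_space)
qed (use assms in simp)

text \<open>The maximizer keeps the strategy for the short game and the minimizer's reply is
  truncated at \<open>h\<close>. The accrued parts agree; a reply stopping exactly at
  \<open>h\<close> owes the premium only in the longer game.\<close>

lemma value_mono_horizon:
  assumes "0 \<le> h" "h \<le> h'" "h' \<le> T" "0 < y"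
  shows "v h y \<le> v h' y"
proof (rule value_ge_shift)
  fix \<tau> assume t: "\<tau> \<in> ST h"
  have t': "\<tau> \<in> ST h'" using t assms(2) by (rule ST_mono)
  show "\<exists>\<tau>'\<in>ST h'. \<forall>\<sigma>'\<in>ST h'. \<exists>\<sigma>\<in>ST h. \<Psi> h y \<sigma> \<tau> \<le> \<Psi> h' y \<sigma>' \<tau>'"
  proof (intro bexI[OF _ t'] ballI)
    fix \<sigma>' assume s': "\<sigma>' \<in> ST h'"
    let ?\<sigma> = "\<lambda>\<omega>. min (\<sigma>' \<omega>) h"
    have s: "?\<sigma> \<in> ST h" using ST_min[OF s' ST_const[of h h]] assms by (simp add: min_absorb2)
    have "\<Psi> h y ?\<sigma> \<tau> \<le> \<Psi> h' y \<sigma>' \<tau>"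
      unfolding \<Psi>_def
    proof (rule integral_mono)
      show "integrable P (pay h y ?\<sigma> \<tau>)" "integrable P (pay h' y \<sigma>' \<tau>)"
        using s s' t t' assms by (auto intro!: pay_integrable)
      fix \<omega> assume \<omega>: "\<omega> \<in> space P"
      have "\<tau> \<omega> \<le> h" using ST_D(3)[OF t \<omega>] .
      then have "min (\<tau> \<omega>) (min (\<sigma>' \<omega>) h) = min (\<tau> \<omega>) (\<sigma>' \<omega>)" by simp
      then show "pay h y ?\<sigma> \<tau> \<omega> \<le> pay h' y \<sigma>' \<tau> \<omega>"
        using a_less_b assms \<open>\<tau> \<omega> \<le> h\<close>
        unfolding pay_lower_form[OF assms(4) s t \<omega>] pay_lower_form[OF assms(4) s' t' \<omega>] by (auto simp: min_def)
    qed
    then show "\<exists>\<sigma>\<in>ST h. \<Psi> h y \<sigma> \<tau> \<le> \<Psi> h' y \<sigma>' \<tau>" using s by blast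
  qed
qed (use assms in auto)

text \<open>
  A minimizer who does not stop before the short horizon \<open>h\<close> waits until \<open>h'\<close>; the maximizer can
  then gain at most the profit accrued between \<open>h\<close> and \<open>h'\<close>.
\<close>

lemma value_horizon_lipschitz:
  assumes y: "0 < y"
  obtains C where "0 < C" "\<And>h h'. 0 \<le> h \<Longrightarrow> h \<le> h' \<Longrightarrow> h' \<le> T \<Longrightarrow> v h' y \<le> v h y + C * (h' - h)"
proof -
  obtain C where C: "0 < C" "\<And>h1 h2. 0 \<le> h1 \<Longrightarrow> h1 \<le> h2 \<Longrightarrow> h2 \<le> T \<Longrightarrow>
    (\<integral>\<omega>. (LINT s:{0..h2}|lborel. rate y s \<omega>) \<partial>P) \<le> (\<integral>\<omega>. (LINT s:{0..h1}|lborel. rate y s \<omega>) \<partial>P) + C * (h2 - h1)"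
    using expected_rate_interval[OF y] by blast
  have "v h' y \<le> v h y + C * (h' - h)" if h: "0 \<le> h" "h \<le> h'" "h' \<le> T" for h h'
  proof (cases "h = h'")
    case True
    then show ?thesis by simp
  next
    case False
    then have hh: "h < h'" using h by simp
    show ?thesis
    proof (rule value_le_shift)
      fix \<sigma> assume s: "\<sigma> \<in> ST h"
      \<comment> \<open>Whether \<sigma> stops before \<open>h\<close> is known at time
        \<open>h\<close>, so postponing the remaining paths to \<open>h'\<close> gives a stopping
        time.\<close>
      define \<sigma>' where "\<sigma>' \<omega> = (if \<sigma> \<omega> < h then \<sigma> \<omega> else h')" for \<omega>
      have "stopping_time F \<sigma>'"
      proof
        fix t
        note st = ST_D(1)[OF s]
        show "Measurable.pred (F t) (\<lambda>\<omega>. \<sigma>' \<omega> \<le> t)"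
        proof (cases "h \<le> t")
          case True
          have "Measurable.pred (F t) (\<lambda>\<omega>. \<sigma> \<omega> < h)"
            by (rule measurable_F_mono[OF stopping_time_less_const[OF st] True])
          then have [measurable]: "Measurable.pred (F t) (\<lambda>\<omega>. \<sigma> \<omega> < h)" .
          have "(\<lambda>\<omega>. \<sigma>' \<omega> \<le> t) = (\<lambda>\<omega>. \<sigma> \<omega> < h \<or> h' \<le> t)"
            using True by (auto simp: \<sigma>'_def fun_eq_iff)
          then show ?thesis by simp
        next
          case False
          then have "(\<lambda>\<omega>. \<sigma>' \<omega> \<le> t) = (\<lambda>\<omega>. \<sigma> \<omega> \<le> t)"
            using hh by (auto simp: \<sigma>'_def fun_eq_iff)
          then show ?thesis using stopping_timeD[OF st] by simp
        qed
      qed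
      then have s': "\<sigma>' \<in> ST h'" using ST_D[OF s] h by (force simp: ST_def \<sigma>'_def)
      show "\<exists>\<sigma>'\<in>ST h'. \<forall>\<tau>'\<in>ST h'. \<exists>\<tau>\<in>ST h. \<Psi> h' y \<sigma>' \<tau>' \<le> \<Psi> h y \<sigma> \<tau> + C * (h' - h)"
      proof (intro bexI[OF _ s'] ballI)
        fix \<tau>' assume t': "\<tau>' \<in> ST h'"
        let ?\<tau> = "\<lambda>\<omega>. min (\<tau>' \<omega>) h"
        have t: "?\<tau> \<in> ST h" using ST_min[OF t' ST_const[of h h]] h by (simp add: min_absorb2)
        let ?I = "\<lambda>h \<omega>. LINT s:{0..h}|lborel. rate y s \<omega>"
        have int: "integrable P (?I h)" "integrable P (?I h')" "integrable P (pay h' y \<sigma>' \<tau>')" "integrable P (pay h y \<sigma> ?\<tau>)"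
          using h y s s' t t' accrued_integrable[OF y ST_const[of h h]] accrued_integrable[OF y ST_const[of h' h']]
          by (auto intro!: pay_integrable)
        have "\<Psi> h' y \<sigma>' \<tau>' \<le> (\<integral>\<omega>. pay h y \<sigma> ?\<tau> \<omega> + (?I h' \<omega> - ?I h \<omega>) \<partial>P)"
          unfolding \<Psi>_def
        proof (rule integral_mono)
          show "integrable P (\<lambda>\<omega>. pay h y \<sigma> ?\<tau> \<omega> + (?I h' \<omega> - ?I h \<omega>))" using int by simp
          fix \<omega> assume \<omega>: "\<omega> \<in> space P"
          have b: "0 \<le> \<sigma> \<omega>" "\<sigma> \<omega> \<le> h" "0 \<le> \<tau>' \<omega>" "\<tau>' \<omega> \<le> h'" using ST_D s t' \<omega> by auto
          have I: "?I h \<omega> \<le> ?I h' \<omega>" using h by (intro accrued_mono y \<omega>) auto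
          note forms = pay_lower_form[OF y s' t' \<omega>] pay_lower_form[OF y s t \<omega>]
          show "pay h' y \<sigma>' \<tau>' \<omega> \<le> pay h y \<sigma> ?\<tau> \<omega> + (?I h' \<omega> - ?I h \<omega>)"
          proof (cases "\<sigma> \<omega> < h")
            case True
            then have "min (\<tau>' \<omega>) (\<sigma>' \<omega>) = min (min (\<tau>' \<omega>) h) (\<sigma> \<omega>)" "\<sigma>' \<omega> = \<sigma> \<omega>"
              by (auto simp: \<sigma>'_def)
            then show ?thesis unfolding forms using True I hh by auto
          next
            case False
            then have e: "\<sigma> \<omega> = h" "\<sigma>' \<omega> = h'" using b by (auto simp: \<sigma>'_def)
            have m: "min (\<tau>' \<omega>) (\<sigma>' \<omega>) = \<tau>' \<omega>" "min (min (\<tau>' \<omega>) h) (\<sigma> \<omega>) = min (\<tau>' \<omega>) h" using e b by auto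
            \<comment> \<open>Neither version pays a premium here. Past \<open>h\<close> the gain
              grows by the profit accrued minus a nonnegative multiple of \<open>a\<close>.\<close>
            have g: "gain a y (\<tau>' \<omega>) \<omega> \<le> gain a y (min (\<tau>' \<omega>) h) \<omega> + (?I h' \<omega> - ?I h \<omega>)"
            proof (cases "\<tau>' \<omega> \<le> h")
              case True
              then show ?thesis using I by simp
            next
              case False
              then have "gain a y (\<tau>' \<omega>) \<omega> = ?I (\<tau>' \<omega>) \<omega> - a * (1 - exp (- r * \<tau>' \<omega>))"
                "gain a y h \<omega> = ?I h \<omega> - a * (1 - exp (- r * h))"
                using accrued_eq_gain[OF y \<omega>, of _ a] h b by auto
              moreover have "?I (\<tau>' \<omega>) \<omega> \<le> ?I h' \<omega>" using b by (intro accrued_mono y \<omega>) auto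
              moreover have "a * (1 - exp (- r * h)) \<le> a * (1 - exp (- r * \<tau>' \<omega>))"
                using False a_pos r_pos by (intro mult_left_mono) auto
              ultimately show ?thesis using False by simp
            qed
            show ?thesis unfolding forms m using e g by simp
          qed
        qed (rule int(3))
        also have "\<dots> = \<Psi> h y \<sigma> ?\<tau> + ((\<integral>\<omega>. ?I h' \<omega> \<partial>P) - (\<integral>\<omega>. ?I h \<omega> \<partial>P))"
          unfolding \<Psi>_def using int by simp
        also have "\<dots> \<le> \<Psi> h y \<sigma> ?\<tau> + C * (h' - h)" using C(2)[OF h] by simp
        finally show "\<exists>\<tau>\<in>ST h. \<Psi> h' y \<sigma>' \<tau>' \<le> \<Psi> h y \<sigma> \<tau> + C * (h' - h)" using t by blast
      qed
    qed (use h y in auto)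
  qed
  then show ?thesis using C(1) that by blast
qed

text \<open>The minimizer waits until \<open>h\<close> and never pays the premium, so the payoff is
  at most \<open>a\<close> plus the accrued profit, whose expectation is of order
  \<open>h\<close>.\<close>

lemma value_near_maturity:
  assumes y: "0 < y"
  obtains C where "0 < C" "\<And>h. 0 < h \<Longrightarrow> h \<le> T \<Longrightarrow> v h y \<le> a + C * h"
proof -
  obtain C where C: "0 < C" "\<And>h1 h2. 0 \<le> h1 \<Longrightarrow> h1 \<le> h2 \<Longrightarrow> h2 \<le> T \<Longrightarrow>
    (\<integral>\<omega>. (LINT s:{0..h2}|lborel. rate y s \<omega>) \<partial>P) \<le> (\<integral>\<omega>. (LINT s:{0..h1}|lborel. rate y s \<omega>) \<partial>P) + C * (h2 - h1)"
    using expected_rate_interval[OF y] by blast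
  have "v h y \<le> a + C * h" if h: "0 < h" "h \<le> T" for h
  proof (rule value_le)
    show s: "(\<lambda>_. h) \<in> ST h" using h by (intro ST_const) auto
    fix \<tau> assume t: "\<tau> \<in> ST h"
    let ?I = "\<lambda>h \<omega>. LINT s:{0..h}|lborel. rate y s \<omega>"
    have int: "integrable P (?I h)" using accrued_integrable[OF y s] h by simp
    have "\<Psi> h y (\<lambda>_. h) \<tau> \<le> (\<integral>\<omega>. a + ?I h \<omega> \<partial>P)"
      unfolding \<Psi>_def
    proof (rule integral_mono)
      show "integrable P (pay h y (\<lambda>_. h) \<tau>)" using h y s t by (intro pay_integrable)
      show "integrable P (\<lambda>\<omega>. a + ?I h \<omega>)" using int by simp
      fix \<omega> assume \<omega>: "\<omega> \<in> space P"
      have b: "0 \<le> \<tau> \<omega>" "\<tau> \<omega> \<le> h" using ST_D t \<omega> by auto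
      have "a * exp (- r * \<tau> \<omega>) \<le> a * 1" using a_pos r_pos b by (intro mult_left_mono) auto
      moreover have "?I (\<tau> \<omega>) \<omega> \<le> ?I h \<omega>" using b by (intro accrued_mono y \<omega>)
      ultimately show "pay h y (\<lambda>_. h) \<tau> \<omega> \<le> a + ?I h \<omega>" using b by (simp add: pay_def min_absorb1)
    qed
    also have "\<dots> = a + (\<integral>\<omega>. ?I h \<omega> \<partial>P)" using int by (simp add: prob_space)
    also have "(\<integral>\<omega>. ?I h \<omega> \<partial>P) \<le> (\<integral>\<omega>. ?I 0 \<omega> \<partial>P) + C * (h - 0)" using h by (intro C) auto
    also have "(\<integral>\<omega>. ?I 0 \<omega> \<partial>P) \<le> 0"
      by (simp add: path_integral_singleton)
    finally show "\<Psi> h y (\<lambda>_. h) \<tau> \<le> a + C * h" by simp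
  qed (use h y in auto)
  then show ?thesis using C(1) that by blast
qed

section \<open>Levels at which the value equals a stopping payment\<close>

lemma exp_path_cont: "\<omega> \<in> space P \<Longrightarrow> continuous_on UNIV (\<lambda>s. (exp (k * Zc s \<omega>) - 1)\<^sup>2)"
  by (intro continuous_intros Zc_cont)

lemma affine_path_integral:
  assumes "\<omega> \<in> space P" "0 \<le> c"
  shows "(LINT s:{0..c}|lborel. \<alpha> + \<beta> * (exp (k * Zc s \<omega>) - 1)\<^sup>2) =
    \<alpha> * c + \<beta> * (LINT s:{0..c}|lborel. (exp (k * Zc s \<omega>) - 1)\<^sup>2)"
proof -
  have "(LINT s:{0..c}|lborel. \<alpha> + \<beta> * (exp (k * Zc s \<omega>) - 1)\<^sup>2) =
    (LINT s:{0..c}|lborel. \<alpha>) + (LINT s:{0..c}|lborel. \<beta> * (exp (k * Zc s \<omega>) - 1)\<^sup>2)"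
    by (intro set_integral_add set_integrable_mult_right set_integrable_path exp_path_cont assms) auto
  then show ?thesis using path_integral_const[OF assms(2), of \<alpha>] by simp
qed

text \<open>The maximizer waits until \<open>h\<close>. Against any \<sigma> the gain is at least
  linear in \<sigma> up to a quadratic error; the linear part must cover both that error and the
  amount \<open>b - a\<close> lost when the minimizer waits as well.\<close>

lemma exists_value_eq_upper:
  assumes h: "0 < h" "h \<le> T"
  shows "\<exists>y>0. v h y = b"
proof -
  obtain C where C: "C \<ge> 0" and occ: "\<And>\<sigma> h. stopping_time F \<sigma> \<Longrightarrow> (\<forall>\<omega>\<in>space P. 0 \<le> \<sigma> \<omega> \<and> \<sigma> \<omega> \<le> h) \<Longrightarrow> h \<le> T \<Longrightarrow>
    integrable P (\<lambda>\<omega>. LINT s:{0..\<sigma> \<omega>}|lborel. (exp (1 * Zc s \<omega>) - 1)\<^sup>2) \<and>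
    (\<integral>\<omega>. (LINT s:{0..\<sigma> \<omega>}|lborel. (exp (1 * Zc s \<omega>) - 1)\<^sup>2) \<partial>P) \<le> C * h * (\<integral>\<omega>. \<sigma> \<omega> \<partial>P)"
    using occupation_square_exp[of 1] by (elim exE conjE) (rule that, assumption, simp only:)
  \<comment> \<open>After discounting, the slope is \<open>(b - a) / h + 1\<close>: the first term
    accumulates \<open>b - a\<close> by time \<open>h\<close>, the 1 is reserved for the quadratic
    error.\<close>
  define A where "A = exp (r * h) * ((b - a) / h + 1)"
  have A: "0 < A" using h a_less_b by (auto simp: A_def intro!: mult_pos_pos add_nonneg_pos)
  have eA: "exp (- r * h) * A = (b - a) / h + 1"
    by (simp add: A_def mult.assoc[symmetric] exp_add[symmetric])
  have B0: "0 < A + r * b" using A r_pos a_pos a_less_b by (simp add: add_pos_pos)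
  \<comment> \<open>Large enough that \<open>(A + r * b) / N * (C * h) \<le> 1\<close>, so that the
    expected error is at most the expectation of \<sigma>.\<close>
  define N where "N = (A + r * b) * C * h + 1"
  have N: "0 < N" using B0 C h by (simp add: N_def add_nonneg_pos)
  have "\<forall>\<^sub>F x in at_right 0. A + r * b \<le> f x" using f_at_0 by (simp add: filterlim_at_top)
  then obtain d where d: "0 < d" "\<And>x. 0 < x \<Longrightarrow> x < d \<Longrightarrow> A + r * b \<le> f x"
    unfolding eventually_at_right_field by auto
  define z0 where "z0 = d / 2"
  have z0: "0 < z0" "A + r * b \<le> f z0" using d by (auto simp: z0_def)
  \<comment> \<open>Leaving the region where \<open>f\<close> is at least \<open>A + r * b\<close>
    now requires \<open>exp z - 1 > sqrt N\<close>; there the quadratic term outweighs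
    \<open>A + r * b\<close>, and positivity of \<open>f\<close> is enough.\<close>
  define y where "y = z0 / (1 + sqrt N)"
  have y: "0 < y" using z0 N by (simp add: y_def add_pos_pos)
  have point: "A + - ((A + r * b) / N) * (exp (1 * z) - 1)\<^sup>2 \<le> f (y * exp z) - r * b" for z
  proof (cases "y * exp z \<le> z0")
    case True
    then have "A + r * b \<le> f (y * exp z)" using f_mono[of "y * exp z" z0] y z0 by simp
    moreover have "0 \<le> ((A + r * b) / N) * (exp (1 * z) - 1)\<^sup>2" using B0 N by simp
    ultimately show ?thesis by linarith
  next
    case False
    have "z0 = y * (1 + sqrt N)" using N by (simp add: y_def add_pos_pos less_imp_neq[symmetric])
    then have "1 + sqrt N < exp z" using False y by simp
    then have "(sqrt N)\<^sup>2 \<le> (exp (1 * z) - 1)\<^sup>2" using N by (intro power_mono) auto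
    then have "((A + r * b) / N) * N \<le> ((A + r * b) / N) * (exp (1 * z) - 1)\<^sup>2"
      using B0 N by (intro mult_left_mono) auto
    moreover have "0 < f (y * exp z)" using y by (intro f_pos) simp
    ultimately show ?thesis using N by simp
  qed
  have "b \<le> v h y"
  proof (rule value_ge)
    show t: "(\<lambda>_. h) \<in> ST h" using h by (intro ST_const) auto
    fix \<sigma> assume s: "\<sigma> \<in> ST h"
    let ?Q = "\<lambda>\<omega>. LINT s:{0..\<sigma> \<omega>}|lborel. (exp (1 * Zc s \<omega>) - 1)\<^sup>2"
    have s': "stopping_time F \<sigma>" "\<forall>\<omega>\<in>space P. 0 \<le> \<sigma> \<omega> \<and> \<sigma> \<omega> \<le> h" using s by (auto simp: ST_def)
    have [measurable]: "\<sigma> \<in> borel_measurable P" using s by (rule ST_measurable)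
    have Q: "integrable P ?Q" "(\<integral>\<omega>. ?Q \<omega> \<partial>P) \<le> C * h * (\<integral>\<omega>. \<sigma> \<omega> \<partial>P)" using occ[OF s' h(2)] by auto
    have \<sigma>int: "integrable P \<sigma>" using s'(2) by (intro integrable_const_bound[where B=h]) auto
    have E0: "0 \<le> (\<integral>\<omega>. \<sigma> \<omega> \<partial>P)" using s'(2) by (intro integral_nonneg_AE) auto
    have "b \<le> b + (\<integral>\<omega>. \<sigma> \<omega> \<partial>P) - (A + r * b) / N * (C * h * (\<integral>\<omega>. \<sigma> \<omega> \<partial>P))"
    proof -
      have "(A + r * b) * C * h \<le> N" by (simp add: N_def)
      then have "(A + r * b) / N * (C * h) \<le> 1" using N by (simp add: field_simps)
      then have "(A + r * b) / N * (C * h) * (\<integral>\<omega>. \<sigma> \<omega> \<partial>P) \<le> 1 * (\<integral>\<omega>. \<sigma> \<omega> \<partial>P)"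
        using E0 by (rule mult_right_mono)
      then show ?thesis by (simp add: mult.assoc)
    qed
    also have "\<dots> \<le> b + (\<integral>\<omega>. \<sigma> \<omega> \<partial>P) - (A + r * b) / N * (\<integral>\<omega>. ?Q \<omega> \<partial>P)"
      using Q(2) B0 N by (intro diff_left_mono mult_left_mono) auto
    also have "\<dots> = (\<integral>\<omega>. b + \<sigma> \<omega> - (A + r * b) / N * ?Q \<omega> \<partial>P)"
      using Q(1) \<sigma>int by (simp add: prob_space)
    also have "\<dots> \<le> \<Psi> h y \<sigma> (\<lambda>_. h)"
      unfolding \<Psi>_def
    proof (rule integral_mono)
      show "integrable P (\<lambda>\<omega>. b + \<sigma> \<omega> - (A + r * b) / N * ?Q \<omega>)" using Q(1) \<sigma>int by simp
      show "integrable P (pay h y \<sigma> (\<lambda>_. h))" using s t y h by (intro pay_integrable)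
      fix \<omega> assume \<omega>: "\<omega> \<in> space P"
      have c: "0 \<le> \<sigma> \<omega>" "\<sigma> \<omega> \<le> h" using s'(2) \<omega> by auto
      have "exp (- r * h) * A * \<sigma> \<omega> + - ((A + r * b) / N) * ?Q \<omega> =
          (LINT s:{0..\<sigma> \<omega>}|lborel. exp (- r * h) * A + - ((A + r * b) / N) * (exp (1 * Zc s \<omega>) - 1)\<^sup>2)"
        by (rule affine_path_integral[OF \<omega> c(1), symmetric])
      also have "\<dots> \<le> gain b y (\<sigma> \<omega>) \<omega>"
        unfolding gain_def
      proof (rule path_integral_mono)
        show "continuous_on UNIV (\<lambda>s. exp (- r * h) * A + - ((A + r * b) / N) * (exp (1 * Zc s \<omega>) - 1)\<^sup>2)"
          by (intro continuous_intros exp_path_cont \<omega>)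
        show "continuous_on UNIV (\<lambda>s. exp (- r * s) * (f (y * exp (Zc s \<omega>)) - r * b))" by (rule gain_cont[OF y \<omega>])
        fix s assume ss: "0 \<le> s" "s \<le> \<sigma> \<omega>"
        let ?\<Phi> = "(exp (1 * Zc s \<omega>) - 1)\<^sup>2"
        have "exp (- r * h) * A \<le> exp (- r * s) * A" using A ss c r_pos by (intro mult_right_mono) auto
        moreover have "exp (- r * s) * ((A + r * b) / N * ?\<Phi>) \<le> 1 * ((A + r * b) / N * ?\<Phi>)"
          using B0 N ss r_pos by (intro mult_right_mono) auto
        moreover have "exp (- r * s) * (A + - ((A + r * b) / N) * ?\<Phi>) \<le> exp (- r * s) * (f (y * exp (Zc s \<omega>)) - r * b)"
          using point by (intro mult_left_mono) auto
        ultimately show "exp (- r * h) * A + - ((A + r * b) / N) * ?\<Phi> \<le> exp (- r * s) * (f (y * exp (Zc s \<omega>)) - r * b)"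
          by (simp add: algebra_simps)
      qed
      finally have g: "((b - a) / h + 1) * \<sigma> \<omega> - (A + r * b) / N * ?Q \<omega> \<le> gain b y (\<sigma> \<omega>) \<omega>"
        unfolding eA by simp
      \<comment> \<open>The amount is lost only at \<open>\<sigma> \<omega> = h\<close>, where the
        line of slope \<open>(b - a) / h\<close> reaches it.\<close>
      have "(if \<sigma> \<omega> \<le> h \<and> \<sigma> \<omega> < h then 0 else (b - a) * exp (- r * h)) \<le> (b - a) / h * \<sigma> \<omega>"
      proof (cases "\<sigma> \<omega> < h")
        case True
        then show ?thesis using c a_less_b h by simp
      next
        case False
        then have "\<sigma> \<omega> = h" using c by simp
        moreover have "(b - a) * exp (- r * h) \<le> (b - a) * 1"
          using a_less_b r_pos h by (intro mult_left_mono) auto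
        ultimately show ?thesis using h by simp
      qed
      then show "b + \<sigma> \<omega> - (A + r * b) / N * ?Q \<omega> \<le> pay h y \<sigma> (\<lambda>_. h) \<omega>"
        unfolding pay_upper_form[OF y s t \<omega>] using g c by (simp add: min_absorb2 distrib_right)
    qed
    finally show "b \<le> \<Psi> h y \<sigma> (\<lambda>_. h)" .
  qed (use h y in auto)
  then show ?thesis using value_le_upper[OF h y] y by (intro exI[of _ y]) auto
qed

text \<open>
  The weight \<open>q / (q - 1)\<^sup>2\<close> with \<open>q = y / y'\<close> is the maximum of \<open>u / (u - 1)\<^sup>2\<close> over \<open>u \<ge> q\<close>,
  where \<open>u = exp (- Z)\<close> ranges over the states with \<open>y * exp Z \<le> y'\<close>.
\<close>

lemma value_eq_lower_region:
  "\<exists>C\<ge>0. \<forall>h y y'. 0 < h \<longrightarrow> h \<le> T \<longrightarrow> 0 < y' \<longrightarrow> y' < y \<longrightarrow> f y' < r * a \<longrightarrow>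
    C * h * (K * (1 + 1 / y) * ((y / y') / (y / y' - 1)\<^sup>2)) \<le> exp (- r * T) * (r * a - f y') \<longrightarrow> v h y = a"
proof -
  obtain C where C: "C \<ge> 0" and occ: "\<And>\<sigma> h. stopping_time F \<sigma> \<Longrightarrow> (\<forall>\<omega>\<in>space P. 0 \<le> \<sigma> \<omega> \<and> \<sigma> \<omega> \<le> h) \<Longrightarrow> h \<le> T \<Longrightarrow>
    integrable P (\<lambda>\<omega>. LINT s:{0..\<sigma> \<omega>}|lborel. (exp (- 1 * Zc s \<omega>) - 1)\<^sup>2) \<and>
    (\<integral>\<omega>. (LINT s:{0..\<sigma> \<omega>}|lborel. (exp (- 1 * Zc s \<omega>) - 1)\<^sup>2) \<partial>P) \<le> C * h * (\<integral>\<omega>. \<sigma> \<omega> \<partial>P)"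
    using occupation_square_exp[of "- 1"] by (elim exE conjE) (rule that, assumption, simp only:)
  have "v h y = a"
    if h: "0 < h" "h \<le> T" and y: "0 < y'" "y' < y" and fy: "f y' < r * a"
      and small: "C * h * (K * (1 + 1 / y) * ((y / y') / (y / y' - 1)\<^sup>2)) \<le> exp (- r * T) * (r * a - f y')" for h y y'
  proof -
    have y0: "0 < y" using y by simp
    define \<delta> where "\<delta> = r * a - f y'"
    define q where "q = y / y'"
    define M where "M = K * (1 + 1 / y) * (q / (q - 1)\<^sup>2)"
    have q: "1 < q" using y by (simp add: q_def)
    have \<delta>: "0 < \<delta>" "\<delta> \<le> r * a" using fy f_pos[OF y(1)] by (auto simp: \<delta>_def)
    have M: "0 \<le> M" using K_nonneg y0 q unfolding M_def by (intro mult_nonneg_nonneg) auto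
    have small': "C * h * M \<le> exp (- r * T) * \<delta>" using small by (simp add: M_def q_def \<delta>_def)
    \<comment> \<open>Above \<open>y'\<close> the rate is below \<open>r * a\<close> by the margin
      \<delta>; below \<open>y'\<close> the quadratic term alone dominates \<open>f\<close>.\<close>
    have point: "f (y * exp z) - r * a \<le> - \<delta> + M * (exp (- 1 * z) - 1)\<^sup>2" for z
    proof (cases "y' \<le> y * exp z")
      case True
      then have "f (y * exp z) \<le> f y'" using f_mono[OF y(1)] by simp
      moreover have "0 \<le> M * (exp (- 1 * z) - 1)\<^sup>2" using M by simp
      ultimately show ?thesis by (simp add: \<delta>_def)
    next
      case False
      define u where "u = exp (- z)"
      have u0: "0 < u" by (simp add: u_def)
      have uz: "y * exp z = y / u" by (simp add: u_def exp_minus field_simps)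
      have u: "q < u" using False y u0 unfolding uz by (simp add: q_def field_simps not_le)
      have "f (y * exp z) \<le> K * (1 + 1 / (y / u))" unfolding uz using y0 u0 by (intro f_le) simp
      \<comment> \<open>Uses \<open>u \<ge> 1\<close> to absorb the additive 1.\<close>
      also have "\<dots> \<le> K * ((1 + 1 / y) * u)"
        using K_nonneg y0 u0 q u by (intro mult_left_mono) (auto simp: field_simps)
      also have "\<dots> \<le> K * ((1 + 1 / y) * (q / (q - 1)\<^sup>2 * (u - 1)\<^sup>2))"
      proof (intro mult_left_mono K_nonneg)
        \<comment> \<open>The product \<open>(u - q) * (u * q - 1)\<close> is the difference of the
          two sides of the claimed bound after clearing denominators.\<close>
        have "1 < u * q" using u q by (intro less_1_mult) auto
        then have "0 \<le> (u - q) * (u * q - 1)" using u by (intro mult_nonneg_nonneg) auto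
        also have "\<dots> = q * (u - 1)\<^sup>2 - u * (q - 1)\<^sup>2" by (simp add: power2_eq_square algebra_simps)
        finally have "u * (q - 1)\<^sup>2 \<le> q * (u - 1)\<^sup>2" by simp
        then show "u \<le> q / (q - 1)\<^sup>2 * (u - 1)\<^sup>2" using q by (simp add: field_simps)
      qed (use y0 in auto)
      also have "\<dots> = M * (exp (- 1 * z) - 1)\<^sup>2" by (simp add: M_def u_def mult.assoc)
      finally show ?thesis using \<delta> by simp
    qed
    have "v h y \<le> a"
    proof (rule value_le)
      show s: "(\<lambda>_. h) \<in> ST h" using h by (intro ST_const) auto
      fix \<tau> assume t: "\<tau> \<in> ST h"
      let ?Q = "\<lambda>\<omega>. LINT s:{0..\<tau> \<omega>}|lborel. (exp (- 1 * Zc s \<omega>) - 1)\<^sup>2"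
      have t': "stopping_time F \<tau>" "\<forall>\<omega>\<in>space P. 0 \<le> \<tau> \<omega> \<and> \<tau> \<omega> \<le> h" using t by (auto simp: ST_def)
      have [measurable]: "\<tau> \<in> borel_measurable P" using t by (rule ST_measurable)
      have Q: "integrable P ?Q" "(\<integral>\<omega>. ?Q \<omega> \<partial>P) \<le> C * h * (\<integral>\<omega>. \<tau> \<omega> \<partial>P)" using occ[OF t' h(2)] by auto
      have \<tau>int: "integrable P \<tau>" using t'(2) by (intro integrable_const_bound[where B=h]) auto
      have E0: "0 \<le> (\<integral>\<omega>. \<tau> \<omega> \<partial>P)" using t'(2) by (intro integral_nonneg_AE) auto
      have "\<Psi> h y (\<lambda>_. h) \<tau> \<le> (\<integral>\<omega>. a - exp (- r * T) * \<delta> * \<tau> \<omega> + M * ?Q \<omega> \<partial>P)"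
        unfolding \<Psi>_def
      proof (rule integral_mono)
        show "integrable P (\<lambda>\<omega>. a - exp (- r * T) * \<delta> * \<tau> \<omega> + M * ?Q \<omega>)" using Q(1) \<tau>int by simp
        show "integrable P (pay h y (\<lambda>_. h) \<tau>)" using s t y0 h by (intro pay_integrable)
        fix \<omega> assume \<omega>: "\<omega> \<in> space P"
        have c: "0 \<le> \<tau> \<omega>" "\<tau> \<omega> \<le> h" using t'(2) \<omega> by auto
        have "gain a y (\<tau> \<omega>) \<omega> \<le> (LINT s:{0..\<tau> \<omega>}|lborel. - exp (- r * T) * \<delta> + M * (exp (- 1 * Zc s \<omega>) - 1)\<^sup>2)"
          unfolding gain_def
        proof (rule path_integral_mono)
          show "continuous_on UNIV (\<lambda>s. - exp (- r * T) * \<delta> + M * (exp (- 1 * Zc s \<omega>) - 1)\<^sup>2)"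
            by (intro continuous_intros exp_path_cont \<omega>)
          show "continuous_on UNIV (\<lambda>s. exp (- r * s) * (f (y * exp (Zc s \<omega>)) - r * a))" by (rule gain_cont[OF y0 \<omega>])
          fix s assume ss: "0 \<le> s" "s \<le> \<tau> \<omega>"
          let ?\<Phi> = "(exp (- 1 * Zc s \<omega>) - 1)\<^sup>2"
          have "exp (- r * T) * \<delta> \<le> exp (- r * s) * \<delta>" using \<delta> ss c h r_pos by (intro mult_right_mono) auto
          moreover have "exp (- r * s) * (M * ?\<Phi>) \<le> 1 * (M * ?\<Phi>)"
            using M ss r_pos by (intro mult_right_mono) auto
          moreover have "exp (- r * s) * (f (y * exp (Zc s \<omega>)) - r * a) \<le> exp (- r * s) * (- \<delta> + M * ?\<Phi>)"
            using point by (intro mult_left_mono) auto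
          ultimately show "exp (- r * s) * (f (y * exp (Zc s \<omega>)) - r * a) \<le> - exp (- r * T) * \<delta> + M * ?\<Phi>"
            by (simp add: algebra_simps)
        qed
        also have "\<dots> = - exp (- r * T) * \<delta> * \<tau> \<omega> + M * ?Q \<omega>" by (rule affine_path_integral[OF \<omega> c(1)])
        finally show "pay h y (\<lambda>_. h) \<tau> \<omega> \<le> a - exp (- r * T) * \<delta> * \<tau> \<omega> + M * ?Q \<omega>"
          unfolding pay_lower_form[OF y0 s t \<omega>] using c by (simp add: min_absorb1)
      qed
      also have "\<dots> = a - exp (- r * T) * \<delta> * (\<integral>\<omega>. \<tau> \<omega> \<partial>P) + M * (\<integral>\<omega>. ?Q \<omega> \<partial>P)"
        using Q(1) \<tau>int by (simp add: prob_space)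
      also have "\<dots> \<le> a - exp (- r * T) * \<delta> * (\<integral>\<omega>. \<tau> \<omega> \<partial>P) + M * (C * h * (\<integral>\<omega>. \<tau> \<omega> \<partial>P))"
        using Q(2) M by (intro add_left_mono mult_left_mono) auto
      also have "\<dots> = a + (C * h * M - exp (- r * T) * \<delta>) * (\<integral>\<omega>. \<tau> \<omega> \<partial>P)" by (simp add: algebra_simps)
      also have "\<dots> \<le> a" using small' E0 by (simp add: mult_nonpos_nonneg)
      finally show "\<Psi> h y (\<lambda>_. h) \<tau> \<le> a" .
    qed (use h y0 in auto)
    then show "v h y = a" using value_ge_lower[OF h y0] by simp
  qed
  then show ?thesis using C by (intro exI[of _ C] conjI allI impI)
qed

text \<open>At a fixed horizon smallness must come from the distance: with \<open>y = q * z\<close>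
  the weight \<open>q / (q - 1)\<^sup>2\<close> is at most \<open>4 / q\<close>.\<close>

lemma exists_value_eq_lower:
  assumes h: "0 < h" "h \<le> T"
  shows "\<exists>y>0. v h y = a"
proof -
  obtain C where C: "C \<ge> 0" and region: "\<And>h y y'. 0 < h \<Longrightarrow> h \<le> T \<Longrightarrow> 0 < y' \<Longrightarrow> y' < y \<Longrightarrow> f y' < r * a \<Longrightarrow>
    C * h * (K * (1 + 1 / y) * ((y / y') / (y / y' - 1)\<^sup>2)) \<le> exp (- r * T) * (r * a - f y') \<Longrightarrow> v h y = a"
    using value_eq_lower_region by (elim exE conjE) (rule that, assumption, simp only:)
  have "\<forall>\<^sub>F x in at_top. 0 < x \<and> f x < r * a"
    using f_at_top r_pos a_pos by (intro eventually_conj eventually_gt_at_top order_tendstoD(2)) auto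
  from eventually_happens'[OF trivial_limit_at_top_linorder this]
  obtain z where z: "0 < z" "f z < r * a" by blast
  define D where "D = exp (- r * T) * (r * a - f z)"
  have D: "0 < D" using z by (simp add: D_def)
  \<comment> \<open>The entries ensure \<open>q - 1 \<ge> q / 2\<close>, \<open>y \<ge> 1\<close>
    and \<open>8 * K * C * h / q \<le> D\<close>, respectively.\<close>
  define q where "q = max (max 2 (1 / z)) (8 * K * C * h / D)"
  have q: "2 \<le> q" "1 / z \<le> q" "8 * K * C * h / D \<le> q" by (auto simp: q_def)
  define y where "y = q * z"
  have y: "z < y" "1 \<le> y" using q z by (auto simp: y_def field_simps)
  have yz: "y / z = q" using z by (simp add: y_def)
  have "v h y = a"
  proof (rule region[OF h z(1) y(1) z(2)])
    have "q / (q - 1)\<^sup>2 \<le> q / (q / 2)\<^sup>2"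
      using q by (intro divide_left_mono power_mono) auto
    also have "\<dots> = 4 / q" using q by (simp add: power2_eq_square)
    finally have 1: "q / (q - 1)\<^sup>2 \<le> 4 / q" .
    have "K * (1 + 1 / y) \<le> K * 2" using y K_nonneg by (intro mult_left_mono) auto
    then have "K * (1 + 1 / y) * (q / (q - 1)\<^sup>2) \<le> K * 2 * (4 / q)"
      by (rule mult_mono[OF _ 1]) (use K_nonneg q in auto)
    then have "C * h * (K * (1 + 1 / y) * (q / (q - 1)\<^sup>2)) \<le> C * h * (K * 2 * (4 / q))"
      using C h by (intro mult_left_mono) auto
    also have "\<dots> = 8 * K * C * h / q" by simp
    also have "\<dots> \<le> D" using q D by (simp add: field_simps)
    finally show "C * h * (K * (1 + 1 / y) * ((y / z) / (y / z - 1)\<^sup>2)) \<le> exp (- r * T) * (r * a - f z)"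
      unfolding yz D_def .
  qed
  then show ?thesis using y by (intro exI[of _ y]) auto
qed

text \<open>Here smallness comes from the horizon: for fixed \<open>y\<close> the midpoint
  \<open>y'\<close> leaves a positive margin \<open>D\<close>, while the error is proportional to
  \<open>h\<close>.\<close>

lemma value_eq_lower_near_maturity:
  assumes x: "0 < x" "f x = r * a" "x < y"
  obtains \<delta> where "0 < \<delta>" "\<And>h. 0 < h \<Longrightarrow> h \<le> T \<Longrightarrow> h \<le> \<delta> \<Longrightarrow> v h y = a"
proof -
  obtain C where C: "C \<ge> 0" and region: "\<And>h y y'. 0 < h \<Longrightarrow> h \<le> T \<Longrightarrow> 0 < y' \<Longrightarrow> y' < y \<Longrightarrow> f y' < r * a \<Longrightarrow>
    C * h * (K * (1 + 1 / y) * ((y / y') / (y / y' - 1)\<^sup>2)) \<le> exp (- r * T) * (r * a - f y') \<Longrightarrow> v h y = a"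
    using value_eq_lower_region by (elim exE conjE) (rule that, assumption, simp only:)
  define y' where "y' = (x + y) / 2"
  have y': "x < y'" "y' < y" "0 < y'" using x by (auto simp: y'_def)
  have fy': "f y' < r * a" using f_anti[OF x(1) y'(1)] x by simp
  define M where "M = C * (K * (1 + 1 / y) * ((y / y') / (y / y' - 1)\<^sup>2))"
  have M: "0 \<le> M" using C K_nonneg y' unfolding M_def by (intro mult_nonneg_nonneg add_nonneg_nonneg) auto
  define D where "D = exp (- r * T) * (r * a - f y')"
  have D: "0 < D" using fy' by (simp add: D_def)
  show ?thesis
  proof (rule that)
    \<comment> \<open>The added 1 guards against \<open>M = 0\<close>.\<close>
    show "0 < D / (M + 1)" using D M by simp
    fix h assume h: "0 < h" "h \<le> T" "h \<le> D / (M + 1)"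
    have "M * h \<le> (M + 1) * h" using h by (intro mult_right_mono) auto
    also have "\<dots> \<le> D" using h M by (simp add: field_simps)
    finally have "C * h * (K * (1 + 1 / y) * ((y / y') / (y / y' - 1)\<^sup>2)) \<le> exp (- r * T) * (r * a - f y')"
      by (simp add: M_def D_def algebra_simps)
    then show "v h y = a" using region[OF h(1,2) y'(3,2) fy'] by simp
  qed
qed

section \<open>Strict inequalities at the critical levels\<close>

lemma short_horizon:
  assumes "0 < h" "h \<le> T" "0 < B" "0 < D"
  obtains \<epsilon> where "0 < \<epsilon>" "\<epsilon> < h" "\<epsilon> \<le> T" "B * \<epsilon> \<le> (D::real)"
proof
  let ?e = "min (h / 2) (D / B)"
  show "0 < ?e" "?e < h" "?e \<le> T" using assms by auto
  have "B * ?e \<le> B * (D / B)" using assms by (intro mult_left_mono) auto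
  then show "B * ?e \<le> D" using assms by simp
qed

text \<open>
  The minimizer's stopping time is so short that the penalty \<open>b - a\<close> deters the maximizer from
  stopping first.
\<close>

lemma value_less_upper:
  assumes h: "0 < h" "h \<le> T" and y: "0 < y" "f y = r * b"
  shows "v h y < b"
proof -
  have rb: "0 < r * b" using r_pos a_pos a_less_b by simp
  \<comment> \<open>The gain falls at rate at most \<open>r * b\<close>, so within \<epsilon> it
    cannot fall by more than the smallest discounted premium on \<open>{0..h}\<close>. A maximizer
    who stops first therefore fares no better than by letting \<sigma> run out.\<close>
  obtain \<epsilon> where \<epsilon>: "0 < \<epsilon>" "\<epsilon> < h" "\<epsilon> \<le> T" "r * b * \<epsilon> \<le> (b - a) * exp (- r * h)"
    using short_horizon[OF h rb, of "(b - a) * exp (- r * h)"] a_less_b by auto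
  define g where "g z = f (y * exp z) - r * b" for z
  obtain \<sigma> where \<sigma>: "stopping_time F \<sigma>" "\<And>\<omega>. 0 \<le> \<sigma> \<omega> \<and> \<sigma> \<omega> \<le> \<epsilon>"
    "(\<integral>\<omega>. (LINT s:{0..\<sigma> \<omega>}|lborel. exp (- r * s) * g (Zc s \<omega>)) \<partial>P) < 0"
  proof (rule exists_short_stopping_time[OF \<epsilon>(1,3), of r g])
    show "0 \<le> r" using r_pos by simp
    show "antimono g" using y unfolding g_def by (intro antimonoI diff_right_mono f_mono) auto
    show "g 0 = 0" using y by (simp add: g_def)
    show "g z < 0" if "0 < z" for z using f_anti[of y "y * exp z"] y that by (simp add: g_def)
    have "continuous_on UNIV g" unfolding g_def by (intro continuous_intros f_exp_cont y)
    then have "(g \<longlongrightarrow> g 0) (at 0)" by (simp add: continuous_on_def)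
    then show "(g \<longlongrightarrow> 0) (at_left 0)"
      unfolding \<open>g 0 = 0\<close> by (rule filterlim_mono) (auto simp: at_le)
    have m: "(\<lambda>p. g (Zc (fst p) (snd p))) \<in> borel_measurable LP"
      unfolding g_def using measurable_compose[OF Zc_joint_measurable f_exp_measurable[OF y(1)]]
      by (simp cong: measurable_cong_sets)
    show "integrable LP (\<lambda>p. indicator {0..\<epsilon>} (fst p) * g (Zc (fst p) (snd p)))"
    proof (rule Bochner_Integration.integrable_bound)
      \<comment> \<open>The undiscounted rate is dominated by the integrable discounted one, the
        factor \<open>exp (r * T)\<close> undoing the discount.\<close>
      show "integrable LP (\<lambda>p. exp (r * T) * (indicator {0..T} (fst p) * rate y (fst p) (snd p))
          + r * b * indicator ({0..T} \<times> space P) p)"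
        using emeasure_strip rate_integrable[OF y(1)]
        by (intro Bochner_Integration.integrable_add integrable_mult_right integrable_real_indicator) auto
      show "AE p in LP. norm (indicator {0..\<epsilon>} (fst p) * g (Zc (fst p) (snd p))) \<le>
        norm (exp (r * T) * (indicator {0..T} (fst p) * rate y (fst p) (snd p)) + r * b * indicator ({0..T} \<times> space P) p)"
      proof (rule AE_I2)
        fix p :: "real \<times> 'a" assume "p \<in> space LP"
        then have p: "snd p \<in> space P" by (auto simp: space_pair_measure)
        let ?s = "fst p" let ?f = "f (y * exp (Zc (fst p) (snd p)))"
        show "norm (indicator {0..\<epsilon>} (fst p) * g (Zc (fst p) (snd p))) \<le>
          norm (exp (r * T) * (indicator {0..T} (fst p) * rate y (fst p) (snd p)) + r * b * indicator ({0..T} \<times> space P) p)"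
        proof (cases "?s \<in> {0..\<epsilon>}")
          case True
          have f0: "0 < ?f" using y by (intro f_pos) simp
          have "?f \<le> exp (r * T - r * ?s) * ?f"
            using f0 True \<epsilon> r_pos by (simp add: mult_le_cancel_right1)
          also have "\<dots> = exp (r * T) * rate y ?s (snd p)"
            by (simp add: rate_def exp_diff exp_minus field_simps)
          finally have "?f \<le> exp (r * T) * rate y ?s (snd p)" .
          moreover have "p \<in> {0..T} \<times> space P" using True \<epsilon> p by (cases p) auto
          moreover have "\<bar>g (Zc ?s (snd p))\<bar> \<le> ?f + r * b" using f0 rb by (auto simp: g_def)
          ultimately show ?thesis using True \<epsilon> rb by simp
        qed simp
      qed
    qed (use m in measurable)
  qed (rule that)
  have g_gain: "(LINT s:{0..c}|lborel. exp (- r * s) * g (Zc s \<omega>)) = gain b y c \<omega>" for c \<omega>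
    by (simp add: gain_def g_def)
  have "\<sigma> \<in> ST \<epsilon>" using \<sigma>(1,2) by (simp add: ST_def)
  then have s: "\<sigma> \<in> ST h" by (rule ST_mono) (use \<epsilon> in simp)
  have int: "integrable P (\<lambda>\<omega>. gain b y (\<sigma> \<omega>) \<omega>)" using y s h by (intro gain_integrable)
  have "v h y \<le> b + (\<integral>\<omega>. gain b y (\<sigma> \<omega>) \<omega> \<partial>P)"
  proof (rule value_le[OF _ h(2) y(1) s])
    fix \<tau> assume t: "\<tau> \<in> ST h"
    have "\<Psi> h y \<sigma> \<tau> \<le> (\<integral>\<omega>. b + gain b y (\<sigma> \<omega>) \<omega> \<partial>P)"
      unfolding \<Psi>_def
    proof (rule integral_mono)
      show "integrable P (pay h y \<sigma> \<tau>)" using y s t h by (intro pay_integrable)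
      show "integrable P (\<lambda>\<omega>. b + gain b y (\<sigma> \<omega>) \<omega>)" using int by simp
      fix \<omega> assume \<omega>: "\<omega> \<in> space P"
      have c: "0 \<le> \<sigma> \<omega>" "\<sigma> \<omega> \<le> \<epsilon>" "0 \<le> \<tau> \<omega>" using \<sigma>(2) ST_D(2)[OF t \<omega>] by auto
      show "pay h y \<sigma> \<tau> \<omega> \<le> b + gain b y (\<sigma> \<omega>) \<omega>"
      proof (cases "\<sigma> \<omega> \<le> \<tau> \<omega>")
        case True
        then show ?thesis unfolding pay_upper_form[OF y(1) s t \<omega>] using c \<epsilon> by (simp add: min_absorb2)
      next
        case False
        have "- (r * b) * (\<sigma> \<omega> - \<tau> \<omega>) = (LINT s:{\<tau> \<omega>..\<sigma> \<omega>}|lborel. - (r * b))"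
          using False by (intro path_integral_const[symmetric]) simp
        also have "\<dots> \<le> (LINT s:{\<tau> \<omega>..\<sigma> \<omega>}|lborel. exp (- r * s) * (f (y * exp (Zc s \<omega>)) - r * b))"
        proof (rule path_integral_mono[OF _ gain_cont[OF y(1) \<omega>]])
          fix s assume ss: "\<tau> \<omega> \<le> s" "s \<le> \<sigma> \<omega>"
          have "exp (- r * s) * (r * b) \<le> 1 * (r * b)" using ss c r_pos rb by (intro mult_right_mono) auto
          moreover have "0 < exp (- r * s) * f (y * exp (Zc s \<omega>))" using y by (intro mult_pos_pos f_pos) auto
          ultimately show "- (r * b) \<le> exp (- r * s) * (f (y * exp (Zc s \<omega>)) - r * b)"
            unfolding right_diff_distrib by linarith
        qed simp
        finally have "gain b y (\<tau> \<omega>) \<omega> - (r * b) * (\<sigma> \<omega> - \<tau> \<omega>) \<le> gain b y (\<sigma> \<omega>) \<omega>"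
          using gain_split[OF y(1) \<omega> c(3), of "\<sigma> \<omega>" b] False by simp
        moreover have "(r * b) * (\<sigma> \<omega> - \<tau> \<omega>) \<le> (b - a) * exp (- r * \<tau> \<omega>)"
        proof -
          have "(r * b) * (\<sigma> \<omega> - \<tau> \<omega>) \<le> (r * b) * \<epsilon>" using c rb by (intro mult_left_mono) auto
          also have "\<dots> \<le> (b - a) * exp (- r * h)" by (rule \<epsilon>(4))
          also have "\<dots> \<le> (b - a) * exp (- r * \<tau> \<omega>)"
            using a_less_b r_pos ST_D(3)[OF t \<omega>] by (intro mult_left_mono) auto
          finally show ?thesis .
        qed
        ultimately show ?thesis
          unfolding pay_upper_form[OF y(1) s t \<omega>] using False by (simp add: min_absorb1)
      qed
    qed
    also have "\<dots> = b + (\<integral>\<omega>. gain b y (\<sigma> \<omega>) \<omega> \<partial>P)" using int by (simp add: prob_space)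
    finally show "\<Psi> h y \<sigma> \<tau> \<le> b + (\<integral>\<omega>. gain b y (\<sigma> \<omega>) \<omega> \<partial>P)" .
  qed (use h in simp)
  then show ?thesis using \<sigma>(3) unfolding g_gain by simp
qed

text \<open>
  The maximizer runs the same strategy for the reflected process \<open>-Z\<close>. Capping the profit rate
  at \<open>r * a + 1\<close> only lowers the payoff and makes the rate bounded.
\<close>

lemma value_greater_lower:
  assumes h: "0 < h" "h \<le> T" and y: "0 < y" "f y = r * a"
  shows "a < v h y"
proof -
  interpret N: drifted_brownian_motion P F "\<lambda>s \<omega>. - Z s \<omega>" "- m" \<kappa> T by (rule mirrored)
  have Zc_neg: "N.Zc s \<omega> = - Zc s \<omega>" for s \<omega> by (simp add: N.Zc_def Zc_def)
  have ra: "0 < r * a" using r_pos a_pos by simp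
  \<comment> \<open>The capped net rate is at most 1, which explains the factor 1: what a minimizer
    who stops first cuts off is at most \<epsilon>, no more than the premium then due.\<close>
  obtain \<epsilon> where \<epsilon>: "0 < \<epsilon>" "\<epsilon> < h" "\<epsilon> \<le> T" "1 * \<epsilon> \<le> (b - a) * exp (- r * h)"
    using short_horizon[OF h zero_less_one, of "(b - a) * exp (- r * h)"] a_less_b by auto
  define f' where "f' x = min (f x) (r * a + 1)" for x
  define g where "g z = r * a - f' (y * exp (- z))" for z
  have f'_cont: "continuous_on UNIV (\<lambda>z. f' (y * exp z))"
    unfolding f'_def by (intro continuous_intros f_exp_cont y)
  have path': "continuous_on UNIV (\<lambda>s. exp (- r * s) * (f' (y * exp (Zc s \<omega>)) - r * a))" if "\<omega> \<in> space P" for \<omega>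
    using continuous_on_compose2[OF f'_cont Zc_cont[OF that]] by (intro continuous_intros) auto
  have f'_bounds: "0 < f' x" "f' x \<le> r * a + 1" "f' x \<le> f x" if "0 < x" for x
    using f_pos[OF that] ra by (auto simp: f'_def)
  obtain \<tau> where \<tau>: "stopping_time F \<tau>" "\<And>\<omega>. 0 \<le> \<tau> \<omega> \<and> \<tau> \<omega> \<le> \<epsilon>"
    "(\<integral>\<omega>. (LINT s:{0..\<tau> \<omega>}|lborel. exp (- r * s) * g (N.Zc s \<omega>)) \<partial>P) < 0"
  proof (rule N.exists_short_stopping_time[OF \<epsilon>(1,3), of r g])
    show "0 \<le> r" using r_pos by simp
    show "antimono g"
      using y unfolding g_def f'_def by (intro antimonoI diff_left_mono min.mono f_mono order_refl) auto
    show "g 0 = 0" using y by (simp add: g_def f'_def)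
    show "g z < 0" if "0 < z" for z using f_anti[of "y * exp (- z)" y] y that by (simp add: g_def f'_def)
    have cont: "continuous_on UNIV g"
      unfolding g_def
      by (intro continuous_intros continuous_on_compose2[OF f'_cont, where f=uminus]) auto
    then have "(g \<longlongrightarrow> g 0) (at 0)" by (simp add: continuous_on_def)
    then show "(g \<longlongrightarrow> 0) (at_left 0)"
      unfolding \<open>g 0 = 0\<close> by (rule filterlim_mono) (auto simp: at_le)
    have [measurable]: "g \<in> borel_measurable borel" using cont by (rule borel_measurable_continuous_onI)
    have [measurable]: "(\<lambda>p. N.Zc (fst p) (snd p)) \<in> borel_measurable LP"
      using N.Zc_joint_measurable by (simp cong: measurable_cong_sets)
    show "integrable LP (\<lambda>p. indicator {0..\<epsilon>} (fst p) * g (N.Zc (fst p) (snd p)))"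
    proof (rule integrable_strip)
      show "\<bar>indicator {0..\<epsilon>} (fst (s, \<omega>)) * g (N.Zc (fst (s, \<omega>)) (snd (s, \<omega>)))\<bar> \<le> (r * a + 1) * indicator {0..\<epsilon>} s"
        for s \<omega>
        using f'_bounds[of "y * exp (- N.Zc s \<omega>)"] y ra by (auto simp: g_def indicator_def)
    qed measurable
  qed (rule that)
  let ?G = "\<lambda>c \<omega>. LINT s:{0..c}|lborel. exp (- r * s) * (f' (y * exp (Zc s \<omega>)) - r * a)"
  have g_gain: "(LINT s:{0..c}|lborel. exp (- r * s) * g (N.Zc s \<omega>)) = - ?G c \<omega>" for c \<omega>
    unfolding g_def Zc_neg set_lebesgue_integral_def
    by (subst Bochner_Integration.integral_minus[symmetric]) (auto intro!: Bochner_Integration.integral_cong simp: algebra_simps)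
  have gain_pos: "0 < (\<integral>\<omega>. ?G (\<tau> \<omega>) \<omega> \<partial>P)" using \<tau>(3) unfolding g_gain by simp
  \<comment> \<open>A nonintegrable function has integral 0 by convention, so a positive integral
    implies integrability.\<close>
  then have int: "integrable P (\<lambda>\<omega>. ?G (\<tau> \<omega>) \<omega>)"
    using not_integrable_integral_eq by fastforce
  have "\<tau> \<in> ST \<epsilon>" using \<tau>(1,2) by (simp add: ST_def)
  then have t: "\<tau> \<in> ST h" by (rule ST_mono) (use \<epsilon> in simp)
  have le_gain: "?G c \<omega> \<le> gain a y c \<omega>" if \<omega>: "\<omega> \<in> space P" for c \<omega>
    unfolding gain_def using f'_bounds(3) y
    by (intro path_integral_mono[OF path'[OF \<omega>] gain_cont[OF y(1) \<omega>]] mult_left_mono diff_right_mono) auto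
  have "a + (\<integral>\<omega>. ?G (\<tau> \<omega>) \<omega> \<partial>P) \<le> v h y"
  proof (rule value_ge[OF _ h(2) y(1) t])
    fix \<sigma> assume s: "\<sigma> \<in> ST h"
    have "a + (\<integral>\<omega>. ?G (\<tau> \<omega>) \<omega> \<partial>P) = (\<integral>\<omega>. a + ?G (\<tau> \<omega>) \<omega> \<partial>P)" using int by (simp add: prob_space)
    also have "\<dots> \<le> \<Psi> h y \<sigma> \<tau>"
      unfolding \<Psi>_def
    proof (rule integral_mono)
      show "integrable P (pay h y \<sigma> \<tau>)" using y s t h by (intro pay_integrable)
      show "integrable P (\<lambda>\<omega>. a + ?G (\<tau> \<omega>) \<omega>)" using int by simp
      fix \<omega> assume \<omega>: "\<omega> \<in> space P"
      have c: "0 \<le> \<tau> \<omega>" "\<tau> \<omega> \<le> \<epsilon>" "0 \<le> \<sigma> \<omega>" "\<sigma> \<omega> \<le> h" using \<tau>(2) ST_D[OF s] \<omega> by auto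
      show "a + ?G (\<tau> \<omega>) \<omega> \<le> pay h y \<sigma> \<tau> \<omega>"
      proof (cases "\<sigma> \<omega> \<le> \<tau> \<omega>")
        case False
        then show ?thesis unfolding pay_lower_form[OF y(1) s t \<omega>] using le_gain[OF \<omega>] by (simp add: min_absorb1)
      next
        case True
        have "(LINT s:{\<sigma> \<omega>..\<tau> \<omega>}|lborel. exp (- r * s) * (f' (y * exp (Zc s \<omega>)) - r * a)) \<le> (LINT s:{\<sigma> \<omega>..\<tau> \<omega>}|lborel. 1)"
        proof (rule path_integral_mono[OF path'[OF \<omega>]])
          fix s assume ss: "\<sigma> \<omega> \<le> s" "s \<le> \<tau> \<omega>"
          have "exp (- r * s) * (f' (y * exp (Zc s \<omega>)) - r * a) \<le> exp (- r * s) * 1"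
            using f'_bounds[of "y * exp (Zc s \<omega>)"] y by (intro mult_left_mono) auto
          also have "\<dots> \<le> 1" using ss c r_pos by simp
          finally show "exp (- r * s) * (f' (y * exp (Zc s \<omega>)) - r * a) \<le> 1" .
        qed simp
        also have "\<dots> = \<tau> \<omega> - \<sigma> \<omega>" using path_integral_const[OF True, of 1] by simp
        also have "\<dots> \<le> (b - a) * exp (- r * h)" using c \<epsilon>(4) by simp
        also have "\<dots> \<le> (b - a) * exp (- r * \<sigma> \<omega>)"
          using a_less_b r_pos c by (intro mult_left_mono) auto
        finally have "?G (\<tau> \<omega>) \<omega> \<le> ?G (\<sigma> \<omega>) \<omega> + (b - a) * exp (- r * \<sigma> \<omega>)"
          using path_integral_split[OF path'[OF \<omega>] c(3) True] by simp
        then show ?thesis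
          unfolding pay_lower_form[OF y(1) s t \<omega>] using le_gain[OF \<omega>, of "\<sigma> \<omega>"] True c \<epsilon>
          by (simp add: min_absorb2)
      qed
    qed
    finally show "a + (\<integral>\<omega>. ?G (\<tau> \<omega>) \<omega> \<partial>P) \<le> \<Psi> h y \<sigma> \<tau>" .
  qed (use h in simp)
  then show ?thesis using gain_pos by simp
qed

end

section \<open>Change of measure\<close>

locale wiener_space = prob_space M + complete_measure M for M :: "'a measure" +
  fixes W :: "real \<Rightarrow> 'a \<Rightarrow> real"
  assumes W: "brownian_motion M W"
begin

lemma W_measurable [measurable]: "0 \<le> t \<Longrightarrow> W t \<in> borel_measurable M"
  using W by (simp add: brownian_motion_def)

abbreviation \<F> :: "real \<Rightarrow> 'a measure" where
  "\<F> \<equiv> augmented_filtration M W"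

lemma generators_closed:
  "{W s -` A \<inter> space M | s A. 0 \<le> s \<and> s \<le> t \<and> A \<in> sets borel} \<union> null_sets M \<subseteq> sets M"
  by (auto intro: measurable_sets[OF W_measurable])

lemma space_\<F>: "space (\<F> t) = space M"
  by (simp add: augmented_filtration_def space_measure_of_conv)

lemma sets_\<F>: "sets (\<F> t) = sigma_sets (space M)
    ({W s -` A \<inter> space M | s A. 0 \<le> s \<and> s \<le> t \<and> A \<in> sets borel} \<union> null_sets M)"
  unfolding augmented_filtration_def
  using order_trans[OF generators_closed sets.space_closed] by (rule sets_measure_of)

lemma sets_\<F>_le: "sets (\<F> t) \<subseteq> sets M"
  unfolding sets_\<F> using generators_closed by (rule sets.sigma_sets_subset)

lemma filtration_\<F>: "filtration (space M) \<F>"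
proof
  show "sets (\<F> s) \<subseteq> sets (\<F> t)" if "s \<le> t" for s t
    unfolding sets_\<F> using that by (intro sigma_sets_mono') fastforce
qed (rule space_\<F>)

lemma null_in_\<F>: "N \<in> null_sets M \<Longrightarrow> N \<in> sets (\<F> t)"
  unfolding sets_\<F> by (intro sigma_sets.Basic) simp

lemma W_adapted: "0 \<le> s \<Longrightarrow> s \<le> t \<Longrightarrow> W s \<in> borel_measurable (\<F> t)"
proof (rule measurableI)
  fix A :: "real set" assume "0 \<le> s" "s \<le> t" "A \<in> sets borel"
  then show "W s -` A \<inter> space (\<F> t) \<in> sets (\<F> t)"
    unfolding space_\<F> unfolding sets_\<F> by (intro sigma_sets.Basic) auto
qed simp

lemma subalgebra_\<F>: "subalgebra M (\<F> t)"
  using sets_\<F>_le space_\<F> by (simp add: subalgebra_def)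

text \<open>Sorting \<open>J\<close> together with 0 and \<open>s\<close> and appending
  \<open>u\<close> yields a strictly increasing sequence, as the independence clause of
  \<open>brownian_motion\<close> demands; \<open>k\<close> locates the members of \<open>J\<close>
  in it.\<close>

lemma time_grid:
  assumes "finite J" "J \<subseteq> {0..s}" "0 \<le> s" "s < u"
  obtains t :: "nat \<Rightarrow> real" and n k where "t 0 = 0" "t n = s" "t (Suc n) = u" "\<And>i. i < Suc n \<Longrightarrow> t i < t (Suc i)"
    "\<And>q. q \<in> J \<Longrightarrow> k q \<le> n \<and> t (k q) = q"
proof -
  define S where "S = J \<union> {0, s}"
  define L where "L = sorted_list_of_set S"
  have S: "finite S" "0 \<in> S" "s \<in> S" "\<And>x. x \<in> S \<Longrightarrow> 0 \<le> x \<and> x \<le> s" using assms by (auto simp: S_def)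
  have set_L: "set L = S" using S by (simp add: L_def)
  have sorted: "sorted L" "distinct L" by (auto simp: L_def)
  have lt: "L ! i < L ! j" if "i < j" "j < length L" for i j
    using sorted_nth_mono[OF sorted(1), of i j] nth_eq_iff_index_eq[OF sorted(2), of i j] that by force
  have ne: "L \<noteq> []" using set_L S by auto
  define n where "n = length L - 1"
  have len: "length L = Suc n" using ne by (simp add: n_def)
  have ex: "\<exists>i\<le>n. L ! i = q" if "q \<in> S" for q
    using that unfolding set_L[symmetric] in_set_conv_nth len by (auto simp: less_Suc_eq_le)
  define t where "t i = (if i \<le> n then L ! i else u)" for i
  have mem: "L ! i \<in> S" if "i \<le> n" for i using that nth_mem[of i L] set_L len by simp
  show ?thesis
  proof
    obtain i where i: "i \<le> n" "L ! i = 0" using ex[OF S(2)] by blast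
    have "i = 0" using lt[of 0 i] i len S(4)[OF mem[of 0]] by (cases i) auto
    then show "t 0 = 0" using i by (simp add: t_def)
    obtain j where j: "j \<le> n" "L ! j = s" using ex[OF S(3)] by blast
    have "j = n" using lt[of j n] j len S(4)[OF mem[of n]] by (cases "j < n") auto
    then show "t n = s" using j by (simp add: t_def)
    show "t (Suc n) = u" by (simp add: t_def)
    show "t i < t (Suc i)" if "i < Suc n" for i
      using that lt[of i "Suc i"] len \<open>t n = s\<close> assms(4) by (cases "i = n") (auto simp: t_def)
    show "(SOME i. i \<le> n \<and> L ! i = q) \<le> n \<and> t (SOME i. i \<le> n \<and> L ! i = q) = q" if "q \<in> J" for q
    proof -
      have "\<exists>i. i \<le> n \<and> L ! i = q" using ex[of q] that by (auto simp: S_def)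
      then have "(SOME i. i \<le> n \<and> L ! i = q) \<le> n \<and> L ! (SOME i. i \<le> n \<and> L ! i = q) = q" by (rule someI_ex)
      then show ?thesis by (simp add: t_def)
    qed
  qed
qed

text \<open>Each \<open>W q - W 0\<close> is a partial sum of the first \<open>n\<close> grid
  increments, while \<open>W u - W s\<close> is the last one; disjoint blocks of independent
  increments are independent.\<close>

lemma increment_indep_finite:
  assumes s: "0 \<le> s" "s < u" and J: "finite J" "J \<subseteq> {0..s}" "\<And>q. q \<in> J \<Longrightarrow> C q \<in> sets borel"
    and B: "B \<in> sets borel"
  shows "prob {\<omega>\<in>space M. (\<forall>q\<in>J. W q \<omega> - W 0 \<omega> \<in> C q) \<and> W u \<omega> - W s \<omega> \<in> B} =
    prob {\<omega>\<in>space M. \<forall>q\<in>J. W q \<omega> - W 0 \<omega> \<in> C q} * prob {\<omega>\<in>space M. W u \<omega> - W s \<omega> \<in> B}"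
proof -
  obtain t :: "nat \<Rightarrow> real" and n k where t: "t 0 = 0" "t n = s" "t (Suc n) = u" "\<And>i. i < Suc n \<Longrightarrow> t i < t (Suc i)"
    and k: "\<And>q. q \<in> J \<Longrightarrow> k q \<le> n \<and> t (k q) = q"
    using time_grid[OF J(1,2) s] by metis
  let ?X = "\<lambda>i \<omega>. W (t (Suc i)) \<omega> - W (t i) \<omega>"
  have "indep_vars (\<lambda>_. borel) ?X {..<Suc n}"
    using W t(1,4) unfolding brownian_motion_def by simp
  then have ind: "indep_var (PiM {..<n} (\<lambda>_. borel)) (\<lambda>\<omega>. restrict (\<lambda>i. ?X i \<omega>) {..<n})
      (PiM {n} (\<lambda>_. borel)) (\<lambda>\<omega>. restrict (\<lambda>i. ?X i \<omega>) {n})"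
    by (rule indep_var_restrict) auto
  define A' where "A' = {f \<in> space (PiM {..<n} (\<lambda>_. borel :: real measure)). \<forall>q\<in>J. (\<Sum>i<k q. f i) \<in> C q}"
  define B' where "B' = {f \<in> space (PiM {n} (\<lambda>_. borel :: real measure)). f n \<in> B}"
  have A': "A' \<in> sets (PiM {..<n} (\<lambda>_. borel))"
    unfolding A'_def
  proof (rule sets.sets_Collect_finite_All[OF _ J(1)])
    fix q assume q: "q \<in> J"
    have "(\<lambda>f. \<Sum>i<k q. f i) \<in> borel_measurable (PiM {..<n} (\<lambda>_. borel :: real measure))"
      using k[OF q] by (intro borel_measurable_sum measurable_component_singleton) auto
    from measurable_sets[OF this J(3)[OF q]]
    show "{f \<in> space (PiM {..<n} (\<lambda>_. borel)). (\<Sum>i<k q. f i) \<in> C q} \<in> sets (PiM {..<n} (\<lambda>_. borel))"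
      by (simp add: vimage_def Int_def conj_commute)
  qed
  have B': "B' \<in> sets (PiM {n} (\<lambda>_. borel))"
  proof -
    have "(\<lambda>f. f n) \<in> borel_measurable (PiM {n} (\<lambda>_. borel :: real measure))"
      by (intro measurable_component_singleton) simp
    from measurable_sets[OF this B] show ?thesis by (simp add: B'_def vimage_def Int_def conj_commute)
  qed
  have tele: "(\<Sum>i<k q. ?X i \<omega>) = W q \<omega> - W 0 \<omega>" if "q \<in> J" for q \<omega>
    using sum_lessThan_telescope[of "\<lambda>i. W (t i) \<omega>" "k q"] k[OF that] t(1) by simp
  have restr: "(\<Sum>i<k q. restrict (\<lambda>i. ?X i \<omega>) {..<n} i) = W q \<omega> - W 0 \<omega>" if "q \<in> J" for q \<omega>
    using k[OF that] tele[OF that, of \<omega>] by (subst sum.cong[OF refl, where h="\<lambda>i. ?X i \<omega>"]) auto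
  have memA: "restrict (\<lambda>i. ?X i \<omega>) {..<n} \<in> A' \<longleftrightarrow> (\<forall>q\<in>J. W q \<omega> - W 0 \<omega> \<in> C q)" for \<omega>
    unfolding A'_def using restr[of _ \<omega>] by (auto simp: space_PiM)
  have memB: "restrict (\<lambda>i. ?X i \<omega>) {n} \<in> B' \<longleftrightarrow> W u \<omega> - W s \<omega> \<in> B" for \<omega>
    unfolding B'_def using t by (simp add: space_PiM)
  show ?thesis
    using indep_varD[OF ind A' B'] by (simp add: vimage_def Int_def memA memB conj_commute)
qed

text \<open>Dynkin's argument: finite-dimensional events form an intersection-stable class that
  contains all generators of the augmented filtration, and independence extends to the generated
  sets.\<close>

lemma increment_indep_past:
  assumes s: "0 \<le> s" "s < u" and A: "A \<in> sets (\<F> s)" and B: "B \<in> sets borel"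
  shows "prob (A \<inter> {\<omega>\<in>space M. W u \<omega> - W s \<omega> \<in> B}) = prob A * prob {\<omega>\<in>space M. W u \<omega> - W s \<omega> \<in> B}"
proof -
  \<comment> \<open>Events are described only up to null sets. This admits the null sets of the
    augmentation, through an impossible condition, and lets \<open>W q\<close> be replaced by
    \<open>W q - W 0\<close>, since \<open>W 0\<close> vanishes only almost surely.\<close>
  define cyl where "cyl = {A \<in> sets M. \<exists>J C. finite J \<and> J \<subseteq> {0..s} \<and> (\<forall>q\<in>J. C q \<in> sets (borel :: real measure)) \<and>
    (AE \<omega> in M. \<omega> \<in> A \<longleftrightarrow> (\<forall>q\<in>J. W q \<omega> - W 0 \<omega> \<in> C q))}"
  define inc where "inc = {{\<omega>\<in>space M. W u \<omega> - W s \<omega> \<in> B} | B. B \<in> sets borel}"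
  have [measurable]: "W u \<in> borel_measurable M" "W s \<in> borel_measurable M" "W 0 \<in> borel_measurable M"
    using s by (auto intro: W_measurable)
  have W0: "AE \<omega> in M. W 0 \<omega> = 0" using W by (simp add: brownian_motion_def)
  have "indep_set cyl inc"
  proof (rule indep_setI)
    show "cyl \<subseteq> events" by (auto simp: cyl_def)
    show "inc \<subseteq> events" by (auto simp: inc_def)
    fix A D assume "A \<in> cyl" "D \<in> inc"
    then obtain J C B where A: "A \<in> events" and J: "finite J" "J \<subseteq> {0..s}" "\<forall>q\<in>J. C q \<in> sets (borel :: real measure)"
      and AE: "AE \<omega> in M. \<omega> \<in> A \<longleftrightarrow> (\<forall>q\<in>J. W q \<omega> - W 0 \<omega> \<in> C q)"
      and D: "D = {\<omega>\<in>space M. W u \<omega> - W s \<omega> \<in> B}" and B: "B \<in> sets borel"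
      unfolding cyl_def inc_def by auto
    have mJ: "{\<omega>\<in>space M. \<forall>q\<in>J. W q \<omega> - W 0 \<omega> \<in> C q} \<in> events"
    proof (rule sets.sets_Collect_finite_All[OF _ J(1)])
      fix q assume q: "q \<in> J"
      then have "(\<lambda>\<omega>. W q \<omega> - W 0 \<omega>) \<in> borel_measurable M" using J(2) by (intro borel_measurable_diff W_measurable) auto
      from measurable_sets[OF this, of "C q"] J(3) q
      show "{\<omega> \<in> space M. W q \<omega> - W 0 \<omega> \<in> C q} \<in> events" by (simp add: vimage_def Int_def conj_commute)
    qed
    have mD: "D \<in> events" unfolding D using B by measurable
    have "prob (A \<inter> D) = prob ({\<omega>\<in>space M. \<forall>q\<in>J. W q \<omega> - W 0 \<omega> \<in> C q} \<inter> D)"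
      using AE A mJ mD AE_space by (intro finite_measure_eq_AE) (auto elim!: eventually_mono)
    also have "{\<omega>\<in>space M. \<forall>q\<in>J. W q \<omega> - W 0 \<omega> \<in> C q} \<inter> D =
        {\<omega>\<in>space M. (\<forall>q\<in>J. W q \<omega> - W 0 \<omega> \<in> C q) \<and> W u \<omega> - W s \<omega> \<in> B}" by (auto simp: D)
    also have "prob \<dots> = prob {\<omega>\<in>space M. \<forall>q\<in>J. W q \<omega> - W 0 \<omega> \<in> C q} * prob D"
      unfolding D using J by (intro increment_indep_finite s B) auto
    also have "prob {\<omega>\<in>space M. \<forall>q\<in>J. W q \<omega> - W 0 \<omega> \<in> C q} = prob A"
    proof (rule finite_measure_eq_AE[OF _ mJ A])
      show "AE \<omega> in M. \<omega> \<in> {\<omega>\<in>space M. \<forall>q\<in>J. W q \<omega> - W 0 \<omega> \<in> C q} \<longleftrightarrow> \<omega> \<in> A"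
        using AE AE_space by eventually_elim auto
    qed
    finally show "prob (A \<inter> D) = prob A * prob D" .
  qed
  moreover have "Int_stable cyl"
  proof (rule Int_stableI)
    fix A A' assume "A \<in> cyl" "A' \<in> cyl"
    then obtain J C J' C' where A: "A \<in> events" "A' \<in> events"
      and J: "finite J" "J \<subseteq> {0..s}" "\<forall>q\<in>J. C q \<in> sets (borel :: real measure)"
      and J': "finite J'" "J' \<subseteq> {0..s}" "\<forall>q\<in>J'. C' q \<in> sets (borel :: real measure)"
      and AE: "AE \<omega> in M. \<omega> \<in> A \<longleftrightarrow> (\<forall>q\<in>J. W q \<omega> - W 0 \<omega> \<in> C q)"
        "AE \<omega> in M. \<omega> \<in> A' \<longleftrightarrow> (\<forall>q\<in>J'. W q \<omega> - W 0 \<omega> \<in> C' q)"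
      unfolding cyl_def by blast
    define C2 where "C2 q = (if q \<in> J then C q else UNIV) \<inter> (if q \<in> J' then C' q else UNIV)" for q
    have "AE \<omega> in M. \<omega> \<in> A \<inter> A' \<longleftrightarrow> (\<forall>q\<in>J \<union> J'. W q \<omega> - W 0 \<omega> \<in> C2 q)"
      using AE by eventually_elim (auto simp: C2_def)
    moreover have "\<forall>q\<in>J \<union> J'. C2 q \<in> sets borel" using J(3) J'(3) by (auto simp: C2_def)
    ultimately show "A \<inter> A' \<in> cyl" unfolding cyl_def using A J(1,2) J'(1,2)
      by (intro CollectI conjI exI[of _ "J \<union> J'"] exI[of _ C2]) auto
  qed
  moreover have "Int_stable inc"
  proof (rule Int_stableI)
    fix D D' assume "D \<in> inc" "D' \<in> inc"
    then obtain B B' where "B \<in> sets borel" "B' \<in> sets borel"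
      "D = {\<omega>\<in>space M. W u \<omega> - W s \<omega> \<in> B}" "D' = {\<omega>\<in>space M. W u \<omega> - W s \<omega> \<in> B'}"
      unfolding inc_def by auto
    then show "D \<inter> D' \<in> inc" unfolding inc_def by (intro CollectI exI[of _ "B \<inter> B'"]) auto
  qed
  ultimately have ind: "indep_set (sigma_sets (space M) cyl) (sigma_sets (space M) inc)"
    by (rule indep_set_sigma_sets)
  have "{W q -` A \<inter> space M | q A. 0 \<le> q \<and> q \<le> s \<and> A \<in> sets borel} \<union> null_sets M \<subseteq> cyl"
  proof safe
    fix q and C :: "real set" assume q: "0 \<le> q" "q \<le> s" and C: "C \<in> sets borel"
    have "AE \<omega> in M. \<omega> \<in> W q -` C \<inter> space M \<longleftrightarrow> (\<forall>q'\<in>{q}. W q' \<omega> - W 0 \<omega> \<in> C)"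
      using W0 AE_space by eventually_elim auto
    then show "W q -` C \<inter> space M \<in> cyl"
      unfolding cyl_def using q C measurable_sets[OF W_measurable[OF q(1)] C]
      by (intro CollectI conjI exI[of _ "{q}"] exI[of _ "\<lambda>_. C"]) auto
  next
    fix N assume N: "N \<in> null_sets M"
    have "AE \<omega> in M. \<omega> \<in> N \<longleftrightarrow> (\<forall>q'\<in>{0}. W q' \<omega> - W 0 \<omega> \<in> {})"
      using AE_not_in[OF N] by eventually_elim auto
    then show "N \<in> cyl"
      unfolding cyl_def using s N
      by (intro CollectI conjI exI[of _ "{0}"] exI[of _ "\<lambda>_. {}"]) auto
  qed
  then have "A \<in> sigma_sets (space M) cyl" using A unfolding sets_\<F> by (rule sigma_sets_mono'[THEN subsetD])
  moreover have "{\<omega>\<in>space M. W u \<omega> - W s \<omega> \<in> B} \<in> sigma_sets (space M) inc"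
    using B by (intro sigma_sets.Basic) (auto simp: inc_def)
  ultimately show ?thesis by (rule indep_setD[OF ind])
qed

lemma exceptional_null_set:
  obtains N where "N \<in> null_sets M" "\<And>\<omega>. \<omega> \<in> space M \<Longrightarrow> \<omega> \<notin> N \<Longrightarrow> W 0 \<omega> = 0 \<and> continuous_on {0..} (\<lambda>t. W t \<omega>)"
proof -
  have "AE \<omega> in M. W 0 \<omega> = 0 \<and> continuous_on {0..} (\<lambda>t. W t \<omega>)"
    using W by (simp add: brownian_motion_def)
  from AE_E3[OF this] obtain N
    where N: "\<And>\<omega>. \<omega> \<in> space M - N \<Longrightarrow> W 0 \<omega> = 0 \<and> continuous_on {0..} (\<lambda>t. W t \<omega>)" "N \<in> null_sets M"
    by blast
  show ?thesis by (rule that[OF N(2)]) (use N(1) in auto)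
qed

text \<open>Setting the paths to 0 on the irregular null set makes them all continuous and start at
  0. Adaptedness survives because the augmentation puts \<open>N\<close> into every \<F> t.\<close>

lemma regular_version:
  obtains N where "N \<in> null_sets M" "\<And>T. 0 < T \<Longrightarrow>
    drifted_brownian_motion M \<F> (\<lambda>s \<omega>. if \<omega> \<in> N then 0 else W s \<omega>) 0 1 T"
    "\<And>\<omega>. \<omega> \<in> space M \<Longrightarrow> \<omega> \<notin> N \<Longrightarrow> W 0 \<omega> = 0 \<and> continuous_on {0..} (\<lambda>t. W t \<omega>)"
proof -
  obtain N where N: "N \<in> null_sets M"
    and reg: "\<And>\<omega>. \<omega> \<in> space M \<Longrightarrow> \<omega> \<notin> N \<Longrightarrow> W 0 \<omega> = 0 \<and> continuous_on {0..} (\<lambda>t. W t \<omega>)"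
    using exceptional_null_set by blast
  let ?V = "\<lambda>s \<omega>. if \<omega> \<in> N then 0 else W s \<omega>"
  have "drifted_brownian_motion M \<F> ?V 0 1 T" if T: "0 < T" for T
  proof -
    interpret filtration "space M" \<F> by (rule filtration_\<F>)
    show ?thesis
    proof unfold_locales
      show "sets (\<F> t) \<subseteq> events" for t by (rule sets_\<F>_le)
      show "?V s \<in> borel_measurable (\<F> s)" if "0 \<le> s" for s
      proof -
        have [measurable]: "N \<in> sets (\<F> s)" using N by (rule null_in_\<F>)
        have [measurable]: "W s \<in> borel_measurable (\<F> s)" using that by (intro W_adapted) auto
        show ?thesis by measurable
      qed
      show "continuous_on {0..T} (\<lambda>s. ?V s \<omega>)" if "\<omega> \<in> space M" for \<omega>
        using reg[OF that] by (cases "\<omega> \<in> N") (auto intro: continuous_on_subset)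
      show "?V 0 \<omega> = 0" if "\<omega> \<in> space M" for \<omega> using reg[OF that] by simp
      fix s u :: real and A B assume s: "0 \<le> s" "s < u" "u \<le> T" and A: "A \<in> sets (\<F> s)" and B: "B \<in> sets (borel :: real measure)"
      have [measurable]: "W u \<in> borel_measurable M" "W s \<in> borel_measurable M"
        using s by (auto intro: W_measurable)
      have [measurable]: "N \<in> events" "A \<in> events" using N A sets_\<F>_le by auto
      have "prob (A \<inter> {\<omega>\<in>space M. ?V u \<omega> - ?V s \<omega> \<in> B}) = prob (A \<inter> {\<omega>\<in>space M. W u \<omega> - W s \<omega> \<in> B})"
      proof (rule finite_measure_eq_AE)
        show "AE \<omega> in M. \<omega> \<in> A \<inter> {\<omega>\<in>space M. ?V u \<omega> - ?V s \<omega> \<in> B} \<longleftrightarrow> \<omega> \<in> A \<inter> {\<omega>\<in>space M. W u \<omega> - W s \<omega> \<in> B}"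
          using AE_not_in[OF N] by eventually_elim auto
      qed (use B in measurable)
      also have "\<dots> = prob A * prob {\<omega>\<in>space M. W u \<omega> - W s \<omega> \<in> B}"
        using s A B by (intro increment_indep_past)
      also have "prob {\<omega>\<in>space M. W u \<omega> - W s \<omega> \<in> B} = measure (gauss 0 (sqrt (u - s))) B"
      proof -
        have "distributed M lborel (\<lambda>\<omega>. W u \<omega> - W s \<omega>) (normal_density 0 (sqrt (u - s)))"
          using W s unfolding brownian_motion_def by simp
        then have "distr M lborel (\<lambda>\<omega>. W u \<omega> - W s \<omega>) = gauss 0 (sqrt (u - s))"
          by (rule distributed_distr_eq_density)
        then have "measure (gauss 0 (sqrt (u - s))) B = measure (distr M lborel (\<lambda>\<omega>. W u \<omega> - W s \<omega>)) B" by simp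
        also have "\<dots> = prob {\<omega>\<in>space M. W u \<omega> - W s \<omega> \<in> B}"
          using B by (subst measure_distr) (auto intro!: arg_cong[where f=prob])
        finally show ?thesis by simp
      qed
      finally show "prob (A \<inter> {\<omega>\<in>space M. ?V u \<omega> - ?V s \<omega> \<in> B}) =
        prob A * measure (gauss (0 * (u - s)) (1 * sqrt (u - s))) B" by simp
    qed (use T in auto)
  qed
  then show ?thesis by (rule that[OF N _ reg])
qed

end

text \<open>The change of measure for a single increment: the weight moves the mean of
  \<open>d\<close> from 0 to \<open>\<sigma> * \<delta>\<close>, and the affine map then gives mean
  \<open>m * \<delta>\<close> and deviation \<open>\<sigma> * sqrt \<delta>\<close>.\<close>

lemma tilted_gauss:
  assumes \<sigma>: "0 < \<sigma>" and \<delta>: "0 < \<delta>" and B[measurable]: "B \<in> sets borel"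
  shows "(\<integral>\<^sup>+d. ennreal (exp (- (1/2) * \<sigma>\<^sup>2 * \<delta> + \<sigma> * d)) * indicator B (m * \<delta> + \<sigma> * (d - \<sigma> * \<delta>)) \<partial>gauss 0 (sqrt \<delta>)) =
    emeasure (gauss (m * \<delta>) (\<sigma> * sqrt \<delta>)) B"
proof -
  let ?t = "m * \<delta> - \<sigma> * \<sigma> * \<delta>"
  have "emeasure (gauss (m * \<delta>) (\<sigma> * sqrt \<delta>)) B =
      (\<integral>\<^sup>+z. ennreal (normal_density (m * \<delta>) (\<sigma> * sqrt \<delta>) z) * indicator B z \<partial>lborel)"
    by (subst emeasure_density) auto
  also have "\<dots> = ennreal \<bar>\<sigma>\<bar> * (\<integral>\<^sup>+x. ennreal (normal_density (m * \<delta>) (\<sigma> * sqrt \<delta>) (?t + \<sigma> * x)) * indicator B (?t + \<sigma> * x) \<partial>lborel)"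
    using \<sigma> by (subst nn_integral_real_affine[where c=\<sigma> and t="?t"]) auto
  also have "\<dots> = (\<integral>\<^sup>+x. ennreal (\<sigma> * normal_density (m * \<delta>) (\<sigma> * sqrt \<delta>) (?t + \<sigma> * x)) * indicator B (?t + \<sigma> * x) \<partial>lborel)"
    using \<sigma> by (subst nn_integral_cmult[symmetric]) (auto simp: ennreal_mult mult.assoc)
  also have "\<dots> = (\<integral>\<^sup>+x. ennreal (normal_density 0 (sqrt \<delta>) x) *
      (ennreal (exp (- (1/2) * \<sigma>\<^sup>2 * \<delta> + \<sigma> * x)) * indicator B (m * \<delta> + \<sigma> * (x - \<sigma> * \<delta>))) \<partial>lborel)"
  proof (rule nn_integral_cong)
    fix x
    have e: "- (?t + \<sigma> * x - m * \<delta>)\<^sup>2 / (2 * (\<sigma> * sqrt \<delta>)\<^sup>2) =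
        - (x - 0)\<^sup>2 / (2 * (sqrt \<delta>)\<^sup>2) + (- (1/2) * \<sigma>\<^sup>2 * \<delta> + \<sigma> * x)"
    proof -
      have "?t + \<sigma> * x - m * \<delta> = \<sigma> * (x - \<sigma> * \<delta>)" by (simp add: algebra_simps)
      then have "- (?t + \<sigma> * x - m * \<delta>)\<^sup>2 / (2 * (\<sigma> * sqrt \<delta>)\<^sup>2) = - (x - \<sigma> * \<delta>)\<^sup>2 / (2 * \<delta>)"
        using \<sigma> \<delta> by (simp add: power_mult_distrib)
      also have "\<dots> = - (x - 0)\<^sup>2 / (2 * (sqrt \<delta>)\<^sup>2) + (- (1/2) * \<sigma>\<^sup>2 * \<delta> + \<sigma> * x)"
        using \<delta> by (simp add: field_simps) (simp add: power2_eq_square algebra_simps)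
      finally show ?thesis .
    qed
    have n: "\<sigma> * (1 / sqrt (2 * pi * (\<sigma> * sqrt \<delta>)\<^sup>2)) = 1 / sqrt (2 * pi * (sqrt \<delta>)\<^sup>2)"
      using \<sigma> \<delta> by (simp add: power_mult_distrib real_sqrt_mult)
    have "\<sigma> * normal_density (m * \<delta>) (\<sigma> * sqrt \<delta>) (?t + \<sigma> * x) =
        \<sigma> * (1 / sqrt (2 * pi * (\<sigma> * sqrt \<delta>)\<^sup>2)) * exp (- (?t + \<sigma> * x - m * \<delta>)\<^sup>2 / (2 * (\<sigma> * sqrt \<delta>)\<^sup>2))"
      by (simp add: normal_density_def)
    also have "\<dots> = normal_density 0 (sqrt \<delta>) x * exp (- (1/2) * \<sigma>\<^sup>2 * \<delta> + \<sigma> * x)"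
      unfolding n e by (simp only: normal_density_def exp_add mult.assoc)
    finally have nd: "\<sigma> * normal_density (m * \<delta>) (\<sigma> * sqrt \<delta>) (?t + \<sigma> * x) = \<dots>" .
    have arg: "?t + \<sigma> * x = m * \<delta> + \<sigma> * (x - \<sigma> * \<delta>)" by (simp add: algebra_simps)
    show "ennreal (\<sigma> * normal_density (m * \<delta>) (\<sigma> * sqrt \<delta>) (?t + \<sigma> * x)) * indicator B (?t + \<sigma> * x) =
      ennreal (normal_density 0 (sqrt \<delta>) x) * (ennreal (exp (- (1/2) * \<sigma>\<^sup>2 * \<delta> + \<sigma> * x)) * indicator B (m * \<delta> + \<sigma> * (x - \<sigma> * \<delta>)))"
      unfolding nd unfolding arg by (simp add: ennreal_mult' mult.assoc)
  qed
  also have "\<dots> = (\<integral>\<^sup>+d. ennreal (exp (- (1/2) * \<sigma>\<^sup>2 * \<delta> + \<sigma> * d)) * indicator B (m * \<delta> + \<sigma> * (d - \<sigma> * \<delta>)) \<partial>gauss 0 (sqrt \<delta>))"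
    by (subst nn_integral_density) auto
  finally show ?thesis by simp
qed

section \<open>Law of the log-state under the new measure\<close>

context wiener_space
begin

text \<open>Unfolds the equality of restricted measures. The density belongs to the same time as the
  event, so the increment law is computed by choosing that time.\<close>

lemma girsanov_emeasure:
  assumes P: "girsanov_measure M W \<sigma> T P" and t: "0 \<le> t" "t \<le> T" and A: "A \<in> sets (\<F> t)"
  shows "emeasure P A = (\<integral>\<^sup>+\<omega>. ennreal (exp (- (1/2) * \<sigma>\<^sup>2 * t + \<sigma> * W t \<omega>)) * indicator A \<omega> \<partial>M)"
proof -
  let ?D = "\<lambda>\<omega>. ennreal (exp (- (1/2) * \<sigma>\<^sup>2 * t + \<sigma> * W t \<omega>))"
  have sets: "sets P = sets M" using P by (simp add: girsanov_measure_def)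
  then have sp: "space P = space M" by (rule sets_eq_imp_space_eq)
  have sub: "subalgebra P (\<F> t)" using subalgebra_\<F>[of t] sets sp by (simp add: subalgebra_def)
  have [measurable]: "W t \<in> borel_measurable (\<F> t)" using t by (intro W_adapted) auto
  have [measurable]: "A \<in> sets (\<F> t)" by (rule A)
  have D: "?D \<in> borel_measurable (\<F> t)" by measurable
  have "emeasure P A = emeasure (restr_to_subalg P (\<F> t)) A"
    by (rule emeasure_restr_to_subalg[OF sub A, symmetric])
  also have "restr_to_subalg P (\<F> t) = density (restr_to_subalg M (\<F> t)) ?D"
    using P t by (simp add: girsanov_measure_def)
  also have "emeasure \<dots> A = (\<integral>\<^sup>+\<omega>. ?D \<omega> * indicator A \<omega> \<partial>restr_to_subalg M (\<F> t))"
    using A D by (intro emeasure_density measurable_in_subalg[OF subalgebra_\<F>])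
      (simp_all add: sets_restr_to_subalg[OF subalgebra_\<F>])
  also have "\<dots> = (\<integral>\<^sup>+\<omega>. ?D \<omega> * indicator A \<omega> \<partial>M)"
    by (rule nn_integral_subalgebra2[OF subalgebra_\<F>]) measurable
  finally show ?thesis .
qed

text \<open>The density at \<open>u\<close> is the density at \<open>s\<close> times a function of
  the increment. The first factor, joined with the event in \<F> s, is frozen; the second is
  integrated out by \<open>tilted_gauss\<close>.\<close>

lemma girsanov_drifted:
  assumes P: "girsanov_measure M W \<sigma> T P" and \<sigma>: "0 < \<sigma>" and T: "0 < T"
  obtains N where "N \<in> null_sets M" "N \<in> null_sets P"
    "drifted_brownian_motion P \<F> (\<lambda>s \<omega>. if \<omega> \<in> N then 0 else m * s + \<sigma> * (W s \<omega> - \<sigma> * s)) m \<sigma> T"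
proof -
  obtain N where N: "N \<in> null_sets M" and drift: "\<And>T. 0 < T \<Longrightarrow>
    drifted_brownian_motion M \<F> (\<lambda>s \<omega>. if \<omega> \<in> N then 0 else W s \<omega>) 0 1 T"
    and reg: "\<And>\<omega>. \<omega> \<in> space M \<Longrightarrow> \<omega> \<notin> N \<Longrightarrow> W 0 \<omega> = 0 \<and> continuous_on {0..} (\<lambda>t. W t \<omega>)"
    using regular_version by blast
  let ?V = "\<lambda>s \<omega>. if \<omega> \<in> N then 0 else W s \<omega>"
  let ?Z = "\<lambda>s \<omega>. if \<omega> \<in> N then 0 else m * s + \<sigma> * (W s \<omega> - \<sigma> * s)"
  interpret V: drifted_brownian_motion M \<F> ?V 0 1 T by (rule drift[OF T])
  have sets: "sets P = sets M" using P by (simp add: girsanov_measure_def)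
  then have sp: "space P = space M" by (rule sets_eq_imp_space_eq)
  \<comment> \<open>\<open>N\<close> belongs to the augmented sets at time 0, where the density is
    available, so it is null for \<open>P\<close> as well.\<close>
  have "emeasure P N = (\<integral>\<^sup>+\<omega>. 0 \<partial>M)"
    unfolding girsanov_emeasure[OF P order_refl less_imp_le[OF T] null_in_\<F>[OF N]]
    using AE_not_in[OF N] by (intro nn_integral_cong_AE) (auto elim!: eventually_mono)
  then have N': "N \<in> null_sets P" using N sets by (auto simp: null_sets_def)
  \<comment> \<open>Total mass 1 is read off at time 0, where the density is 1 almost
    surely.\<close>
  have "emeasure P (space P) = (\<integral>\<^sup>+\<omega>. 1 \<partial>M)"
  proof -
    have "space P \<in> sets (\<F> 0)" using sets.top[of "\<F> 0"] space_\<F>[of 0] sp by simp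
    then have "emeasure P (space P) = (\<integral>\<^sup>+\<omega>. ennreal (exp (- (1/2) * \<sigma>\<^sup>2 * 0 + \<sigma> * W 0 \<omega>)) * indicator (space P) \<omega> \<partial>M)"
      using T by (intro girsanov_emeasure[OF P]) auto
    also have "\<dots> = (\<integral>\<^sup>+\<omega>. 1 \<partial>M)"
    proof (rule nn_integral_cong_AE)
      have "AE \<omega> in M. W 0 \<omega> = 0" using W by (simp add: brownian_motion_def)
      then show "AE \<omega> in M. ennreal (exp (- (1/2) * \<sigma>\<^sup>2 * 0 + \<sigma> * W 0 \<omega>)) * indicator (space P) \<omega> = 1"
        using AE_space by eventually_elim (simp add: sp)
    qed
    finally show ?thesis .
  qed
  then interpret P: prob_space P by (intro prob_spaceI) (simp add: emeasure_space_1)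
  have "drifted_brownian_motion P \<F> ?Z m \<sigma> T"
  proof -
    interpret filtration "space P" \<F> using filtration_\<F> sp by simp
    have adapted: "?Z s \<in> borel_measurable (\<F> t)" if "0 \<le> s" "s \<le> t" for s t
    proof -
      have [measurable]: "N \<in> sets (\<F> t)" using N by (rule null_in_\<F>)
      have [measurable]: "W s \<in> borel_measurable (\<F> t)" using that by (rule W_adapted)
      show ?thesis by measurable
    qed
    show ?thesis
    proof unfold_locales
      show "sets (\<F> t) \<subseteq> P.events" for t using sets_\<F>_le sets by simp
      show "?Z s \<in> borel_measurable (\<F> s)" if "0 \<le> s" for s using that by (intro adapted) auto
      show "continuous_on {0..T} (\<lambda>s. ?Z s \<omega>)" if "\<omega> \<in> space P" for \<omega>
      proof (cases "\<omega> \<in> N")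
        case False
        then have "continuous_on {0..T} (\<lambda>s. W s \<omega>)"
          using reg[of \<omega>] that sp by (auto intro: continuous_on_subset)
        then show ?thesis using False by (auto intro!: continuous_intros)
      qed simp
      show "?Z 0 \<omega> = 0" if "\<omega> \<in> space P" for \<omega> using reg[of \<omega>] that sp by simp
      fix s u :: real and A B assume s: "0 \<le> s" "s < u" "u \<le> T" and A: "A \<in> sets (\<F> s)" and B[measurable]: "B \<in> sets (borel :: real measure)"
      let ?\<delta> = "u - s"
      let ?E = "A \<inter> {\<omega>\<in>space P. ?Z u \<omega> - ?Z s \<omega> \<in> B}"
      have \<delta>: "0 < ?\<delta>" using s by simp
      have E: "?E \<in> sets (\<F> u)"
      proof -
        have [measurable]: "?Z u \<in> borel_measurable (\<F> u)" "?Z s \<in> borel_measurable (\<F> u)"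
          using s by (auto intro!: adapted)
        have "A \<in> sets (\<F> u)" using A sets_F_mono[of s u] s by auto
        moreover have "{\<omega>\<in>space (\<F> u). ?Z u \<omega> - ?Z s \<omega> \<in> B} \<in> sets (\<F> u)" by measurable
        ultimately show ?thesis unfolding space_\<F> sp by (rule sets.Int)
      qed
      define Y where "Y \<omega> = indicator A \<omega> * exp (- (1/2) * \<sigma>\<^sup>2 * s + \<sigma> * ?V s \<omega>)" for \<omega>
      define H where "H = (\<lambda>(y, d). ennreal y * (ennreal (exp (- (1/2) * \<sigma>\<^sup>2 * ?\<delta> + \<sigma> * d)) * indicator B (m * ?\<delta> + \<sigma> * (d - \<sigma> * ?\<delta>))))"
      have Y: "Y \<in> borel_measurable (\<F> s)"
      proof -
        have [measurable]: "A \<in> sets (\<F> s)" by (rule A)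
        have [measurable]: "?V s \<in> borel_measurable (\<F> s)" using s by (intro V.Z_adapted) auto
        show ?thesis unfolding Y_def by measurable
      qed
      have [measurable]: "Y \<in> borel_measurable M" using Y by (rule V.measurable_F_imp)
      have [measurable]: "H \<in> borel_measurable (borel \<Otimes>\<^sub>M borel)" unfolding H_def by measurable
      have "emeasure P ?E = (\<integral>\<^sup>+\<omega>. ennreal (exp (- (1/2) * \<sigma>\<^sup>2 * u + \<sigma> * W u \<omega>)) * indicator ?E \<omega> \<partial>M)"
        using s E by (intro girsanov_emeasure[OF P]) auto
      also have "\<dots> = (\<integral>\<^sup>+\<omega>. H (Y \<omega>, ?V u \<omega> - ?V s \<omega>) \<partial>M)"
      proof (rule nn_integral_cong_AE)
        show "AE \<omega> in M. ennreal (exp (- (1/2) * \<sigma>\<^sup>2 * u + \<sigma> * W u \<omega>)) * indicator ?E \<omega> = H (Y \<omega>, ?V u \<omega> - ?V s \<omega>)"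
          using AE_not_in[OF N] AE_space
        proof eventually_elim
          case (elim \<omega>)
          have ex: "exp (- (1/2) * \<sigma>\<^sup>2 * s + \<sigma> * W s \<omega>) * exp (- (1/2) * \<sigma>\<^sup>2 * ?\<delta> + \<sigma> * (W u \<omega> - W s \<omega>)) =
              exp (- (1/2) * \<sigma>\<^sup>2 * u + \<sigma> * W u \<omega>)"
            by (simp add: exp_add[symmetric] field_simps)
          have arg: "?Z u \<omega> - ?Z s \<omega> = m * ?\<delta> + \<sigma> * ((W u \<omega> - W s \<omega>) - \<sigma> * ?\<delta>)"
            using elim by (simp add: algebra_simps)
          have mem: "indicator ?E \<omega> = (indicator A \<omega> * indicator B (m * ?\<delta> + \<sigma> * ((W u \<omega> - W s \<omega>) - \<sigma> * ?\<delta>)) :: ennreal)"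
            unfolding arg[symmetric] using elim sp by (auto simp: indicator_def)
          show ?case
            unfolding mem H_def Y_def ex[symmetric] using elim
            by (auto simp: indicator_def ennreal_mult)
        qed
      qed
      also have "\<dots> = (\<integral>\<^sup>+\<omega>. (\<integral>\<^sup>+d. H (Y \<omega>, d) \<partial>V.law ?\<delta>) \<partial>M)"
        using s Y by (intro V.nn_integral_increment) auto
      also have "\<dots> = (\<integral>\<^sup>+\<omega>. ennreal (Y \<omega>) * emeasure (gauss (m * ?\<delta>) (\<sigma> * sqrt ?\<delta>)) B \<partial>M)"
      proof (rule nn_integral_cong)
        fix \<omega>
        show "(\<integral>\<^sup>+d. H (Y \<omega>, d) \<partial>V.law ?\<delta>) = ennreal (Y \<omega>) * emeasure (gauss (m * ?\<delta>) (\<sigma> * sqrt ?\<delta>)) B"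
          unfolding tilted_gauss[OF \<sigma> \<delta> B, symmetric] H_def
          by (simp add: nn_integral_cmult)
      qed
      also have "\<dots> = (\<integral>\<^sup>+\<omega>. ennreal (Y \<omega>) \<partial>M) * emeasure (gauss (m * ?\<delta>) (\<sigma> * sqrt ?\<delta>)) B"
        by (rule nn_integral_multc) measurable
      also have "(\<integral>\<^sup>+\<omega>. ennreal (Y \<omega>) \<partial>M) = emeasure P A"
      proof -
        have "emeasure P A = (\<integral>\<^sup>+\<omega>. ennreal (exp (- (1/2) * \<sigma>\<^sup>2 * s + \<sigma> * W s \<omega>)) * indicator A \<omega> \<partial>M)"
          using s A by (intro girsanov_emeasure[OF P]) auto
        also have "\<dots> = (\<integral>\<^sup>+\<omega>. ennreal (Y \<omega>) \<partial>M)"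
          using AE_not_in[OF N] by (intro nn_integral_cong_AE) (auto elim!: eventually_mono simp: Y_def indicator_def)
        finally show ?thesis by simp
      qed
      finally show "P.prob ?E = P.prob A * measure (gauss (m * (u - s)) (\<sigma> * sqrt (u - s))) B"
        by (simp add: measure_def enn2real_mult)
    qed (use T \<sigma> in auto)
  qed
  then show ?thesis by (rule that[OF N N'])
qed

end

section \<open>Marginal revenue\<close>

text \<open>Concavity gives the weak tangent bound at the midpoint of \<open>x\<close> and
  \<open>z\<close>; strict concavity puts the average of \<open>R x\<close> and \<open>R z\<close>
  strictly below the value there, which makes the bound at \<open>z\<close> strict.\<close>

lemma concave_secant_bounds:
  assumes R: "strictly_concave_on {0..} R" and diff: "\<And>C. C > 0 \<Longrightarrow> R differentiable at C"
    and x: "0 < x" "0 \<le> z" "z \<noteq> x"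
  shows "R z < R x + deriv R x * (z - (x::real))"
proof -
  have tangent: "R w \<le> R x + deriv R x * (w - x)" if "0 \<le> w" for w
  proof -
    have "convex_on {0..} (\<lambda>x. - R x)"
    proof (rule convex_onI)
      fix t u w :: real assume tuw: "0 < t" "t < 1" "u \<in> {0..}" "w \<in> {0..}"
      show "- R ((1 - t) *\<^sub>R u + t *\<^sub>R w) \<le> (1 - t) * - R u + t * - R w"
      proof (cases "u = w")
        case True
        then show ?thesis by (simp add: algebra_simps)
      next
        case False
        then have "(1 - t) * R u + t * R w < R ((1 - t) * u + t * w)"
          using R tuw unfolding strictly_concave_on_def by blast
        then show ?thesis by simp
      qed
    qed simp
    moreover have "x \<in> interior {0..}"
      using x by (intro interiorI[of "{0<..}"]) auto
    moreover have "((\<lambda>x. - R x) has_real_derivative - deriv R x) (at x within {0..})"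
      using diff[OF x(1)] by (intro DERIV_minus DERIV_subset[OF DERIV_deriv_iff_real_differentiable[THEN iffD2]]) auto
    ultimately have "- deriv R x * (w - x) \<le> - R w - - R x"
      using that by (intro convex_on_imp_above_tangent[of "{0..}"]) auto
    then show ?thesis by simp
  qed
  have "(1 - 1/2) * R x + 1/2 * R z < R ((1 - 1/2) * x + 1/2 * z)"
    using R[unfolded strictly_concave_on_def, THEN conjunct2, rule_format, of x z "1/2"] x by simp
  moreover have "R ((1 - 1/2) * x + 1/2 * z) \<le> R x + deriv R x * (((1 - 1/2) * x + 1/2 * z) - x)"
    using x by (intro tangent) auto
  ultimately show ?thesis by (simp add: field_simps)
qed

text \<open>Adding the strict tangent bounds at two points gives strict decrease, and decrease
  towards the limit 0 gives positivity. The tangent at \<open>w\<close>, evaluated at 0, yields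
  \<open>deriv R w * w \<le> R w\<close>, the source of the growth bound near 0. The inverse comes
  from the intermediate value theorem and the two limits.\<close>

lemma marginal_revenue:
  assumes R: "R \<in> {0..} \<rightarrow> {0..}" "mono_on {0..} R" "strictly_concave_on {0..} R"
    and diff: "\<And>C. C > 0 \<Longrightarrow> R differentiable at C" "\<And>C. C > 0 \<Longrightarrow> deriv R differentiable at C"
    and lim: "filterlim (deriv R) at_top (at_right 0)" "(deriv R \<longlongrightarrow> 0) at_top"
  shows marginal_decreasing: "\<And>x y. 0 < x \<Longrightarrow> x < y \<Longrightarrow> deriv R y < deriv R (x::real)"
    and marginal_positive: "\<And>x. 0 < x \<Longrightarrow> 0 < deriv R x"
    and marginal_continuous: "continuous_on {0<..} (deriv R)"
    and marginal_le: "\<And>x. 0 < x \<Longrightarrow> deriv R x \<le> R 1 * (1 + 1 / x)"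
    and marginal_inverse_correct:
      "\<And>c. 0 < c \<Longrightarrow> 0 < marginal_inverse R c \<and> deriv R (marginal_inverse R c) = c"
proof -
  note secant = concave_secant_bounds[OF R(3) diff(1)]
  show dec: "deriv R y < deriv R x" if "0 < x" "x < y" for x y
  proof -
    have "R y < R x + deriv R x * (y - x)" "R x < R y + deriv R y * (x - y)"
      using secant[of x y] secant[of y x] that by auto
    then have "(deriv R y - deriv R x) * (y - x) < 0" by (simp add: algebra_simps)
    then show ?thesis using that by (simp add: mult_less_0_iff)
  qed
  show pos: "0 < deriv R x" if "0 < x" for x
  proof -
    have "0 \<le> deriv R (x + 1)"
    proof (rule tendsto_upperbound[OF lim(2)])
      show "\<forall>\<^sub>F z in at_top. deriv R z \<le> deriv R (x + 1)"
        using eventually_gt_at_top[of "x + 1"] by eventually_elim (use dec[of "x + 1"] that in force)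
    qed simp
    then show ?thesis using dec[of x "x + 1"] that by simp
  qed
  show cont: "continuous_on {0<..} (deriv R)"
    using diff(2) by (intro continuous_at_imp_continuous_on) (auto intro: differentiable_imp_continuous_within)
  show "deriv R x \<le> R 1 * (1 + 1 / x)" if x: "0 < x" for x
  proof -
    have R1: "0 \<le> R 1" using R(1) by auto
    have le: "deriv R w * w \<le> R w" if "0 < w" for w
    proof -
      have "0 \<le> R 0" using R(1) by auto
      then show ?thesis using secant[of w 0] that by simp
    qed
    show ?thesis
    proof (cases "x \<le> 1")
      case True
      then have "R x \<le> R 1" using R(2) x by (auto simp: mono_on_def)
      then have "deriv R x \<le> R 1 / x" using le[OF x] x by (simp add: field_simps)
      then show ?thesis using R1 by (simp add: algebra_simps)
    next
      case False
      then have "deriv R x \<le> R 1" using dec[of 1 x] le[of 1] by simp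
      then show ?thesis using R1 x by (simp add: algebra_simps add_increasing2)
    qed
  qed
  show "0 < marginal_inverse R c \<and> deriv R (marginal_inverse R c) = c" if c: "0 < c" for c
  proof -
    have "\<forall>\<^sub>F x in at_right 0. c \<le> deriv R x" using lim(1) by (simp add: filterlim_at_top)
    then obtain d where d: "0 < d" "\<And>x. 0 < x \<Longrightarrow> x < d \<Longrightarrow> c \<le> deriv R x"
      unfolding eventually_at_right_field by auto
    define x1 where "x1 = d / 2"
    have x1: "0 < x1" "c \<le> deriv R x1" using d by (auto simp: x1_def)
    have "\<forall>\<^sub>F x in at_top. x1 < x \<and> deriv R x < c"
      using lim(2) c by (intro eventually_conj eventually_gt_at_top order_tendstoD(2)) auto
    from eventually_happens'[OF trivial_limit_at_top_linorder this]
    obtain x2 where x2: "x1 < x2" "deriv R x2 < c" by blast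
    have "\<exists>x\<ge>x1. x \<le> x2 \<and> deriv R x = c"
      using x1 x2 by (intro IVT2' continuous_on_subset[OF cont]) auto
    then obtain x where "x1 \<le> x" "deriv R x = c" by blast
    then have x: "0 < x" "deriv R x = c" using x1 by auto
    have "inj_on (deriv R) {0<..}"
      using dec by (intro linorder_inj_onI) force+
    then have "marginal_inverse R c = x"
      unfolding marginal_inverse_def using x by (intro the_inv_into_f_eq) auto
    then show ?thesis using x by simp
  qed
qed

text \<open>Needed because the payoff is written with the original \<open>C0\<close>, whose paths
  may be irregular on the null set \<open>N\<close>; completeness makes any behaviour there
  measurable.\<close>

lemma (in complete_measure) measurable_modification:
  fixes f g :: "'a \<Rightarrow> real"
  assumes f: "f \<in> borel_measurable M" and N: "N \<in> null_sets M"
    and eq: "\<And>\<omega>. \<omega> \<in> space M \<Longrightarrow> \<omega> \<notin> N \<Longrightarrow> g \<omega> = f \<omega>"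
  shows "g \<in> borel_measurable M"
proof (rule measurableI)
  fix A :: "real set" assume A: "A \<in> sets borel"
  have split: "g -` A \<inter> space M = (f -` A \<inter> space M - N) \<union> (g -` A \<inter> space M \<inter> N)" using eq by auto
  have "g -` A \<inter> space M \<inter> N \<in> sets M" using N by (intro complete[of _ N]) auto
  moreover have "f -` A \<inter> space M - N \<in> sets M" using measurable_sets[OF f A] N by auto
  ultimately show "g -` A \<inter> space M \<in> sets M" by (subst split) (intro sets.Un)
qed simp

lemma deriv_affine_eq:
  assumes G: "\<And>C. C \<ge> 0 \<Longrightarrow> G C = G0 + k * (C::real)" and x: "0 < x"
  shows "deriv G x = k"
proof (rule DERIV_imp_deriv)
  have "((\<lambda>C. G0 + k * C) has_real_derivative k) (at x)" by (auto intro!: derivative_eq_intros)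
  then show "(G has_real_derivative k) (at x)"
  proof (rule DERIV_cong_ev[THEN iffD1, rotated -1, OF _ refl _ refl])
    show "\<forall>\<^sub>F C in nhds x. G0 + k * C = G C"
      using eventually_nhds_in_open[of "{0<..}" x] x by (auto elim!: eventually_mono simp: G)
  qed
qed

section \<open>The free boundaries\<close>

locale stopping_game_boundaries = stopping_game P F Z m \<kappa> T f r a b K v
  for P :: "'a measure" and F Z m \<kappa> T f r a b K v +
  fixes yp :: "real \<Rightarrow> real" and ym :: "real \<Rightarrow> ereal"
  assumes boundaries: "free_boundaries T a b (\<lambda>t. v (T - t)) yp ym"
begin

lemma boundary_order: "0 \<le> t \<Longrightarrow> t < T \<Longrightarrow> 0 \<le> yp t" "0 \<le> t \<Longrightarrow> t < T \<Longrightarrow> ereal (yp t) < ym t"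
  using boundaries by (auto simp: free_boundaries_def)

lemma value_eq_upper_iff:
  assumes "0 \<le> t" "t < T" "0 < y" shows "v (T - t) y = b \<longleftrightarrow> y \<le> yp t"
proof -
  have "{y. 0 < y \<and> v (T - t) y = b} = {0<..yp t}"
    using boundaries assms by (auto simp: free_boundaries_def)
  then have "y \<in> {y. 0 < y \<and> v (T - t) y = b} \<longleftrightarrow> y \<in> {0<..yp t}" by (simp only:)
  then show ?thesis using assms by simp
qed

lemma value_eq_lower_iff:
  assumes "0 \<le> t" "t < T" "0 < y" shows "v (T - t) y = a \<longleftrightarrow> ym t \<le> ereal y"
proof -
  have "{y. 0 < y \<and> v (T - t) y = a} = {y. ym t \<le> ereal y}"
    using boundaries assms by (simp add: free_boundaries_def)
  then have "y \<in> {y. 0 < y \<and> v (T - t) y = a} \<longleftrightarrow> y \<in> {y. ym t \<le> ereal y}" by (simp only:)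
  then show ?thesis using assms by simp
qed

lemma yp_antimono: "antimono_on {0..<T} yp"
proof (rule monotone_onI)
  fix s t assume st: "s \<in> {0..<T}" "t \<in> {0..<T}" "s \<le> t"
  show "yp t \<le> yp s"
  proof (cases "0 < yp t")
    case True
    then have "v (T - t) (yp t) = b" using st by (subst value_eq_upper_iff) auto
    then have "b \<le> v (T - s) (yp t)" using value_mono_horizon[of "T - t" "T - s" "yp t"] st True by simp
    then have "v (T - s) (yp t) = b" using value_le_upper[of "T - s" "yp t"] st True by simp
    then show ?thesis using value_eq_upper_iff[of s "yp t"] st True by simp
  next
    case False
    then show ?thesis using boundary_order(1)[of s] st by simp
  qed
qed

text \<open>Value \<open>a\<close> at the longer horizon forces value \<open>a\<close> at the
  shorter one. Real test points above \<open>ym s\<close> are used because \<open>ym\<close> is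
  extended real; for infinite \<open>ym s\<close> there is nothing to show.\<close>

lemma ym_antimono: "antimono_on {0..<T} ym"
proof (rule monotone_onI)
  fix s t assume st: "s \<in> {0..<T}" "t \<in> {0..<T}" "s \<le> t"
  show "ym t \<le> ym s"
  proof (rule dense_ge)
    fix e assume e: "ym s < e"
    then obtain y where y: "ym s < ereal y" "ereal y < e" using ereal_dense2 by blast
    have y0: "0 < y" using boundary_order[of s] y st by (cases "ym s") auto
    have "v (T - s) y = a" using st y y0 by (subst value_eq_lower_iff) auto
    then have "v (T - t) y \<le> a" using value_mono_horizon[of "T - t" "T - s" y] st y0 by simp
    then have "v (T - t) y = a" using value_ge_lower[of "T - t" y] st y0 by simp
    then show "ym t \<le> e" using value_eq_lower_iff[of t y] st y0 y by auto
  qed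
qed

text \<open>Monotonicity gives one half. For the other, \<open>v < b\<close> at a level
  \<open>c\<close> persists for slightly longer horizons by the Lipschitz bound, so \<open>c\<close>
  stays above the boundary; \<open>?d\<close> is the time in which the gap to \<open>b\<close> could
  close.\<close>

lemma yp_left_continuous:
  assumes t: "0 < t" "t < T"
  shows "continuous (at_left t) yp"
  unfolding continuous_within
proof (rule order_tendstoI)
  fix c assume c: "c < yp t"
  show "\<forall>\<^sub>F s in at_left t. c < yp s"
    unfolding eventually_at_left_field
  proof (intro exI[of _ 0] conjI allI impI t)
    fix s assume "0 < s" "s < t"
    then show "c < yp s" using monotone_onD[OF yp_antimono, of s t] t c by simp
  qed
next
  fix c assume c: "yp t < c"
  have c0: "0 < c" using boundary_order(1)[of t] t c by simp
  have less: "v (T - t) c < b" using value_eq_upper_iff[of t c] value_le_upper[of "T - t" c] t c c0 by force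
  obtain C where C: "0 < C" "\<And>h h'. 0 \<le> h \<Longrightarrow> h \<le> h' \<Longrightarrow> h' \<le> T \<Longrightarrow> v h' c \<le> v h c + C * (h' - h)"
    using value_horizon_lipschitz[OF c0] by blast
  let ?d = "(b - v (T - t) c) / C"
  show "\<forall>\<^sub>F s in at_left t. yp s < c"
    unfolding eventually_at_left_field
  proof (intro exI[of _ "max 0 (t - ?d)"] conjI allI impI)
    show "max 0 (t - ?d) < t" using t less C by simp
    fix s assume s: "max 0 (t - ?d) < s" "s < t"
    have "v (T - s) c \<le> v (T - t) c + C * (t - s)" using C(2)[of "T - t" "T - s"] s t by simp
    also have "\<dots> < b" using s C by (simp add: field_simps)
    finally show "yp s < c" using value_eq_upper_iff[of s c] s t c0 by force
  qed
qed

text \<open>Dual to the other boundary: \<open>v > a\<close> at a real level \<open>y\<close>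
  between \<open>c\<close> and \<open>ym t\<close> persists for slightly shorter horizons. The
  maximum with 0 keeps \<open>y\<close> positive.\<close>

lemma ym_right_continuous:
  assumes t: "0 \<le> t" "t < T"
  shows "continuous (at_right t) ym"
  unfolding continuous_within
proof (rule order_tendstoI)
  fix c assume c: "c < ym t"
  have "0 < ym t" using boundary_order[of t] t by (intro le_less_trans[of 0 "ereal (yp t)"]) auto
  then have "max c 0 < ym t" using c by simp
  then obtain y where y: "max c 0 < ereal y" "ereal y < ym t" using ereal_dense2 by blast
  have y0: "0 < y" using y by simp
  have less: "a < v (T - t) y" using value_eq_lower_iff[of t y] value_ge_lower[of "T - t" y] t y y0 by force
  obtain C where C: "0 < C" "\<And>h h'. 0 \<le> h \<Longrightarrow> h \<le> h' \<Longrightarrow> h' \<le> T \<Longrightarrow> v h' y \<le> v h y + C * (h' - h)"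
    using value_horizon_lipschitz[OF y0] by blast
  let ?d = "(v (T - t) y - a) / C"
  show "\<forall>\<^sub>F s in at_right t. c < ym s"
    unfolding eventually_at_right_field
  proof (intro exI[of _ "min T (t + ?d)"] conjI allI impI)
    show "t < min T (t + ?d)" using t less C by simp
    fix s assume s: "t < s" "s < min T (t + ?d)"
    have "v (T - t) y \<le> v (T - s) y + C * (s - t)" using C(2)[of "T - s" "T - t"] s t by simp
    moreover have "C * (s - t) < v (T - t) y - a" using s C by (simp add: field_simps)
    ultimately have "v (T - s) y \<noteq> a" by simp
    then have "ereal y < ym s" using value_eq_lower_iff[of s y] s t y0 by (simp add: not_le)
    then show "c < ym s" using y by (auto intro: less_trans)
  qed
next
  fix c assume c: "ym t < c"
  show "\<forall>\<^sub>F s in at_right t. ym s < c"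
    unfolding eventually_at_right_field
  proof (intro exI[of _ T] conjI allI impI t)
    fix s assume "t < s" "s < T"
    then show "ym s < c" using monotone_onD[OF ym_antimono, of t s] t c by (auto intro: le_less_trans)
  qed
qed

lemma yp_bounds:
  assumes t: "0 \<le> t" "t < T" and x: "0 < x" "f x = r * b"
  shows "0 < yp t" "yp t < x"
proof -
  obtain y where "0 < y" "v (T - t) y = b" using exists_value_eq_upper[of "T - t"] t by auto
  then show "0 < yp t" using value_eq_upper_iff[of t y] t by simp
  have "v (T - t) x < b" using t x by (intro value_less_upper) auto
  then show "yp t < x" using value_eq_upper_iff[of t x] t x by force
qed

lemma ym_bounds:
  assumes t: "0 \<le> t" "t < T" and x: "0 < x" "f x = r * a"
  shows "ereal x < ym t" "ym t < \<infinity>"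
proof -
  obtain y where "0 < y" "v (T - t) y = a" using exists_value_eq_lower[of "T - t"] t by auto
  then have "ym t \<le> ereal y" using value_eq_lower_iff[of t y] t by simp
  then show "ym t < \<infinity>" by (rule le_less_trans) simp
  have "a < v (T - t) x" using t x by (intro value_greater_lower) auto
  then show "ereal x < ym t" using value_eq_lower_iff[of t x] t x by force
qed

text \<open>At any fixed level the value tends to \<open>a < b\<close> as the horizon shrinks, so
  every positive level eventually leaves the set where the value is \<open>b\<close>.\<close>

lemma yp_at_maturity: "(yp \<longlongrightarrow> 0) (at_left T)"
proof (rule order_tendstoI)
  fix c :: real assume c: "c < 0"
  show "\<forall>\<^sub>F s in at_left T. c < yp s"
    unfolding eventually_at_left_field
  proof (intro exI[of _ 0] conjI allI impI T_pos)
    fix s assume "0 < s" "s < T"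
    then show "c < yp s" using boundary_order(1)[of s] c by simp
  qed
next
  fix c :: real assume c: "0 < c"
  obtain C where C: "0 < C" "\<And>h. 0 < h \<Longrightarrow> h \<le> T \<Longrightarrow> v h c \<le> a + C * h"
    using value_near_maturity[OF c] by blast
  show "\<forall>\<^sub>F s in at_left T. yp s < c"
    unfolding eventually_at_left_field
  proof (intro exI[of _ "max 0 (T - (b - a) / C)"] conjI allI impI)
    show "max 0 (T - (b - a) / C) < T" using T_pos a_less_b C by simp
    fix s assume s: "max 0 (T - (b - a) / C) < s" "s < T"
    have "v (T - s) c \<le> a + C * (T - s)" using C(2)[of "T - s"] s by simp
    also have "\<dots> < b" using s C by (simp add: field_simps)
    finally show "yp s < c" using value_eq_upper_iff[of s c] s c by force
  qed
qed

lemma ym_at_maturity: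
  assumes x: "0 < x" "f x = r * a"
  shows "(ym \<longlongrightarrow> ereal x) (at_left T)"
proof (rule order_tendstoI)
  fix c assume c: "c < ereal x"
  show "\<forall>\<^sub>F s in at_left T. c < ym s"
    unfolding eventually_at_left_field
  proof (intro exI[of _ 0] conjI allI impI T_pos)
    fix s assume "0 < s" "s < T"
    then show "c < ym s" using ym_bounds(1)[OF _ _ x, of s] c by (auto intro: less_trans)
  qed
next
  fix c assume "ereal x < c"
  then obtain y where y: "ereal x < ereal y" "ereal y < c" using ereal_dense2 by blast
  have y0: "x < y" using y by simp
  obtain \<delta> where \<delta>: "0 < \<delta>" "\<And>h. 0 < h \<Longrightarrow> h \<le> T \<Longrightarrow> h \<le> \<delta> \<Longrightarrow> v h y = a"
    using value_eq_lower_near_maturity[OF x y0] by blast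
  show "\<forall>\<^sub>F s in at_left T. ym s < c"
    unfolding eventually_at_left_field
  proof (intro exI[of _ "max 0 (T - \<delta>)"] conjI allI impI)
    show "max 0 (T - \<delta>) < T" using T_pos \<delta> by simp
    fix s assume s: "max 0 (T - \<delta>) < s" "s < T"
    then have "v (T - s) y = a" by (intro \<delta>(2)) auto
    then have "ym s \<le> ereal y" using value_eq_lower_iff[of s y] s x y0 by simp
    then show "ym s < c" using y by (auto intro: le_less_trans)
  qed
qed

end

theorem proposition3p10:
  fixes M P :: "'a measure"
    and W :: "real \<Rightarrow> 'a \<Rightarrow> real"
    and T \<mu>C \<sigma>C fC \<mu>F cp cm G0 :: real
    and R G :: "real \<Rightarrow> real"
    and v :: "real \<Rightarrow> real \<Rightarrow> real"
    and yp :: "real \<Rightarrow> real"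
    and ym :: "real \<Rightarrow> ereal"
  assumes constants: "T > 0" "\<mu>C > 0" "\<sigma>C > 0" "fC > 0" "\<mu>F > 0" "cm > 0" "cp > cm"
    and M: "prob_space M" "complete_measure M"
    and W: "brownian_motion M W"
    and P: "girsanov_measure M W \<sigma>C T P"
    and R: "R \<in> {0..} \<rightarrow> {0..}"
      "R \<in> borel_measurable (restrict_space borel {0..})"
      "mono_on {0..} R"
      "strictly_concave_on {0..} R"
      "R 0 = 0"
    and R_C2: "\<And>C. C > 0 \<Longrightarrow> R differentiable at C"
      "\<And>C. C > 0 \<Longrightarrow> deriv R differentiable at C"
      "continuous_on {0<..} (deriv (deriv R))"
    and R_lim: "filterlim (deriv R) at_top (at_right 0)"
      "(deriv R \<longlongrightarrow> 0) at_top"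
    and G: "G0 \<ge> 0" "\<And>C. C \<ge> 0 \<Longrightarrow> G C = G0 + cm / fC * C"
    and v: "is_game_value
        (stopping_times_upto M (augmented_filtration M W))
        (game_payoff P (C0 \<mu>C \<sigma>C W) (deriv R) (deriv G) (\<mu>C + \<mu>F) cp cm fC T)
        T v"
    and boundaries: "free_boundaries T (cm / fC) (cp / fC) v yp ym"
  shows "(antimono_on {0..<T} yp \<and> antimono_on {0..<T} ym) \<and>
    ((\<forall>t\<in>{0<..<T}. continuous (at_left t) yp) \<and> (\<forall>t\<in>{0..<T}. continuous (at_right t) ym)) \<and>
    (\<forall>t\<in>{0..<T}. 0 < yp t \<and> yp t < marginal_inverse R ((\<mu>C + \<mu>F) * cp / fC)) \<and>
    ((yp \<longlongrightarrow> 0) (at_left T)) \<and>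
    (\<forall>t\<in>{0..<T}. 0 < marginal_inverse R ((\<mu>C + \<mu>F) * cm / fC) \<and>
      ereal (marginal_inverse R ((\<mu>C + \<mu>F) * cm / fC)) < ym t \<and> ym t < \<infinity>) \<and>
    ((ym \<longlongrightarrow> ereal (marginal_inverse R ((\<mu>C + \<mu>F) * cm / fC))) (at_left T))"
proof -
  interpret M: prob_space M by (rule M(1))
  interpret CM: complete_measure M by (rule M(2))
  interpret wiener_space M W by unfold_locales (rule W)
  note marginal = marginal_revenue[OF R(1,3,4) R_C2(1,2) R_lim]
  define r where "r = \<mu>C + \<mu>F"
  define a where "a = cm / fC"
  define b where "b = cp / fC"
  \<comment> \<open>The drift of \<open>ln C0\<close> under \<open>P\<close>, where
    \<open>W_tilde\<close> is a Brownian motion.\<close>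
  define m where "m = - \<mu>C + 1/2 * \<sigma>C\<^sup>2"
  define V where "V h = v (T - h)" for h
  have r: "0 < r" and ab: "0 < a" "a < b" using constants by (auto simp: r_def a_def b_def divide_strict_right_mono)
  have R1: "0 \<le> R 1" using R(1) by auto
  let ?Z0 = "\<lambda>N s \<omega>. if \<omega> \<in> N then 0 else m * s + \<sigma>C * (W s \<omega> - \<sigma>C * s)"
  obtain N where N: "N \<in> null_sets M" "N \<in> null_sets P"
    and drift: "drifted_brownian_motion P \<F> (?Z0 N) m \<sigma>C T"
    using girsanov_drifted[OF P constants(3,1), of m] by blast
  let ?Z = "?Z0 N"
  interpret drifted_brownian_motion P \<F> ?Z m \<sigma>C T by (rule drift)
  interpret stopping_game_setup P \<F> ?Z m \<sigma>C T "deriv R" r a b "R 1"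
    by unfold_locales (simp_all add: r ab R1 marginal(1-4) R_lim)
  have sets: "sets P = sets M" using P by (simp add: girsanov_measure_def)
  then have sp: "space P = space M" by (rule sets_eq_imp_space_eq)
  have ST: "stopping_times_upto M \<F> h = ST h" for h
    by (simp add: stopping_times_upto_def ST_def sp)
  have payoff: "game_payoff P (C0 \<mu>C \<sigma>C W) (deriv R) (deriv G) (\<mu>C + \<mu>F) cp cm fC T t y \<sigma> \<tau> = \<Psi> (T - t) y \<sigma> \<tau>"
    if t: "0 \<le> t" "t \<le> T" and y: "0 < y" and s: "\<sigma> \<in> ST (T - t)" "\<tau> \<in> ST (T - t)" for t y \<sigma> \<tau>
  proof -
    let ?g = "\<lambda>\<omega>. cp / fC * exp (- (\<mu>C + \<mu>F) * \<sigma> \<omega>) * of_bool (\<sigma> \<omega> \<le> \<tau> \<omega>) * of_bool (\<sigma> \<omega> < T - t)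
         + cm / fC * exp (- (\<mu>C + \<mu>F) * \<tau> \<omega>) * of_bool (\<tau> \<omega> < \<sigma> \<omega>)
         + exp (- (\<mu>C + \<mu>F) * (T - t)) * deriv G (y * C0 \<mu>C \<sigma>C W (T - t) \<omega>) * of_bool (\<tau> \<omega> = T - t \<and> \<sigma> \<omega> = T - t)
         + (LINT s:{0..min (\<tau> \<omega>) (\<sigma> \<omega>)}|lborel. exp (- (\<mu>C + \<mu>F) * s) * deriv R (y * C0 \<mu>C \<sigma>C W s \<omega>))"
    \<comment> \<open>Off \<open>N\<close> the process \<open>exp ?Z\<close> is \<open>C0\<close>,
      so the two payoffs agree pointwise.\<close>
    have eq: "?g \<omega> = pay (T - t) y \<sigma> \<tau> \<omega>" if \<omega>: "\<omega> \<in> space M" "\<omega> \<notin> N" for \<omega>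
    proof -
      have C: "C0 \<mu>C \<sigma>C W s \<omega> = exp (?Z s \<omega>)" for s
        using \<omega> by (simp add: C0_def W_tilde_def m_def)
      have b': "0 \<le> \<sigma> \<omega>" "\<sigma> \<omega> \<le> T - t" "0 \<le> \<tau> \<omega>" "\<tau> \<omega> \<le> T - t"
        using ST_D s \<omega> sp by auto
      have I: "(LINT s:{0..min (\<tau> \<omega>) (\<sigma> \<omega>)}|lborel. exp (- (\<mu>C + \<mu>F) * s) * deriv R (y * C0 \<mu>C \<sigma>C W s \<omega>)) =
          (LINT s:{0..min (\<tau> \<omega>) (\<sigma> \<omega>)}|lborel. rate y s \<omega>)"
      proof (rule set_lebesgue_integral_cong)
        show "\<forall>s. s \<in> {0..min (\<tau> \<omega>) (\<sigma> \<omega>)} \<longrightarrow> exp (- (\<mu>C + \<mu>F) * s) * deriv R (y * C0 \<mu>C \<sigma>C W s \<omega>) = rate y s \<omega>"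
          unfolding r_def[symmetric] rate_def C using b' t by (auto simp: Zc_eq)
      qed simp
      have dG: "deriv G (y * C0 \<mu>C \<sigma>C W (T - t) \<omega>) = a"
        unfolding a_def using y by (intro deriv_affine_eq[where G=G and ?G0.0=G0] G(2)) (auto simp: C0_def)
      show ?thesis
        unfolding I dG pay_def using b' by (auto simp: a_def b_def r_def)
    qed
    have int: "pay (T - t) y \<sigma> \<tau> \<in> borel_measurable P"
      using t s y by (intro borel_measurable_integrable pay_integrable) auto
    \<comment> \<open>\<open>integral_cong_AE\<close> asks for measurability of both sides; it is
      obtained in the complete space \<open>M\<close> and carried to \<open>P\<close>, which has the
      same sets.\<close>
    have g: "?g \<in> borel_measurable P"
    proof -
      have "pay (T - t) y \<sigma> \<tau> \<in> borel_measurable M" using int sets by (simp cong: measurable_cong_sets)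
      then have "?g \<in> borel_measurable M" using N(1) eq by (rule CM.measurable_modification)
      then show ?thesis using sets by (simp cong: measurable_cong_sets)
    qed
    show ?thesis
      unfolding game_payoff_def \<Psi>_def
    proof (rule integral_cong_AE[OF g int])
      show "AE \<omega> in P. ?g \<omega> = pay (T - t) y \<sigma> \<tau> \<omega>"
        using AE_not_in[OF N(2)] AE_space by eventually_elim (use eq sp in simp)
    qed
  qed
  interpret stopping_game P \<F> ?Z m \<sigma>C T "deriv R" r a b "R 1" V
  proof
    fix h y :: real assume h: "0 \<le> h" "h \<le> T" and y: "0 < y"
    let ?G = "game_payoff P (C0 \<mu>C \<sigma>C W) (deriv R) (deriv G) (\<mu>C + \<mu>F) cp cm fC T (T - h) y"
    have pay_eq: "?G \<sigma> \<tau> = \<Psi> h y \<sigma> \<tau>" if "\<sigma> \<in> ST h" "\<tau> \<in> ST h" for \<sigma> \<tau>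
      using payoff[of "T - h" y \<sigma> \<tau>] h y that by simp
    have "v (T - h) y = (INF \<sigma>\<in>ST h. SUP \<tau>\<in>ST h. ?G \<sigma> \<tau>) \<and> v (T - h) y = (SUP \<tau>\<in>ST h. INF \<sigma>\<in>ST h. ?G \<sigma> \<tau>)"
      using v[unfolded is_game_value_def ST, rule_format, of "T - h" y] h y by simp
    moreover have "(INF \<sigma>\<in>ST h. SUP \<tau>\<in>ST h. ?G \<sigma> \<tau>) = (INF \<sigma>\<in>ST h. SUP \<tau>\<in>ST h. \<Psi> h y \<sigma> \<tau>)"
      by (intro INF_cong SUP_cong refl pay_eq)
    moreover have "(SUP \<tau>\<in>ST h. INF \<sigma>\<in>ST h. ?G \<sigma> \<tau>) = (SUP \<tau>\<in>ST h. INF \<sigma>\<in>ST h. \<Psi> h y \<sigma> \<tau>)"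
      by (intro INF_cong SUP_cong refl pay_eq)
    ultimately show "V h y = (INF \<sigma>\<in>ST h. SUP \<tau>\<in>ST h. \<Psi> h y \<sigma> \<tau>) \<and>
        V h y = (SUP \<tau>\<in>ST h. INF \<sigma>\<in>ST h. \<Psi> h y \<sigma> \<tau>)"
      by (simp add: V_def)
  qed
  interpret stopping_game_boundaries P \<F> ?Z m \<sigma>C T "deriv R" r a b "R 1" V yp ym
    by unfold_locales (use boundaries in \<open>simp add: V_def a_def b_def\<close>)
  have lo: "0 < marginal_inverse R (r * a)" "deriv R (marginal_inverse R (r * a)) = r * a"
    using marginal(5)[of "r * a"] r ab by auto
  have hi: "0 < marginal_inverse R (r * b)" "deriv R (marginal_inverse R (r * b)) = r * b"
    using marginal(5)[of "r * b"] r ab by auto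
  have c: "(\<mu>C + \<mu>F) * cp / fC = r * b" "(\<mu>C + \<mu>F) * cm / fC = r * a"
    by (auto simp: r_def a_def b_def)
  show ?thesis
    unfolding c
    using yp_antimono ym_antimono yp_left_continuous ym_right_continuous yp_bounds[OF _ _ hi]
      yp_at_maturity lo(1) ym_bounds[OF _ _ lo] ym_at_maturity[OF lo]
    by (intro conjI ballI) auto
qed

end
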